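(* Let $X(t,x)=\sum_{\alpha=1}^{r}f_\alpha(t,x) X_\alpha(x)$ be a foliated Lie system on a manifold $N$ associated with an $r$-dimensional Vessiot--Guldberg Lie algebra $V=\langle X_1,\ldots,X_r\rangle$. Let $\phi:(g,x)\in G\times N\mapsto \phi(g,x)\in N$ be the effective local Lie group action of a Lie group $G$ obtained by integrating the vector fields of $V$ (so that $V$ is the Lie algebra of fundamental vector fields of $\phi$). Assume that the space $M=N/G$ of leaves of $\mathcal{D}^V$ admits a manifold structure for which the canonical projection $N\rightarrow N/G=M$ is a smooth submersion, and regard each $f_\alpha$ as a function on $\mathbb{R}\times M$. Define the automorphic foliated Lie system on the total space of the trivial principal bundle $\pi:G\times M\rightarrow M$ given by $$ X_\pi^R(t,g,k)=-\sum_{\alpha=1}^rf_\alpha(t,k)X^R_\alpha(g,k),\qquad \forall t\in \mathbb{R},\ \forall g\in G,\ \forall k\in M, $$ where, for each $\alpha$, $-X^R_\alpha$ and $X_\alpha$ are the fundamental vector fields associated with the same element of $T_eG$ relative to the actions $\varphi_\pi$ and $\phi$, respectively. Then each particular solution $x(t)$ of $X$ contained in the leaf indexed by $k\in M$ can be written as $$ x(t)=\phi(g(t),x(0)), $$ where $t \mapsto (g(t),k)\in G\times M$ is the particular solution of $X_\pi^R$ with $g(0)=e$.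
   Context: All structures are smooth. A $t$-dependent vector field on $N$ is a smooth map $X:\mathbb{R}\times N\to TN$ with $X(t,x)\in T_xN$; its particular solutions are the solutions of $dx/dt=X(t,x)$. $X$ is a foliated Lie system with Vessiot--Guldberg Lie algebra $V$ if $X(t,x)=\sum_{\alpha=1}^r f_\alpha(t,x)X_\alpha(x)$, where $X_1,\dots,X_r$ is a basis of an $r$-dimensional real Lie algebra $V$ of vector fields on $N$, the functions $f_\alpha\in C^\infty(\mathbb{R}\times N)$ satisfy $X_\alpha(f_\beta(t,\cdot))=0$ for all $\alpha,\beta$ and all $t$, and the distribution $\mathcal{D}^V_x=\{Y(x):Y\in V\}$ has constant rank. The leaves of $\mathcal{D}^V$ are its maximal connected integral submanifolds; each $f_\alpha(t,\cdot)$ is constant on leaves and hence can be regarded as a function on the space $M$ of leaves. The fundamental vector field of a Lie group action $\varphi:G\times N\to N$ associated with $v\in T_eG$ is defined with the sign convention $X_v(x)=\frac{d}{dt}\big|_{t=0}\varphi(\exp(-tv),x)$. The group $G$ acts on $G\times M$ by $\varphi_\pi(g_1,(g_2,k))=(g_1g_2,k)$, and $\pi(g,k)=k$. With the sign convention $X_v(x)=\frac{d}{dt}\big|_{t=0}\varphi(\exp(-tv),x)$ for fundamental vector fields, the fundamental vector field of $\varphi_\pi$ associated with $v$ is minus the right-invariant vector field on $G$ (regarded as a vertical vector field on $G\times M$) with value $v$ at $e$; hence $X^R_\alpha$ is the right-invariant vector field with $X^R_\alpha(e)=v_\alpha$, where $v_\alpha\in T_eG$ is the element whose fundamental vector field relative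 to $\phi$ is $X_\alpha$. An automorphic foliated Lie system is a $t$-dependent vector field on $G\times M$ of the form $\sum_{\alpha=1}^r h_\alpha(t,k)X^R_\alpha(g,k)$, with $X_1^R,\dots,X_r^R$ a basis of fundamental vector fields of $\varphi_\pi$ and $h_\alpha$ functions on $\mathbb{R}\times M$. Since $\phi$ may be only a local action, the formula for $x(t)$ is understood for those $t$ for which $\phi(g(t'),x(0))$ is defined for all $t'$ between $0$ and $t$. *)

theory Defs
  imports "HOL-Analysis.Analysis" "HOL-Algebra.Group"
begin

section \<open>Smooth manifolds\<close>

text \<open>
  A manifold is a topology together with a smooth atlas, with charts in a finite-dimensional normed
  space. The model space is only required to be of class \<open>real_normed_vector\<close> (and not of class
  \<open>euclidean_space\<close>) so that it may have dimension 0: the space of leaves is a point when the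
  vector fields act transitively.
\<close>

text \<open>For open \<open>S\<close> in a finite-dimensional space, \<open>Ck_on k f S\<close> is the usual \<open>C^k\<close>.\<close>

primrec Ck_on :: "nat \<Rightarrow> ('e::real_normed_vector \<Rightarrow> 'f::real_normed_vector) \<Rightarrow> 'e set \<Rightarrow> bool" where
  "Ck_on 0 f S \<longleftrightarrow> continuous_on S f"
| "Ck_on (Suc k) f S \<longleftrightarrow>
     (\<forall>x\<in>S. f differentiable (at x)) \<and> (\<forall>v. Ck_on k (\<lambda>x. frechet_derivative f (at x) v) S)"

definition smooth_on :: "('e::real_normed_vector \<Rightarrow> 'f::real_normed_vector) \<Rightarrow> 'e set \<Rightarrow> bool" where
  "smooth_on f S \<longleftrightarrow> (\<forall>k. Ck_on k f S)"

type_synonym ('a, 'e) chart = "'a set \<times> ('a \<Rightarrow> 'e)"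

abbreviation chart_inv :: "('a, 'e) chart \<Rightarrow> 'e \<Rightarrow> 'a" where
  "chart_inv c \<equiv> inv_into (fst c) (snd c)"

record ('a, 'e) manifold =
  mtop :: "'a topology"
  atlas :: "('a, 'e) chart set"

abbreviation points :: "('a, 'e) manifold \<Rightarrow> 'a set" where
  "points N \<equiv> topspace (mtop N)"

definition charts_at :: "('a, 'e) manifold \<Rightarrow> 'a \<Rightarrow> ('a, 'e) chart set" where
  "charts_at N x = {c \<in> atlas N. x \<in> fst c}"

definition smooth_manifold :: "('a, 'e::real_normed_vector) manifold \<Rightarrow> bool" where
  "smooth_manifold N \<longleftrightarrow>
     (\<exists>B::'e set. finite B \<and> span B = UNIV) \<and>
     Hausdorff_space (mtop N) \<and> second_countable (mtop N) \<and>
     (\<Union>c\<in>atlas N. fst c) = points N \<and>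
     (\<forall>c\<in>atlas N. openin (mtop N) (fst c) \<and> open (snd c ` fst c) \<and>
        homeomorphic_map (subtopology (mtop N) (fst c)) (top_of_set (snd c ` fst c)) (snd c)) \<and>
     (\<forall>c\<in>atlas N. \<forall>d\<in>atlas N. smooth_on (snd d \<circ> chart_inv c) (snd c ` (fst c \<inter> fst d)))"

definition vspace :: "('e::real_normed_vector, 'e) manifold" where
  "vspace = \<lparr>mtop = euclidean, atlas = {(UNIV, id)}\<rparr>"

definition prod_manifold ::
    "('a, 'e) manifold \<Rightarrow> ('b, 'f) manifold \<Rightarrow> ('a \<times> 'b, 'e \<times> 'f) manifold" where
  "prod_manifold M N =
     \<lparr>mtop = prod_topology (mtop M) (mtop N),
      atlas = {(fst c \<times> fst d, map_prod (snd c) (snd d)) | c d. c \<in> atlas M \<and> d \<in> atlas N}\<rparr>"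

definition smooth_map_on ::
    "'a set \<Rightarrow> ('a, 'e::real_normed_vector) manifold \<Rightarrow> ('b, 'f::real_normed_vector) manifold
       \<Rightarrow> ('a \<Rightarrow> 'b) \<Rightarrow> bool" where
  "smooth_map_on D M N f \<longleftrightarrow>
     openin (mtop M) D \<and> continuous_map (subtopology (mtop M) D) (mtop N) f \<and>
     (\<forall>c\<in>atlas M. \<forall>d\<in>atlas N.
        smooth_on (snd d \<circ> f \<circ> chart_inv c) (snd c ` {x \<in> D \<inter> fst c. f x \<in> fst d}))"

abbreviation smooth_map ::
    "('a, 'e::real_normed_vector) manifold \<Rightarrow> ('b, 'f::real_normed_vector) manifold
       \<Rightarrow> ('a \<Rightarrow> 'b) \<Rightarrow> bool" where
  "smooth_map M N \<equiv> smooth_map_on (points M) M N"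


section \<open>Tangent vectors, curves and vector fields\<close>

text \<open>
  A tangent vector at \<open>x\<close> is the family of its components in the charts at \<open>x\<close>, related by the
  differentials of the transition maps. The components at all other charts are set to 0, so that
  tangent vectors (and vector fields) are equal iff they are equal as functions, and the linear
  operations are pointwise.
\<close>

type_synonym ('a, 'e) tvec = "('a, 'e) chart \<Rightarrow> 'e"

definition tangent_space :: "('a, 'e::real_normed_vector) manifold \<Rightarrow> 'a \<Rightarrow> ('a, 'e) tvec set" where
  "tangent_space N x =
     {v. (\<forall>c. c \<notin> charts_at N x \<longrightarrow> v c = 0) \<and>
         (\<forall>c\<in>charts_at N x. \<forall>d\<in>charts_at N x.
            v d = frechet_derivative (snd d \<circ> chart_inv c) (at (snd c x)) (v c))}"

text \<open>By compatibility of the components, the choice of the chart \<open>c\<close> at \<open>x\<close> is immaterial.\<close>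

definition differential ::
    "('a, 'e::real_normed_vector) manifold \<Rightarrow> ('b, 'f::real_normed_vector) manifold
       \<Rightarrow> ('a \<Rightarrow> 'b) \<Rightarrow> 'a \<Rightarrow> ('a, 'e) tvec \<Rightarrow> ('b, 'f) tvec" where
  "differential M N f x v = (\<lambda>d.
     if d \<in> charts_at N (f x)
     then (let c = (SOME c. c \<in> charts_at M x)
           in frechet_derivative (snd d \<circ> f \<circ> chart_inv c) (at (snd c x)) (v c))
     else 0)"

definition submersion ::
    "('a, 'e::real_normed_vector) manifold \<Rightarrow> ('b, 'f::real_normed_vector) manifold
       \<Rightarrow> ('a \<Rightarrow> 'b) \<Rightarrow> bool" where
  "submersion M N f \<longleftrightarrow> smooth_map M N f \<and>
     (\<forall>x\<in>points M. differential M N f x ` tangent_space M x = tangent_space N (f x))"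

definition immersion ::
    "('a, 'e::real_normed_vector) manifold \<Rightarrow> ('b, 'f::real_normed_vector) manifold
       \<Rightarrow> ('a \<Rightarrow> 'b) \<Rightarrow> bool" where
  "immersion M N f \<longleftrightarrow> smooth_map M N f \<and>
     (\<forall>x\<in>points M. inj_on (differential M N f x) (tangent_space M x))"

definition has_velocity ::
    "('a, 'e::real_normed_vector) manifold \<Rightarrow> (real \<Rightarrow> 'a) \<Rightarrow> ('a, 'e) tvec \<Rightarrow> real \<Rightarrow> bool" where
  "has_velocity N \<gamma> v t \<longleftrightarrow>
     limitin (mtop N) \<gamma> (\<gamma> t) (at t) \<and> v \<in> tangent_space N (\<gamma> t) \<and>
     (\<forall>c\<in>charts_at N (\<gamma> t). ((snd c \<circ> \<gamma>) has_vector_derivative v c) (at t))"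

type_synonym ('a, 'e) vfield = "'a \<Rightarrow> ('a, 'e) tvec"

definition vector_field :: "('a, 'e::real_normed_vector) manifold \<Rightarrow> ('a, 'e) vfield \<Rightarrow> bool" where
  "vector_field N Y \<longleftrightarrow>
     (\<forall>x. Y x \<in> tangent_space N x) \<and>
     (\<forall>c\<in>atlas N. smooth_map_on (fst c) N vspace (\<lambda>x. Y x c))"

definition apply_vf ::
    "('a, 'e::real_normed_vector) manifold \<Rightarrow> ('a, 'e) vfield \<Rightarrow> ('a \<Rightarrow> real) \<Rightarrow> 'a \<Rightarrow> real" where
  "apply_vf N Y h x = differential N vspace h x (Y x) (UNIV, id)"

definition lie_bracket ::
    "('a, 'e::real_normed_vector) manifold \<Rightarrow> ('a, 'e) vfield \<Rightarrow> ('a, 'e) vfield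
       \<Rightarrow> ('a, 'e) vfield" where
  "lie_bracket N Y Z = (\<lambda>x c.
     if c \<in> charts_at N x
     then frechet_derivative (\<lambda>p. Z (chart_inv c p) c) (at (snd c x)) (Y x c)
        - frechet_derivative (\<lambda>p. Y (chart_inv c p) c) (at (snd c x)) (Z x c)
     else 0)"

text \<open>Particular solutions of \<open>dx/dt = X(t,x)\<close> on an open interval \<open>I\<close>.\<close>

definition particular_solution ::
    "('a, 'e::real_normed_vector) manifold \<Rightarrow> (real \<Rightarrow> ('a, 'e) vfield) \<Rightarrow> real set
       \<Rightarrow> (real \<Rightarrow> 'a) \<Rightarrow> bool" where
  "particular_solution N X I \<gamma> \<longleftrightarrow>
     open I \<and> is_interval I \<and> (\<forall>t\<in>I. has_velocity N \<gamma> (X t (\<gamma> t)) t)"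


section \<open>Foliated Lie systems and leaves\<close>

definition vf_span :: "nat \<Rightarrow> (nat \<Rightarrow> ('a, 'e::real_normed_vector) vfield) \<Rightarrow> ('a, 'e) vfield set" where
  "vf_span r Xs = {(\<lambda>x c. \<Sum>\<alpha><r. a \<alpha> *\<^sub>R Xs \<alpha> x c) | a :: nat \<Rightarrow> real. True}"

text \<open>\<open>V\<close> is a Lie algebra of vector fields on \<open>N\<close> with basis \<open>Xs 0, \<dots>, Xs (r - 1)\<close>.\<close>

definition lie_algebra_with_basis ::
    "('a, 'e::real_normed_vector) manifold \<Rightarrow> ('a, 'e) vfield set \<Rightarrow> nat
       \<Rightarrow> (nat \<Rightarrow> ('a, 'e) vfield) \<Rightarrow> bool" where
  "lie_algebra_with_basis N V r Xs \<longleftrightarrow>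
     (\<forall>\<alpha><r. vector_field N (Xs \<alpha>)) \<and>
     V = vf_span r Xs \<and>
     (\<forall>a :: nat \<Rightarrow> real. (\<forall>x c. (\<Sum>\<alpha><r. a \<alpha> *\<^sub>R Xs \<alpha> x c) = 0) \<longrightarrow> (\<forall>\<alpha><r. a \<alpha> = 0)) \<and>
     (\<forall>Y\<in>V. \<forall>Z\<in>V. lie_bracket N Y Z \<in> V)"

definition distribution :: "('a, 'e) vfield set \<Rightarrow> 'a \<Rightarrow> ('a, 'e) tvec set" where
  "distribution V x = {Y x | Y. Y \<in> V}"

text \<open>The dimension of a subspace of the tangent space is read off in any chart.\<close>

definition constant_rank ::
    "('a, 'e::real_normed_vector) manifold \<Rightarrow> ('a, 'e) vfield set \<Rightarrow> bool" where
  "constant_rank N V \<longleftrightarrow>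
     (\<exists>m. \<forall>x\<in>points N. \<forall>c\<in>charts_at N x. dim ((\<lambda>v. v c) ` distribution V x) = m)"

definition foliated_Lie_system ::
    "('a, 'e::real_normed_vector) manifold \<Rightarrow> ('a, 'e) vfield set \<Rightarrow> nat
       \<Rightarrow> (nat \<Rightarrow> ('a, 'e) vfield) \<Rightarrow> (nat \<Rightarrow> real \<Rightarrow> 'a \<Rightarrow> real)
       \<Rightarrow> (real \<Rightarrow> ('a, 'e) vfield) \<Rightarrow> bool" where
  "foliated_Lie_system N V r Xs f X \<longleftrightarrow>
     lie_algebra_with_basis N V r Xs \<and>
     (\<forall>\<alpha><r. smooth_map (prod_manifold vspace N) vspace (\<lambda>(t, x). f \<alpha> t x)) \<and>
     (\<forall>\<alpha><r. \<forall>\<beta><r. \<forall>t. \<forall>x\<in>points N. apply_vf N (Xs \<alpha>) (f \<beta> t) x = 0) \<and>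
     constant_rank N V \<and>
     X = (\<lambda>t x c. \<Sum>\<alpha><r. f \<alpha> t x *\<^sub>R Xs \<alpha> x c)"

text \<open>
  A connected integral submanifold is a nonempty subset of \<open>N\<close> with its own (in general finer)
  topology and smooth structure \<open>L\<close>, such that the inclusion is an immersion and the tangent spaces
  are those of the distribution.
\<close>

definition connected_integral_submanifold ::
    "('a, 'e::real_normed_vector) manifold \<Rightarrow> ('a, 'e) vfield set
       \<Rightarrow> ('a, 'l::real_normed_vector) manifold \<Rightarrow> bool" where
  "connected_integral_submanifold N V L \<longleftrightarrow>
     smooth_manifold L \<and> points L \<noteq> {} \<and> connected_space (mtop L) \<and>
     points L \<subseteq> points N \<and> immersion L N (\<lambda>x. x) \<and>
     (\<forall>x\<in>points L. differential L N (\<lambda>x. x) x ` tangent_space L x = distribution V x)"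

text \<open>
  The leaves, as subsets of \<open>N\<close>. The type \<open>'l\<close> is the model space of the leaves: its dimension is
  necessarily the rank of the distribution (for another \<open>'l\<close> there are no leaves).
\<close>

definition leaves ::
    "'l::real_normed_vector itself \<Rightarrow> ('a, 'e::real_normed_vector) manifold
       \<Rightarrow> ('a, 'e) vfield set \<Rightarrow> 'a set set" where
  "leaves _ N V = {points L | L :: ('a, 'l) manifold.
     connected_integral_submanifold N V L \<and>
     (\<forall>L' :: ('a, 'l) manifold.
        connected_integral_submanifold N V L' \<and> points L \<subseteq> points L' \<longrightarrow> points L' = points L)}"

definition leaf_proj :: "'a set set \<Rightarrow> 'a \<Rightarrow> 'a set" where
  "leaf_proj \<L> x = (THE k. k \<in> \<L> \<and> x \<in> k)"

text \<open>A function that is constant on the leaves, regarded as a function on the space of leaves.\<close>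

definition leaf_fun :: "('a \<Rightarrow> real) \<Rightarrow> 'a set \<Rightarrow> real" where
  "leaf_fun h k = (THE y. \<forall>x\<in>k. h x = y)"


section \<open>Lie groups and local actions\<close>

definition Lie_group :: "'g monoid \<Rightarrow> ('g, 'c::real_normed_vector) manifold \<Rightarrow> bool" where
  "Lie_group G GM \<longleftrightarrow>
     smooth_manifold GM \<and> group G \<and> carrier G = points GM \<and>
     smooth_map (prod_manifold GM GM) GM (\<lambda>(g, h). g \<otimes>\<^bsub>G\<^esub> h) \<and>
     smooth_map GM GM (\<lambda>g. inv\<^bsub>G\<^esub> g)"

text \<open>A local action need only be defined on an open neighbourhood \<open>D\<close> of \<open>{e} \<times> N\<close>.\<close>

definition local_Lie_group_action ::
    "'g monoid \<Rightarrow> ('g, 'c::real_normed_vector) manifold \<Rightarrow> ('a, 'e::real_normed_vector) manifold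
       \<Rightarrow> ('g \<times> 'a) set \<Rightarrow> ('g \<Rightarrow> 'a \<Rightarrow> 'a) \<Rightarrow> bool" where
  "local_Lie_group_action G GM N D \<phi> \<longleftrightarrow>
     smooth_map_on D (prod_manifold GM N) N (\<lambda>(g, x). \<phi> g x) \<and>
     (\<forall>x\<in>points N. (\<one>\<^bsub>G\<^esub>, x) \<in> D \<and> \<phi> \<one>\<^bsub>G\<^esub> x = x) \<and>
     (\<forall>g\<in>carrier G. \<forall>h\<in>carrier G. \<forall>x\<in>points N.
        (h, x) \<in> D \<and> (g, \<phi> h x) \<in> D \<and> (g \<otimes>\<^bsub>G\<^esub> h, x) \<in> D \<longrightarrow>
        \<phi> (g \<otimes>\<^bsub>G\<^esub> h) x = \<phi> g (\<phi> h x))"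

definition effective_action ::
    "'g monoid \<Rightarrow> ('a, 'e) manifold \<Rightarrow> ('g \<times> 'a) set \<Rightarrow> ('g \<Rightarrow> 'a \<Rightarrow> 'a) \<Rightarrow> bool" where
  "effective_action G N D \<phi> \<longleftrightarrow>
     (\<forall>g\<in>carrier G. (\<forall>x\<in>points N. (g, x) \<in> D \<and> \<phi> g x = x) \<longrightarrow> g = \<one>\<^bsub>G\<^esub>)"

text \<open>The curve \<open>\<gamma>(t) = exp(t v)\<close>.\<close>

definition one_parameter_subgroup ::
    "'g monoid \<Rightarrow> ('g, 'c::real_normed_vector) manifold \<Rightarrow> ('g, 'c) tvec \<Rightarrow> (real \<Rightarrow> 'g) \<Rightarrow> bool" where
  "one_parameter_subgroup G GM v \<gamma> \<longleftrightarrow>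
     smooth_map vspace GM \<gamma> \<and> (\<forall>s t. \<gamma> (s + t) = \<gamma> s \<otimes>\<^bsub>G\<^esub> \<gamma> t) \<and> has_velocity GM \<gamma> v 0"

text \<open>
  \<open>Y\<close> is the fundamental vector field of \<open>\<phi>\<close> associated with \<open>v\<close>:
  \<open>Y(x)\<close> is the velocity of \<open>\<phi>(exp(-t v), x)\<close> at \<open>t = 0\<close>.
\<close>

definition fundamental_vf ::
    "'g monoid \<Rightarrow> ('g, 'c::real_normed_vector) manifold \<Rightarrow> ('a, 'e::real_normed_vector) manifold
       \<Rightarrow> ('g \<Rightarrow> 'a \<Rightarrow> 'a) \<Rightarrow> ('g, 'c) tvec \<Rightarrow> ('a, 'e) vfield \<Rightarrow> bool" where
  "fundamental_vf G GM N \<phi> v Y \<longleftrightarrow>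
     v \<in> tangent_space GM \<one>\<^bsub>G\<^esub> \<and> vector_field N Y \<and>
     (\<exists>\<gamma>. one_parameter_subgroup G GM v \<gamma> \<and>
        (\<forall>x\<in>points N. has_velocity N (\<lambda>t. \<phi> (\<gamma> (- t)) x) (Y x) 0))"

text \<open>
  The action integrates \<open>V\<close>: \<open>V\<close> is the Lie algebra of fundamental vector fields, and each element
  of \<open>V\<close> is associated with exactly one element of the tangent space at the identity.
\<close>

definition integrates ::
    "'g monoid \<Rightarrow> ('g, 'c::real_normed_vector) manifold \<Rightarrow> ('a, 'e::real_normed_vector) manifold
       \<Rightarrow> ('g \<Rightarrow> 'a \<Rightarrow> 'a) \<Rightarrow> ('a, 'e) vfield set \<Rightarrow> bool" where
  "integrates G GM N \<phi> V \<longleftrightarrow>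
     V = {Y. \<exists>v. fundamental_vf G GM N \<phi> v Y} \<and>
     (\<forall>Y\<in>V. \<exists>!v. fundamental_vf G GM N \<phi> v Y)"

definition bundle_action :: "'g monoid \<Rightarrow> 'g \<Rightarrow> 'g \<times> 'k \<Rightarrow> 'g \<times> 'k" where
  "bundle_action G = (\<lambda>g\<^sub>1 (g\<^sub>2, k). (g\<^sub>1 \<otimes>\<^bsub>G\<^esub> g\<^sub>2, k))"

text \<open>The \<open>t\<close>-dependent vector field on \<open>G \<times> M\<close> with coefficients \<open>h \<alpha>\<close> on \<open>\<real> \<times> M\<close>.\<close>

definition automorphic_system ::
    "nat \<Rightarrow> (nat \<Rightarrow> real \<Rightarrow> 'k \<Rightarrow> real) \<Rightarrow> (nat \<Rightarrow> ('g \<times> 'k, 'e::real_normed_vector) vfield)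
       \<Rightarrow> real \<Rightarrow> ('g \<times> 'k, 'e) vfield" where
  "automorphic_system r h XR t = (\<lambda>(g, k) c. \<Sum>\<alpha><r. h \<alpha> t k *\<^sub>R XR \<alpha> (g, k) c)"

end

theory Submission
  imports Defs
begin

text \<open>
  Each \<open>f\<^sub>\<alpha>(t,\<cdot>)\<close> has vanishing derivative along a leaf \<open>k\<close>, hence is constant on it. A solution
  \<open>x\<close> in \<open>k\<close> is therefore an integral curve of \<open>\<Sum>\<^sub>\<alpha> a\<^sub>\<alpha>(t) X\<^sub>\<alpha>\<close> with coefficients \<open>a\<^sub>\<alpha>\<close> that depend
  only on time. The system on the fibre \<open>G \<times> {k}\<close> has the same coefficients and right-invariant
  fields \<open>W\<^sub>\<alpha>\<close>; it has a solution \<open>g\<close> with \<open>g(0) = e\<close> on the whole time interval, because right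
  translations permute its solutions. Since \<open>\<phi>(exp(-s v) g, x(0)) = \<phi>(exp(-s v), \<phi>(g, x(0)))\<close> for
  small \<open>s\<close>, the map \<open>\<phi>(\<cdot>, x(0))\<close> relates \<open>W\<^sub>\<alpha>\<close> to \<open>X\<^sub>\<alpha>\<close>, so \<open>\<phi>(g(t), x(0))\<close> solves the same equation
  on \<open>N\<close> as \<open>x(t)\<close>, and integral curves are unique.
\<close>

section \<open>Ordinary differential equations in finite-dimensional normed spaces\<close>

text \<open>Model spaces are normed spaces with a finite spanning set; completeness and continuity
  of coordinates are not part of the type. Both are replaced by a bound on coefficients with respect
  to a finite independent set: it makes coordinates continuous, turns \<open>C^1\<close> maps into
  locally Lipschitz ones, and yields a bounded retraction from a Banach space in which Picard
  iteration can run. The delicate point is the regularity of the right-invariant fields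
  \<open>W \<alpha>\<close>. They arise by differentiating the multiplication at the identity, so
  bounding their variation directly would involve second derivatives of the multiplication. Instead,
  a fundamental field of the bundle action is smooth by the definition of
  \<open>fundamental_vf\<close>, and its G-component over a fixed \<open>k\<close> is
  \<open>W \<alpha>\<close>; the Lipschitz estimate is inherited from there. Otherwise first-order
  calculus on \<open>diff_manifold\<close> suffices, a notion that passes to G x M at once. Fields
  on different manifolds are compared at one point at a time, each by one test curve built from
  exp(-s v); linearity of the differential then handles their combinations.\<close>

lemma closed_span_of_coefficient_bound:
  fixes B :: "'a::real_normed_vector set"
  assumes "finite B" and C: "\<And>u. (\<Sum>b\<in>B. \<bar>u b\<bar>) \<le> C * norm (\<Sum>b\<in>B. u b *\<^sub>R b)"
  shows "closed (span B)"
  unfolding closed_sequential_limits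
proof (intro allI impI, elim conjE)
  fix x l assume x: "\<forall>n. x n \<in> span B" and lim: "x \<longlonglongrightarrow> l"
  have "\<exists>u. x n = (\<Sum>b\<in>B. u b *\<^sub>R b)" for n
    using x span_finite[OF \<open>finite B\<close>] by (auto simp: image_iff set_eq_iff)
  then obtain u where u: "\<And>n. x n = (\<Sum>b\<in>B. u n b *\<^sub>R b)" by metis
  have "Cauchy x" using lim by (rule LIMSEQ_imp_Cauchy)
  \<comment> \<open>The bound, applied to differences of coefficient families, transfers the Cauchy
    property from \<open>x\<close> to each coefficient. The sign of \<open>C\<close> is unknown,
    hence the factor \<open>\<bar>C\<bar> + 1\<close>.\<close>
  have "Cauchy (\<lambda>n. u n b)" if "b \<in> B" for b
  proof (rule metric_CauchyI)
    fix e :: real assume "e > 0"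
    then have "e / (\<bar>C\<bar> + 1) > 0" by simp
    with \<open>Cauchy x\<close> obtain M where M: "\<And>m n. m \<ge> M \<Longrightarrow> n \<ge> M \<Longrightarrow> dist (x m) (x n) < e / (\<bar>C\<bar> + 1)"
      by (meson metric_CauchyD)
    have "dist (u m b) (u n b) < e" if "m \<ge> M" "n \<ge> M" for m n
    proof -
      have "dist (u m b) (u n b) \<le> (\<Sum>b\<in>B. \<bar>u m b - u n b\<bar>)"
        unfolding dist_real_def
        by (rule member_le_sum[where f = "\<lambda>b. \<bar>u m b - u n b\<bar>"]) (use \<open>b \<in> B\<close> \<open>finite B\<close> in auto)
      also have "\<dots> \<le> C * norm (\<Sum>b\<in>B. (u m b - u n b) *\<^sub>R b)" by (rule C)
      also have "\<dots> \<le> (\<bar>C\<bar> + 1) * dist (x m) (x n)"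
        by (auto simp: u dist_norm scaleR_left_diff_distrib sum_subtractf intro!: mult_right_mono)
      also have "\<dots> < e"
        using M[OF that] by (simp add: field_simps)
      finally show ?thesis .
    qed
    then show "\<exists>M. \<forall>m\<ge>M. \<forall>n\<ge>M. dist (u m b) (u n b) < e" by blast
  qed
  then have "\<exists>c. (\<lambda>n. u n b) \<longlonglongrightarrow> c" if "b \<in> B" for b
    using that by (meson convergent_def Cauchy_convergent_iff)
  then obtain c where "\<And>b. b \<in> B \<Longrightarrow> (\<lambda>n. u n b) \<longlonglongrightarrow> c b" by metis
  then have "x \<longlonglongrightarrow> (\<Sum>b\<in>B. c b *\<^sub>R b)"
    unfolding u by (intro tendsto_sum tendsto_scaleR tendsto_const)
  then have "l = (\<Sum>b\<in>B. c b *\<^sub>R b)" using lim LIMSEQ_unique by blast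
  then show "l \<in> span B" by (simp add: span_base span_scale span_sum)
qed

text \<open>Induction on the set. The bound for \<open>B\<close> makes its span closed, so a new
  vector \<open>a\<close> outside the span has positive distance \<open>d\<close> from it. Hence the
  coefficient of \<open>a\<close> is at most \<open>norm x / d\<close>, and the rest of
  \<open>x\<close> is controlled by the triangle inequality.\<close>

lemma independent_coefficient_bound:
  fixes B :: "'a::real_normed_vector set"
  assumes "finite B" "independent B"
  shows "\<exists>C. \<forall>u. (\<Sum>b\<in>B. \<bar>u b\<bar>) \<le> C * norm (\<Sum>b\<in>B. u b *\<^sub>R b)"
  using assms
proof (induction B rule: finite_induct)
  case (insert a B)
  then have "a \<notin> span B" "independent B"
    by (auto simp: independent_insert)
  with insert obtain C where C: "\<And>u. (\<Sum>b\<in>B. \<bar>u b\<bar>) \<le> C * norm (\<Sum>b\<in>B. u b *\<^sub>R b)" by blast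
  have "closed (span B)" by (rule closed_span_of_coefficient_bound[OF insert.hyps(1) C])
  define d where "d = infdist a (span B)"
  have "d > 0" unfolding d_def
    using \<open>a \<notin> span B\<close> \<open>closed (span B)\<close>
    by (metis in_closed_iff_infdist_zero infdist_nonneg order_le_less span_zero empty_iff)
  have d: "\<bar>s\<bar> * d \<le> norm (s *\<^sub>R a + y)" if "y \<in> span B" for s y
  proof (cases "s = 0")
    case False
    have "d \<le> dist a (- (y /\<^sub>R s))"
      unfolding d_def by (rule infdist_le) (simp add: span_neg span_scale that)
    then have "\<bar>s\<bar> * d \<le> \<bar>s\<bar> * norm (a + y /\<^sub>R s)" by (simp add: dist_norm mult_left_mono)
    also have "\<dots> = norm (s *\<^sub>R (a + y /\<^sub>R s))" by simp
    also have "s *\<^sub>R (a + y /\<^sub>R s) = s *\<^sub>R a + y" using False by (simp add: scaleR_add_right)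
    finally show ?thesis .
  qed simp
  \<comment> \<open>The term \<open>1 / d\<close> pays for the coefficient of \<open>a\<close>; the
    other one is the old constant applied to \<open>y\<close>, whose norm is at most
    \<open>(1 + norm a / d) * norm x\<close>.\<close>
  define K where "K = 1 / d + \<bar>C\<bar> * (1 + norm a / d)"
  have "(\<Sum>b\<in>insert a B. \<bar>u b\<bar>) \<le> K * norm (\<Sum>b\<in>insert a B. u b *\<^sub>R b)" for u
  proof -
    define y where "y = (\<Sum>b\<in>B. u b *\<^sub>R b)"
    define x where "x = u a *\<^sub>R a + y"
    have y: "y \<in> span B" unfolding y_def by (simp add: span_base span_scale span_sum)
    have ua: "\<bar>u a\<bar> \<le> norm x / d" using d[OF y, of "u a"] \<open>d > 0\<close> by (simp add: x_def field_simps)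
    have "norm y \<le> norm x + norm (u a *\<^sub>R a)"
      by (metis x_def add_diff_cancel_left' norm_triangle_ineq4)
    also have "\<dots> \<le> norm x + (norm x / d) * norm a"
      using mult_right_mono[OF ua, of "norm a"] by simp
    finally have "C * norm y \<le> \<bar>C\<bar> * (norm x + (norm x / d) * norm a)"
      by (meson abs_ge_self abs_ge_zero mult_mono norm_ge_zero)
    then have "\<bar>u a\<bar> + (\<Sum>b\<in>B. \<bar>u b\<bar>) \<le> K * norm x"
      using ua C[of u] unfolding y_def[symmetric] K_def by (simp add: algebra_simps)
    then show ?thesis using insert.hyps by (simp add: x_def y_def)
  qed
  then show ?case by blast
qed simp

text \<open>Coordinates with respect to a basis are linear, and the coefficient bound makes them
  continuous. Outside \<open>B'\<close> the representation is 0, so \<open>coord b\<close> is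
  meaningful for every \<open>b\<close>.\<close>

lemma finite_spanning_coordinates:
  fixes B :: "'a::real_normed_vector set"
  assumes "finite B" "span B = UNIV"
  obtains B' and coord :: "'a \<Rightarrow> 'a \<Rightarrow>\<^sub>L real"
  where "finite B'" "\<And>x. (\<Sum>b\<in>B'. coord b x *\<^sub>R b) = x"
proof -
  obtain B' where B': "B' \<subseteq> B" "independent B'" "span B' = UNIV"
    using maximal_independent_subset[of B] assms(2) by (metis span_mono span_span top.extremum_uniqueI)
  then have fin: "finite B'" using assms(1) finite_subset by blast
  then obtain C where C: "\<And>u. (\<Sum>b\<in>B'. \<bar>u b\<bar>) \<le> C * norm (\<Sum>b\<in>B'. u b *\<^sub>R b)"
    using independent_coefficient_bound B'(2) by blast
  have sum: "(\<Sum>b\<in>B'. representation B' x b *\<^sub>R b) = x" for x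
    using sum_representation_eq[OF B'(2), of x B'] B'(3) fin by auto
  have bl: "bounded_linear (\<lambda>x. representation B' x b)" for b
  proof (cases "b \<in> B'")
    case True
    show ?thesis
    proof (rule bounded_linear_intro[where K = C])
      show "norm (representation B' x b) \<le> norm x * C" for x
      proof -
        have "\<bar>representation B' x b\<bar> \<le> (\<Sum>b\<in>B'. \<bar>representation B' x b\<bar>)"
          by (rule member_le_sum[where f = "\<lambda>b. \<bar>representation B' x b\<bar>"]) (use True fin in auto)
        then show ?thesis using C[of "representation B' x"] sum[of x] by (simp add: mult.commute)
      qed
    qed (use B' in \<open>simp_all add: representation_add representation_scale\<close>)
  next
    case False
    then have "representation B' x b = 0" for x by (meson representation_ne_zero)
    then show ?thesis by simp
  qed
  have "(\<Sum>b\<in>B'. Blinfun (\<lambda>x. representation B' x b) x *\<^sub>R b) = x" for x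
    using sum[of x] bl by (simp add: bounded_linear_Blinfun_apply)
  with fin show ?thesis by (rule that)
qed

text \<open>Only the directional derivatives are known to be continuous. Near \<open>x\<close> the
  finitely many values of the derivative on basis vectors stay within 1 of their norm at
  \<open>x\<close>; bounded coordinates turn this into an operator norm bound, and the mean value
  inequality applies on a ball.\<close>

lemma locally_Lipschitz_if_C1:
  fixes f :: "'a::real_normed_vector \<Rightarrow> 'b::real_normed_vector" and B :: "'a set"
  assumes "finite B" "span B = UNIV" "open S" "x \<in> S"
    and diff: "\<And>y. y \<in> S \<Longrightarrow> f differentiable (at y)"
    and cont: "\<And>v. continuous_on S (\<lambda>y. frechet_derivative f (at y) v)"
  obtains \<delta> L where "\<delta> > 0" "L \<ge> 0" "ball x \<delta> \<subseteq> S"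
    "\<And>y z. y \<in> ball x \<delta> \<Longrightarrow> z \<in> ball x \<delta> \<Longrightarrow> norm (f y - f z) \<le> L * norm (y - z)"
proof -
  obtain B' and coord :: "'a \<Rightarrow> 'a \<Rightarrow>\<^sub>L real"
    where B': "finite B'" "\<And>x. (\<Sum>b\<in>B'. coord b x *\<^sub>R b) = x"
    using finite_spanning_coordinates[OF assms(1,2)] by blast
  let ?D = "\<lambda>y. frechet_derivative f (at y)"
  have "\<forall>\<^sub>F y in nhds x. y \<in> S \<and> (\<forall>b\<in>B'. norm (?D y b) < norm (?D x b) + 1)"
  proof (intro eventually_conj eventually_ball_finite B' ballI)
    show "\<forall>\<^sub>F y in nhds x. y \<in> S" using assms by (simp add: eventually_nhds_in_open)
    fix b
    have "isCont (\<lambda>y. norm (?D y b)) x"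
      using cont[of b] assms(3,4) by (intro continuous_norm) (simp add: continuous_on_eq_continuous_at)
    then have "((\<lambda>y. norm (?D y b)) \<longlongrightarrow> norm (?D x b)) (nhds x)"
      unfolding isCont_def by (subst (asm) tendsto_at_iff_tendsto_nhds)
    then show "\<forall>\<^sub>F y in nhds x. norm (?D y b) < norm (?D x b) + 1"
      by (rule order_tendstoD) simp
  qed
  then obtain \<delta> where \<delta>: "\<delta> > 0" and
    D: "\<And>y. y \<in> ball x \<delta> \<Longrightarrow> y \<in> S \<and> (\<forall>b\<in>B'. norm (?D y b) < norm (?D x b) + 1)"
    by (auto simp: eventually_nhds_metric dist_commute)
  define L where "L = (\<Sum>b\<in>B'. norm (coord b) * (norm (?D x b) + 1))"
  have "L \<ge> 0" unfolding L_def by (intro sum_nonneg) simp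
  have hd: "(f has_derivative ?D y) (at y)" if "y \<in> ball x \<delta>" for y
    using diff D[OF that] frechet_derivative_works by blast
  have on: "onorm (?D y) \<le> L" if "y \<in> ball x \<delta>" for y
  proof (rule onorm_bound[OF \<open>L \<ge> 0\<close>])
    fix v
    interpret bounded_linear "?D y" using hd[OF that] by (rule has_derivative_bounded_linear)
    have "?D y v = ?D y (\<Sum>b\<in>B'. coord b v *\<^sub>R b)" using B'(2)[of v] by metis
    also have "\<dots> = (\<Sum>b\<in>B'. coord b v *\<^sub>R ?D y b)"
      by (simp add: sum scaleR)
    also have "norm \<dots> \<le> (\<Sum>b\<in>B'. norm (coord b) * norm v * (norm (?D x b) + 1))"
    proof (rule sum_norm_le)
      fix b assume "b \<in> B'"
      show "norm (coord b v *\<^sub>R ?D y b) \<le> norm (coord b) * norm v * (norm (?D x b) + 1)"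
        unfolding norm_scaleR using D[OF that] \<open>b \<in> B'\<close> norm_blinfun[of "coord b" v]
        by (intro mult_mono) (auto intro: less_imp_le)
    qed
    also have "\<dots> = L * norm v" unfolding L_def sum_distrib_right by (simp add: ac_simps)
    finally show "norm (?D y v) \<le> L * norm v" .
  qed
  have "norm (f y - f z) \<le> L * norm (y - z)" if "y \<in> ball x \<delta>" "z \<in> ball x \<delta>" for y z
    by (rule differentiable_bound[where S = "ball x \<delta>" and f' = ?D])
      (use that hd on in \<open>auto intro: has_derivative_at_withinI\<close>)
  then show ?thesis using that[of \<delta> L] \<delta> D \<open>L \<ge> 0\<close> by blast
qed

section \<open>Existence of solutions by Picard iteration\<close>

lemma vector_derivative_bound:
  fixes f :: "real \<Rightarrow> 'a::real_normed_vector"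
  assumes "convex S" "s \<in> S" "t \<in> S"
    and "\<And>t. t \<in> S \<Longrightarrow> (f has_vector_derivative f' t) (at t within S)"
    and "\<And>t. t \<in> S \<Longrightarrow> norm (f' t) \<le> C"
  shows "norm (f s - f t) \<le> C * \<bar>s - t\<bar>"
  unfolding real_norm_def[symmetric]
proof (rule differentiable_bound[OF assms(1)])
  show "(f has_derivative (\<lambda>h. h *\<^sub>R f' t)) (at t within S)" if "t \<in> S" for t
    using assms(4)[OF that] by (simp add: has_vector_derivative_def)
  show "onorm (\<lambda>h. h *\<^sub>R f' t) \<le> C" if "t \<in> S" for t
    by (rule onorm_le) (use assms(5)[OF that] in \<open>simp add: mult.commute[of C] mult_left_mono\<close>)
qed fact+

text \<open>Banach's fixed point theorem for the integral operator on bounded continuous functions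
  with values in \<open>cball y\<^sub>0 R\<close>: \<open>C * \<epsilon> \<le> R\<close> keeps this
  set invariant and \<open>L * \<epsilon> < 1\<close> makes the operator a contraction.\<close>

lemma Picard_banach:
  fixes F :: "real \<Rightarrow> 'a::banach \<Rightarrow> 'a"
  assumes "\<epsilon> > 0" "R \<ge> 0" "L \<ge> 0" "C * \<epsilon> \<le> R" "L * \<epsilon> < 1"
    and cont: "continuous_on ({t\<^sub>0 - \<epsilon>..t\<^sub>0 + \<epsilon>} \<times> cball y\<^sub>0 R) (\<lambda>(t, y). F t y)"
    and bound: "\<And>t y. t \<in> {t\<^sub>0 - \<epsilon>..t\<^sub>0 + \<epsilon>} \<Longrightarrow> y \<in> cball y\<^sub>0 R \<Longrightarrow> norm (F t y) \<le> C"
    and lip: "\<And>t y z. t \<in> {t\<^sub>0 - \<epsilon>..t\<^sub>0 + \<epsilon>} \<Longrightarrow> y \<in> cball y\<^sub>0 R \<Longrightarrow> z \<in> cball y\<^sub>0 R \<Longrightarrow>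
      norm (F t y - F t z) \<le> L * norm (y - z)"
  obtains u where "u t\<^sub>0 = y\<^sub>0"
    "\<And>t. t \<in> {t\<^sub>0 - \<epsilon>..t\<^sub>0 + \<epsilon>} \<Longrightarrow> u t \<in> cball y\<^sub>0 R"
    "\<And>t. t \<in> {t\<^sub>0 - \<epsilon>..t\<^sub>0 + \<epsilon>} \<Longrightarrow> (u has_vector_derivative F t (u t)) (at t within {t\<^sub>0 - \<epsilon>..t\<^sub>0 + \<epsilon>})"
proof -
  define a b where "a = t\<^sub>0 - \<epsilon>" and "b = t\<^sub>0 + \<epsilon>"
  define S :: "(real \<Rightarrow>\<^sub>C 'a) set" where "S = PiC UNIV (\<lambda>_. cball y\<^sub>0 R)"
  have S: "u \<in> S \<longleftrightarrow> (\<forall>t. u t \<in> cball y\<^sub>0 R)" for u :: "real \<Rightarrow>\<^sub>C 'a" by (auto simp: S_def mem_PiC_iff)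
  have ab: "a < b" "t\<^sub>0 \<in> {a..b}" using \<open>\<epsilon> > 0\<close> by (auto simp: a_def b_def)
  \<comment> \<open>Clamping time to \<open>{a..b}\<close> extends curves on the interval to bounded
    continuous functions on the whole line, so that the complete space of such functions can be
    used.\<close>
  define cl where "cl = (\<lambda>t. max a (min b t))"
  have cl: "cl t \<in> {a..b}" for t using ab by (auto simp: cl_def)
  have cl_id: "cl t = t" if "t \<in> {a..b}" for t using that by (auto simp: cl_def)
  have cl_cont: "continuous_on A cl" for A unfolding cl_def by (intro continuous_intros)
  have cl_near: "\<bar>cl t - t\<^sub>0\<bar> \<le> \<epsilon>" for t using cl[of t] by (auto simp: a_def b_def abs_le_iff)
  define H where "H = (\<lambda>u :: real \<Rightarrow>\<^sub>C 'a. \<lambda>\<tau>. integral {a..\<tau>} (\<lambda>s. F s (u s)))"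
  have cont_F: "continuous_on {a..b} (\<lambda>s. F s (u s))" if "u \<in> S" for u :: "real \<Rightarrow>\<^sub>C 'a"
  proof -
    have "continuous_on {a..b} ((\<lambda>(t, y). F t y) \<circ> (\<lambda>s. (s, u s)))"
      by (rule continuous_on_compose[OF _ continuous_on_subset[OF cont]])
        (use that in \<open>auto intro!: continuous_intros simp: S a_def b_def\<close>)
    then show ?thesis by (simp add: o_def)
  qed
  have H: "(H u has_vector_derivative F t (u t)) (at t within {a..b})"
    if "u \<in> S" "t \<in> {a..b}" for u t
    unfolding H_def by (rule integral_has_vector_derivative[OF cont_F[OF that(1)] that(2)])
  have H_bound: "norm (H u s - H u t) \<le> C * \<bar>s - t\<bar>" if "u \<in> S" "s \<in> {a..b}" "t \<in> {a..b}" for u s t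
    by (rule vector_derivative_bound[OF _ that(2,3) H[OF that(1)]])
      (use that in \<open>auto simp: S a_def b_def intro: bound\<close>)
  have "C \<ge> 0" using order_trans[OF norm_ge_zero bound[of t\<^sub>0 y\<^sub>0]] assms(1,2) by simp
  \<comment> \<open>A difference of two primitives based at the left end \<open>a\<close> replaces
    an integral from \<open>t\<^sub>0\<close> to \<open>t\<close>, which would need a sign for
    \<open>t < t\<^sub>0\<close>.\<close>
  define T where "T = (\<lambda>u t. y\<^sub>0 + (H u (cl t) - H u t\<^sub>0))"
  have T_ball: "T u t \<in> cball y\<^sub>0 R" if "u \<in> S" for u t
  proof -
    have "norm (H u (cl t) - H u t\<^sub>0) \<le> C * \<bar>cl t - t\<^sub>0\<bar>" by (rule H_bound[OF that cl ab(2)])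
    also have "\<dots> \<le> C * \<epsilon>" using cl_near \<open>C \<ge> 0\<close> by (rule mult_left_mono)
    finally show ?thesis using \<open>C * \<epsilon> \<le> R\<close> by (simp add: T_def dist_norm norm_minus_commute)
  qed
  have T_bcont: "T u \<in> bcontfun" if "u \<in> S" for u
  proof (rule bcontfun_normI)
    have "continuous_on {a..b} (H u)"
      using H[OF that] has_vector_derivative_continuous continuous_on_eq_continuous_within by blast
    then have "continuous_on UNIV (H u \<circ> cl)"
      by (intro continuous_on_compose cl_cont) (use cl in \<open>auto elim: continuous_on_subset\<close>)
    then show "continuous_on UNIV (T u)" unfolding T_def by (intro continuous_intros) (simp add: o_def)
    show "norm (T u t) \<le> norm y\<^sub>0 + R" for t
      using T_ball[OF that, of t] norm_triangle_ineq2[of "T u t" y\<^sub>0] by (simp add: dist_norm norm_minus_commute)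
  qed
  have app: "apply_bcontfun (Bcontfun (T u)) = T u" if "u \<in> S" for u
    using T_bcont[OF that] by (rule Bcontfun_inverse)
  have "\<exists>!u. u \<in> S \<and> Bcontfun (T u) = u"
  proof (rule Banach_fix)
    show "complete S"
      unfolding S_def complete_eq_closed by (rule closed_PiC) simp
    have "const_bcontfun y\<^sub>0 \<in> S" using \<open>R \<ge> 0\<close> by (simp add: S const_bcontfun.rep_eq)
    then show "S \<noteq> {}" by blast
    show "0 \<le> L * \<epsilon>" using assms by simp
    show "(\<lambda>u. Bcontfun (T u)) ` S \<subseteq> S" using app T_ball by (auto simp: S)
    show "dist (Bcontfun (T u)) (Bcontfun (T w)) \<le> L * \<epsilon> * dist u w" if "u \<in> S" "w \<in> S" for u w
    proof (rule dist_bound)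
      fix t
      have "norm ((H u (cl t) - H w (cl t)) - (H u t\<^sub>0 - H w t\<^sub>0)) \<le> (L * dist u w) * \<bar>cl t - t\<^sub>0\<bar>"
      proof (rule vector_derivative_bound[where S = "{a..b}"])
        show "((\<lambda>t. H u t - H w t) has_vector_derivative (F t (u t) - F t (w t))) (at t within {a..b})"
          if "t \<in> {a..b}" for t
          by (intro derivative_intros H that \<open>u \<in> S\<close> \<open>w \<in> S\<close>)
        fix t assume "t \<in> {a..b}"
        then have "norm (F t (u t) - F t (w t)) \<le> L * dist (u t) (w t)"
          unfolding dist_norm using that by (intro lip) (auto simp: S a_def b_def)
        also have "\<dots> \<le> L * dist u w" using \<open>L \<ge> 0\<close> dist_bounded by (intro mult_left_mono)
        finally show "norm (F t (u t) - F t (w t)) \<le> L * dist u w" .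
      qed (use cl ab in auto)
      also have "\<dots> \<le> (L * dist u w) * \<epsilon>" using cl_near \<open>L \<ge> 0\<close> by (intro mult_left_mono) auto
      finally show "dist (Bcontfun (T u) t) (Bcontfun (T w) t) \<le> L * \<epsilon> * dist u w"
        unfolding app[OF that(1)] app[OF that(2)]
        by (simp add: T_def dist_norm[where 'a = 'a] algebra_simps)
    qed
  qed fact
  then obtain u where u: "u \<in> S" "Bcontfun (T u) = u" by blast
  then have uT: "apply_bcontfun u = T u" using app by metis
  have "((\<lambda>t. y\<^sub>0 + (H u t - H u t\<^sub>0)) has_vector_derivative F t (u t)) (at t within {a..b})"
    if "t \<in> {a..b}" for t
    by (auto intro!: derivative_eq_intros H that u)
  then have dT: "(T u has_vector_derivative F t (u t)) (at t within {a..b})" if "t \<in> {a..b}" for t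
    by (rule has_vector_derivative_transform[rotated 2]) (use that cl_id in \<open>auto simp: T_def\<close>)
  show ?thesis
  proof (rule that[of "T u"])
    show "T u t\<^sub>0 = y\<^sub>0" using cl_id[OF ab(2)] by (simp add: T_def)
    show "T u t \<in> cball y\<^sub>0 R" for t by (rule T_ball[OF u(1)])
    show "(T u has_vector_derivative F t (T u t)) (at t within {t\<^sub>0 - \<epsilon>..t\<^sub>0 + \<epsilon>})"
      if "t \<in> {t\<^sub>0 - \<epsilon>..t\<^sub>0 + \<epsilon>}" for t
      using dT[unfolded uT a_def b_def, OF that] .
  qed
qed

text \<open>A finite-dimensional normed space is a retract of its bidual, which is a Banach space.\<close>

lemma Picard_finite_dim:
  fixes F :: "real \<Rightarrow> 'a::real_normed_vector \<Rightarrow> 'a" and B :: "'a set"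
  assumes "finite B" "span B = UNIV" "c > 0" "\<delta> > 0" "L \<ge> 0"
    and cont: "continuous_on ({t\<^sub>0 - c..t\<^sub>0 + c} \<times> ball y\<^sub>0 \<delta>) (\<lambda>(t, y). F t y)"
    and bound: "\<And>t y. t \<in> {t\<^sub>0 - c..t\<^sub>0 + c} \<Longrightarrow> y \<in> ball y\<^sub>0 \<delta> \<Longrightarrow> norm (F t y) \<le> C"
    and lip: "\<And>t y z. t \<in> {t\<^sub>0 - c..t\<^sub>0 + c} \<Longrightarrow> y \<in> ball y\<^sub>0 \<delta> \<Longrightarrow> z \<in> ball y\<^sub>0 \<delta> \<Longrightarrow>
      norm (F t y - F t z) \<le> L * norm (y - z)"
  obtains \<epsilon> u where "\<epsilon> > 0" "u t\<^sub>0 = y\<^sub>0"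
    "\<And>t. t \<in> {t\<^sub>0 - \<epsilon><..<t\<^sub>0 + \<epsilon>} \<Longrightarrow> u t \<in> ball y\<^sub>0 \<delta>"
    "\<And>t. t \<in> {t\<^sub>0 - \<epsilon><..<t\<^sub>0 + \<epsilon>} \<Longrightarrow> (u has_vector_derivative F t (u t)) (at t)"
proof -
  obtain B' and coord :: "'a \<Rightarrow> 'a \<Rightarrow>\<^sub>L real"
    where B': "finite B'" "\<And>x. (\<Sum>b\<in>B'. coord b x *\<^sub>R b) = x"
    using finite_spanning_coordinates[OF assms(1,2)] by blast
  \<comment> \<open>Evaluation embeds the space into the dual of its dual, which is complete because
    the reals are. The map \<open>P\<close> below rebuilds a vector from its coordinates and is a
    left inverse of \<open>J\<close>.\<close>
  define J :: "'a \<Rightarrow> ('a \<Rightarrow>\<^sub>L real) \<Rightarrow>\<^sub>L real" where "J = (\<lambda>x. Blinfun (\<lambda>\<phi>. blinfun_apply \<phi> x))"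
  have J_apply: "blinfun_apply (J x) \<phi> = blinfun_apply \<phi> x" for x \<phi>
    unfolding J_def by (simp add: bounded_linear_Blinfun_apply blinfun.bounded_linear_left)
  have J_norm: "norm (J x) \<le> norm x" for x
  proof (rule norm_blinfun_bound[OF norm_ge_zero])
    show "norm (blinfun_apply (J x) \<phi>) \<le> norm x * norm \<phi>" for \<phi>
      using norm_blinfun[of \<phi> x] by (simp add: J_apply mult.commute)
  qed
  have J_diff: "J x - J y = J (x - y)" for x y
    by (rule blinfun_eqI) (simp add: J_apply blinfun.diff_left blinfun.diff_right)
  have J_cont: "continuous_on A J" for A
  proof (unfold continuous_on_iff, intro ballI allI impI)
    fix x e assume "(e :: real) > 0"
    then show "\<exists>d>0. \<forall>x'\<in>A. dist x' x < d \<longrightarrow> dist (J x') (J x) < e"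
      by (intro exI[of _ e]) (auto simp: dist_norm J_diff intro: le_less_trans[OF J_norm])
  qed
  define P :: "(('a \<Rightarrow>\<^sub>L real) \<Rightarrow>\<^sub>L real) \<Rightarrow> 'a" where "P = (\<lambda>\<Phi>. \<Sum>b\<in>B'. \<Phi> (coord b) *\<^sub>R b)"
  have P: "bounded_linear P"
    unfolding P_def
    by (intro bounded_linear_sum bounded_linear_compose[OF bounded_linear_scaleR_left]
        blinfun.bounded_linear_left)
  have PJ: "P (J x) = x" for x using B'(2)[of x] by (simp add: P_def J_apply)
  obtain K where K: "K > 0" "\<And>\<Phi>. norm (P \<Phi>) \<le> norm \<Phi> * K" using bounded_linear.pos_bounded[OF P] by blast
  have P_diff: "norm (P \<Phi> - P \<Psi>) \<le> norm (\<Phi> - \<Psi>) * K" for \<Phi> \<Psi>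
    using K(2)[of "\<Phi> - \<Psi>"] by (simp add: bounded_linear.linear[OF P] linear_diff)
  \<comment> \<open>With this radius \<open>P\<close> maps the closed ball around
    \<open>J y\<^sub>0\<close> into the open ball \<open>ball y\<^sub>0 \<delta>\<close>; the factor
    2 makes the estimate strict.\<close>
  define R where "R = \<delta> / (2 * K)"
  have "R > 0" using K \<open>\<delta> > 0\<close> by (simp add: R_def)
  have P_ball: "P \<Phi> \<in> ball y\<^sub>0 \<delta>" if "\<Phi> \<in> cball (J y\<^sub>0) R" for \<Phi>
  proof -
    have "norm (P (J y\<^sub>0) - P \<Phi>) \<le> norm (J y\<^sub>0 - \<Phi>) * K" by (rule P_diff)
    also have "\<dots> \<le> R * K" using that K by (intro mult_right_mono) (auto simp: dist_norm)
    also have "\<dots> < \<delta>" using K \<open>\<delta> > 0\<close> by (simp add: R_def)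
    finally show ?thesis by (simp add: PJ dist_norm)
  qed
  have "C \<ge> 0" using order_trans[OF norm_ge_zero bound[of t\<^sub>0 y\<^sub>0]] assms(3,4) by simp
  \<comment> \<open>The three entries keep time inside the given interval, yield
    \<open>C * \<epsilon> \<le> R\<close>, and yield \<open>L * K * \<epsilon> < 1\<close>; adding 1
    avoids division by zero.\<close>
  define \<epsilon> where "\<epsilon> = min c (min (R / (C + 1)) (1 / (2 * (L * K + 1))))"
  have "L * K \<ge> 0" using K \<open>L \<ge> 0\<close> by simp
  have \<epsilon>: "\<epsilon> > 0" "\<epsilon> \<le> c"
    using \<open>c > 0\<close> \<open>R > 0\<close> \<open>C \<ge> 0\<close> \<open>L * K \<ge> 0\<close> by (auto simp: \<epsilon>_def add_nonneg_pos)
  have "C * \<epsilon> \<le> (C + 1) * (R / (C + 1))"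
    using \<open>C \<ge> 0\<close> \<epsilon>(1) by (intro mult_mono) (auto simp: \<epsilon>_def)
  then have C\<epsilon>: "C * \<epsilon> \<le> R" using \<open>C \<ge> 0\<close> by simp
  have "L * K * \<epsilon> \<le> L * K * (1 / (2 * (L * K + 1)))"
    using \<open>L * K \<ge> 0\<close> by (intro mult_left_mono) (auto simp: \<epsilon>_def)
  also have "\<dots> < 1" using \<open>L * K \<ge> 0\<close> by (simp add: field_simps add_strict_increasing2)
  finally have L\<epsilon>: "L * K * \<epsilon> < 1" .
  have sub: "t \<in> {t\<^sub>0 - c..t\<^sub>0 + c}" if "t \<in> {t\<^sub>0 - \<epsilon>..t\<^sub>0 + \<epsilon>}" for t using that \<epsilon> by auto
  have "continuous_on ({t\<^sub>0 - \<epsilon>..t\<^sub>0 + \<epsilon>} \<times> cball (J y\<^sub>0) R) (J \<circ> ((\<lambda>(t, y). F t y) \<circ> (\<lambda>(t, \<Phi>). (t, P \<Phi>))))"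
  proof (intro continuous_on_compose J_cont continuous_on_subset[OF cont])
    show "continuous_on ({t\<^sub>0 - \<epsilon>..t\<^sub>0 + \<epsilon>} \<times> cball (J y\<^sub>0) R) (\<lambda>(t, \<Phi>). (t, P \<Phi>))"
      unfolding case_prod_beta by (intro continuous_intros bounded_linear.continuous_on[OF P])
  qed (use sub P_ball in \<open>auto simp del: mem_cball mem_ball\<close>)
  then have contJ: "continuous_on ({t\<^sub>0 - \<epsilon>..t\<^sub>0 + \<epsilon>} \<times> cball (J y\<^sub>0) R) (\<lambda>(t, \<Phi>). J (F t (P \<Phi>)))"
    by (simp add: o_def case_prod_beta)
  obtain w where w: "w t\<^sub>0 = J y\<^sub>0" "\<And>t. t \<in> {t\<^sub>0 - \<epsilon>..t\<^sub>0 + \<epsilon>} \<Longrightarrow> w t \<in> cball (J y\<^sub>0) R"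
    "\<And>t. t \<in> {t\<^sub>0 - \<epsilon>..t\<^sub>0 + \<epsilon>} \<Longrightarrow>
       (w has_vector_derivative J (F t (P (w t)))) (at t within {t\<^sub>0 - \<epsilon>..t\<^sub>0 + \<epsilon>})"
  proof (rule Picard_banach[OF \<epsilon>(1) less_imp_le[OF \<open>R > 0\<close>] \<open>L * K \<ge> 0\<close> C\<epsilon> L\<epsilon> contJ])
    fix t \<Phi> assume t: "t \<in> {t\<^sub>0 - \<epsilon>..t\<^sub>0 + \<epsilon>}" and \<Phi>: "\<Phi> \<in> cball (J y\<^sub>0) R"
    show "norm (J (F t (P \<Phi>))) \<le> C"
      using J_norm bound[OF sub[OF t] P_ball[OF \<Phi>]] order_trans by blast
    fix \<Psi> assume \<Psi>: "\<Psi> \<in> cball (J y\<^sub>0) R"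
    have "norm (J (F t (P \<Phi>)) - J (F t (P \<Psi>))) \<le> norm (F t (P \<Phi>) - F t (P \<Psi>))"
      unfolding J_diff by (rule J_norm)
    also have "\<dots> \<le> L * norm (P \<Phi> - P \<Psi>)" by (rule lip[OF sub[OF t] P_ball[OF \<Phi>] P_ball[OF \<Psi>]])
    also have "\<dots> \<le> L * (norm (\<Phi> - \<Psi>) * K)" using P_diff \<open>L \<ge> 0\<close> by (rule mult_left_mono)
    finally show "norm (J (F t (P \<Phi>)) - J (F t (P \<Psi>))) \<le> L * K * norm (\<Phi> - \<Psi>)" by (simp add: ac_simps)
  qed (use that in blast)
  have "((\<lambda>t. P (w t)) has_vector_derivative F t (P (w t))) (at t)"
    if "t \<in> {t\<^sub>0 - \<epsilon><..<t\<^sub>0 + \<epsilon>}" for t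
  proof -
    have "at t within {t\<^sub>0 - \<epsilon>..t\<^sub>0 + \<epsilon>} = at t"
      using that by (simp add: at_within_Icc_at)
    then have "(w has_vector_derivative J (F t (P (w t)))) (at t)" using w(3)[of t] that by simp
    from bounded_linear.has_vector_derivative[OF P this] show ?thesis by (simp add: PJ)
  qed
  then show ?thesis
    using that[of \<epsilon> "\<lambda>t. P (w t)"] \<epsilon>(1) w(1) P_ball w(2) by (simp add: PJ)
qed

section \<open>Differentiable maps between manifolds\<close>

text \<open>The first-order part of the structure: charts that are homeomorphisms onto open sets,
  with differentiable transitions. It passes to products without any computation of higher
  derivatives. Continuity of \<open>chart_inv\<close> is demanded separately because
  \<open>inv_into\<close> is arbitrary off the image of the chart.\<close>

definition diff_manifold :: "('a, 'e::real_normed_vector) manifold \<Rightarrow> bool" where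
  "diff_manifold N \<longleftrightarrow>
     (\<Union>c\<in>atlas N. fst c) = points N \<and>
     (\<forall>c\<in>atlas N. openin (mtop N) (fst c) \<and> open (snd c ` fst c) \<and> inj_on (snd c) (fst c) \<and>
        continuous_map (subtopology (mtop N) (fst c)) euclidean (snd c) \<and>
        continuous_map (top_of_set (snd c ` fst c)) (mtop N) (chart_inv c)) \<and>
     (\<forall>c\<in>atlas N. \<forall>d\<in>atlas N. \<forall>x\<in>fst c \<inter> fst d.
        (\<lambda>y. snd d (chart_inv c y)) differentiable (at (snd c x)))"

lemma smooth_onD:
  assumes "smooth_on f S"
  shows "x \<in> S \<Longrightarrow> f differentiable (at x)"
    and "continuous_on S (\<lambda>x. frechet_derivative f (at x) v)"
proof -
  have "Ck_on (Suc 0) f S" using assms unfolding smooth_on_def by blast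
  then show "x \<in> S \<Longrightarrow> f differentiable (at x)" "continuous_on S (\<lambda>x. frechet_derivative f (at x) v)"
    by simp_all
qed

lemma diff_manifold_if_smooth:
  assumes "smooth_manifold N"
  shows "diff_manifold N"
  unfolding diff_manifold_def
proof (intro conjI ballI)
  show "(\<Union>c\<in>atlas N. fst c) = points N" using assms by (simp add: smooth_manifold_def)
  fix c assume c: "c \<in> atlas N"
  with assms have open_c: "openin (mtop N) (fst c)" "open (snd c ` fst c)"
    and homeo: "homeomorphic_map (subtopology (mtop N) (fst c)) (top_of_set (snd c ` fst c)) (snd c)"
    by (simp_all add: smooth_manifold_def)
  have top: "points N \<inter> fst c = fst c" using openin_subset[OF open_c(1)] by blast
  show "openin (mtop N) (fst c)" "open (snd c ` fst c)" by fact+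
  show inj: "inj_on (snd c) (fst c)"
    using homeomorphic_imp_injective_map[OF homeo] top by simp
  show "continuous_map (subtopology (mtop N) (fst c)) euclidean (snd c)"
    using homeomorphic_imp_continuous_map[OF homeo] by (simp add: continuous_map_in_subtopology)
  obtain g where g: "homeomorphic_maps (subtopology (mtop N) (fst c)) (top_of_set (snd c ` fst c)) (snd c) g"
    using homeo homeomorphic_map_maps by blast
  then have "continuous_map (top_of_set (snd c ` fst c)) (mtop N) g"
    by (simp add: homeomorphic_maps_def continuous_map_in_subtopology)
  moreover have "g y = chart_inv c y" if "y \<in> snd c ` fst c" for y
    using that g top inj by (auto simp: homeomorphic_maps_def)
  ultimately show "continuous_map (top_of_set (snd c ` fst c)) (mtop N) (chart_inv c)"
    by (auto intro: continuous_map_eq)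
  fix d x assume "d \<in> atlas N" "x \<in> fst c \<inter> fst d"
  with assms c have "smooth_on (snd d \<circ> chart_inv c) (snd c ` (fst c \<inter> fst d))"
    by (simp add: smooth_manifold_def)
  from smooth_onD(1)[OF this, of "snd c x"] \<open>x \<in> fst c \<inter> fst d\<close>
  show "(\<lambda>y. snd d (chart_inv c y)) differentiable (at (snd c x))" by (simp add: o_def)
qed

lemma chart_at:
  assumes "diff_manifold N" "c \<in> charts_at N x"
  shows "c \<in> atlas N" "x \<in> fst c" "openin (mtop N) (fst c)" "open (snd c ` fst c)"
    "inj_on (snd c) (fst c)" "chart_inv c (snd c x) = x" "x \<in> points N"
  using assms by (auto simp: diff_manifold_def charts_at_def)

lemma ex_chart_at:
  assumes "diff_manifold N" "x \<in> points N"
  shows "\<exists>c. c \<in> charts_at N x"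
  using assms unfolding diff_manifold_def charts_at_def by blast

lemma some_chart_at:
  assumes "diff_manifold N" "x \<in> points N"
  shows "(SOME c. c \<in> charts_at N x) \<in> charts_at N x"
  by (rule someI_ex[OF ex_chart_at[OF assms]])

text \<open>Continuity of the inverse chart pulls a neighbourhood of \<open>x\<close> back to the
  model space. The last two conjuncts record that \<open>chart_inv\<close> is a genuine inverse near
  the point, which derivatives require.\<close>

lemma eventually_chart_inv:
  assumes "diff_manifold N" "c \<in> charts_at N x" "openin (mtop N) U" "x \<in> U"
  shows "\<forall>\<^sub>F y in nhds (snd c x). chart_inv c y \<in> U \<and> chart_inv c y \<in> fst c \<and> snd c (chart_inv c y) = y"
proof -
  note c = chart_at[OF assms(1,2)]
  have "continuous_map (top_of_set (snd c ` fst c)) (mtop N) (chart_inv c)"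
    using assms(1) c(1) by (simp add: diff_manifold_def)
  from openin_continuous_map_preimage[OF this assms(3)]
  have "open {y \<in> snd c ` fst c. chart_inv c y \<in> U}"
    using c(4) openin_open_eq by force
  moreover have "snd c x \<in> {y \<in> snd c ` fst c. chart_inv c y \<in> U}"
    using c assms(4) by simp
  ultimately have "\<forall>\<^sub>F y in nhds (snd c x). y \<in> {y \<in> snd c ` fst c. chart_inv c y \<in> U}"
    by (rule eventually_nhds_in_open)
  then show ?thesis by eventually_elim (auto simp: inv_into_into f_inv_into_f c(5))
qed

lemma tendsto_chart:
  assumes "diff_manifold N" "limitin (mtop N) \<gamma> x F" "c \<in> charts_at N x"
  shows "((\<lambda>t. snd c (\<gamma> t)) \<longlongrightarrow> snd c x) F"
proof (rule topological_tendstoI)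
  note c = chart_at[OF assms(1,3)]
  fix U assume U: "open U" "snd c x \<in> U"
  have "continuous_map (subtopology (mtop N) (fst c)) euclidean (snd c)"
    using assms(1) c(1) by (simp add: diff_manifold_def)
  from openin_continuous_map_preimage[OF this, of U] U
  have "openin (subtopology (mtop N) (fst c)) {y \<in> points N \<inter> fst c. snd c y \<in> U}" by simp
  then have "openin (mtop N) {y \<in> points N \<inter> fst c. snd c y \<in> U}"
    using c(3) openin_trans_full by blast
  from limitinD[OF assms(2) this] show "\<forall>\<^sub>F t in F. snd c (\<gamma> t) \<in> U"
    using U c by (auto elim: eventually_mono)
qed

text \<open>Differentiability is required of all chart representations, so that no compatibility argument is
  needed to change charts.\<close>

definition mdiff ::
    "('a, 'e::real_normed_vector) manifold \<Rightarrow> ('b, 'f::real_normed_vector) manifold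
       \<Rightarrow> ('a \<Rightarrow> 'b) \<Rightarrow> 'a \<Rightarrow> bool" where
  "mdiff M N F p \<longleftrightarrow> p \<in> points M \<and> F p \<in> points N \<and>
     (\<forall>V. openin (mtop N) V \<and> F p \<in> V \<longrightarrow> (\<exists>U. openin (mtop M) U \<and> p \<in> U \<and> (\<forall>q\<in>U. F q \<in> V))) \<and>
     (\<forall>c\<in>charts_at M p. \<forall>d\<in>charts_at N (F p).
        (\<lambda>y. snd d (F (chart_inv c y))) differentiable (at (snd c p)))"

lemma mdiff_if_smooth_map_on:
  assumes "smooth_map_on D M N F" "p \<in> D"
  shows "mdiff M N F p"
  unfolding mdiff_def
proof (intro conjI allI impI ballI)
  have D: "openin (mtop M) D" and cont: "continuous_map (subtopology (mtop M) D) (mtop N) F"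
    using assms(1) by (simp_all add: smooth_map_on_def)
  show "p \<in> points M" using D assms(2) openin_subset by blast
  have top: "points M \<inter> D = D" using openin_subset[OF D] by blast
  then show "F p \<in> points N" using cont assms(2) by (auto simp: continuous_map_def)
  fix V assume V: "openin (mtop N) V \<and> F p \<in> V"
  have "openin (mtop M) {q \<in> D. F q \<in> V}"
    using openin_continuous_map_preimage[OF cont, of V] V D top openin_trans_full by force
  then show "\<exists>U. openin (mtop M) U \<and> p \<in> U \<and> (\<forall>q\<in>U. F q \<in> V)"
    using V assms(2) by (intro exI[of _ "{q \<in> D. F q \<in> V}"]) auto
next
  fix c d assume "c \<in> charts_at M p" "d \<in> charts_at N (F p)"
  then have "smooth_on (snd d \<circ> F \<circ> chart_inv c) (snd c ` {x \<in> D \<inter> fst c. F x \<in> fst d})"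
    "snd c p \<in> snd c ` {x \<in> D \<inter> fst c. F x \<in> fst d}"
    using assms by (auto simp: smooth_map_on_def charts_at_def)
  then show "(\<lambda>y. snd d (F (chart_inv c y))) differentiable (at (snd c p))"
    using smooth_onD(1) by (fastforce simp: o_def)
qed

lemma limitin_mdiff:
  assumes "mdiff M N F p" "limitin (mtop M) \<gamma> p Fl"
  shows "limitin (mtop N) (\<lambda>t. F (\<gamma> t)) (F p) Fl"
  unfolding limitin_def
proof (intro conjI allI impI)
  show "F p \<in> points N" using assms(1) by (simp add: mdiff_def)
  fix V assume "openin (mtop N) V \<and> F p \<in> V"
  then obtain U where U: "openin (mtop M) U" "p \<in> U" "\<And>q. q \<in> U \<Longrightarrow> F q \<in> V"
    using assms(1) by (metis mdiff_def)
  show "\<forall>\<^sub>F t in Fl. F (\<gamma> t) \<in> V"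
    using limitinD[OF assms(2) U(1,2)] by eventually_elim (rule U(3))
qed

text \<open>Near \<open>x\<close> the composite factors as \<open>H \<circ> chart_inv d\<close>
  after \<open>snd d \<circ> f\<close>, so this is the chain rule in model spaces. The third
  assumption is what allows the factorisation on a whole neighbourhood.\<close>

lemma has_derivative_through_chart:
  assumes "diff_manifold N" "d \<in> charts_at N (f x)" "\<forall>\<^sub>F y in at x. f y \<in> fst d"
    and "((\<lambda>y. snd d (f y)) has_derivative f') (at x)"
    and "((\<lambda>z. H (chart_inv d z)) has_derivative H') (at (snd d (f x)))"
  shows "((\<lambda>y. H (f y)) has_derivative (\<lambda>h. H' (f' h))) (at x)"
proof (rule has_derivative_transform_eventually)
  note d = chart_at[OF assms(1,2)]
  show "((\<lambda>y. H (chart_inv d (snd d (f y)))) has_derivative (\<lambda>h. H' (f' h))) (at x)"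
    using diff_chain_at[OF assms(4,5)] by (simp add: o_def)
  show "\<forall>\<^sub>F y in at x. H (chart_inv d (snd d (f y))) = H (f y)"
    using assms(3) by eventually_elim (simp add: d)
  show "H (chart_inv d (snd d (f x))) = H (f x)" by (simp add: d)
qed simp

lemma transition_has_derivative:
  assumes "diff_manifold N" "c \<in> charts_at N x" "d \<in> charts_at N x"
  shows "((\<lambda>y. snd d (chart_inv c y)) has_derivative
          frechet_derivative (\<lambda>y. snd d (chart_inv c y)) (at (snd c x))) (at (snd c x))"
  using assms by (auto simp: diff_manifold_def charts_at_def frechet_derivative_works)

lemma mdiff_has_derivative:
  assumes "mdiff M N F p" "c \<in> charts_at M p" "d \<in> charts_at N (F p)"
  shows "((\<lambda>y. snd d (F (chart_inv c y))) has_derivative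
          frechet_derivative (\<lambda>y. snd d (F (chart_inv c y))) (at (snd c p))) (at (snd c p))"
  using assms by (auto simp: mdiff_def frechet_derivative_works)

lemma mdiff_through_chart:
  assumes "diff_manifold M" "diff_manifold N" "mdiff M N F p" "c \<in> charts_at M p" "d \<in> charts_at N (F p)"
    and "((\<lambda>z. H (chart_inv d z)) has_derivative H') (at (snd d (F p)))"
  shows "((\<lambda>y. H (F (chart_inv c y))) has_derivative
    (\<lambda>h. H' (frechet_derivative (\<lambda>y. snd d (F (chart_inv c y))) (at (snd c p)) h))) (at (snd c p))"
proof (rule has_derivative_through_chart[OF assms(2), where d = d])
  note c = chart_at[OF assms(1,4)] and d = chart_at[OF assms(2,5)]
  show "d \<in> charts_at N (F (chart_inv c (snd c p)))" using assms c by simp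
  obtain U where U: "openin (mtop M) U" "p \<in> U" "\<And>q. q \<in> U \<Longrightarrow> F q \<in> fst d"
    using assms(3) d(2,3) by (metis mdiff_def)
  show "\<forall>\<^sub>F y in at (snd c p). F (chart_inv c y) \<in> fst d"
    using eventually_chart_inv[OF assms(1,4) U(1,2)] unfolding eventually_nhds_conv_at
    by (auto elim: eventually_mono intro: U(3))
  show "((\<lambda>y. snd d (F (chart_inv c y))) has_derivative
    frechet_derivative (\<lambda>y. snd d (F (chart_inv c y))) (at (snd c p))) (at (snd c p))"
    by (rule mdiff_has_derivative[OF assms(3-5)])
  show "((\<lambda>z. H (chart_inv d z)) has_derivative H') (at (snd d (F (chart_inv c (snd c p)))))"
    using assms(6) c by simp
qed

lemma mdiff_compose:
  assumes "diff_manifold M" "diff_manifold N" "mdiff M N F p" "mdiff N P H (F p)"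
  shows "mdiff M P (\<lambda>q. H (F q)) p"
  unfolding mdiff_def
proof (intro conjI allI impI ballI)
  show "p \<in> points M" "H (F p) \<in> points P" using assms by (auto simp: mdiff_def)
  fix V assume "openin (mtop P) V \<and> H (F p) \<in> V"
  then obtain U where U: "openin (mtop N) U" "F p \<in> U" "\<And>q. q \<in> U \<Longrightarrow> H q \<in> V"
    using assms(4) by (metis mdiff_def)
  obtain W where W: "openin (mtop M) W" "p \<in> W" "\<And>q. q \<in> W \<Longrightarrow> F q \<in> U"
    using assms(3) U by (metis mdiff_def)
  then show "\<exists>W. openin (mtop M) W \<and> p \<in> W \<and> (\<forall>q\<in>W. H (F q) \<in> V)" using U by blast
next
  fix c e assume c: "c \<in> charts_at M p" and e: "e \<in> charts_at P (H (F p))"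
  obtain d where d: "d \<in> charts_at N (F p)" using assms(2,3) ex_chart_at by (metis mdiff_def)
  from mdiff_through_chart[OF assms(1-3) c d mdiff_has_derivative[OF assms(4) d e]]
  show "(\<lambda>y. snd e (H (F (chart_inv c y)))) differentiable (at (snd c p))"
    unfolding differentiable_def by blast
qed

section \<open>Differentials, tangent vectors and velocities of curves\<close>

lemma differential_apply:
  assumes "d \<in> charts_at N (F p)"
  shows "differential M N F p v d = frechet_derivative (\<lambda>y. snd d (F (chart_inv (SOME c. c \<in> charts_at M p) y)))
           (at (snd (SOME c. c \<in> charts_at M p) p)) (v (SOME c. c \<in> charts_at M p))"
  using assms by (simp add: differential_def Let_def o_def)

text \<open>The vector \<open>v\<close> is arbitrary: \<open>differential\<close> reads only its
  component in one chosen chart, and the chain rule makes the resulting components compatible. This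
  also allows tangent vectors to be built from a single prescribed component.\<close>

lemma differential_in_tangent_space:
  assumes "diff_manifold M" "diff_manifold N" "mdiff M N F p"
  shows "differential M N F p v \<in> tangent_space N (F p)"
  unfolding tangent_space_def
proof (intro CollectI conjI allI impI ballI)
  fix d assume "d \<notin> charts_at N (F p)"
  then show "differential M N F p v d = 0" by (simp add: differential_def)
next
  fix d e assume d: "d \<in> charts_at N (F p)" and e: "e \<in> charts_at N (F p)"
  have c: "(SOME c. c \<in> charts_at M p) \<in> charts_at M p"
    using assms(1,3) by (simp add: some_chart_at mdiff_def)
  from frechet_derivative_at[OF mdiff_through_chart[OF assms c d transition_has_derivative[OF assms(2) d e]]]
  show "differential M N F p v e =
      frechet_derivative (snd e \<circ> chart_inv d) (at (snd d (F p))) (differential M N F p v d)"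
    by (simp add: differential_apply d e o_def fun_eq_iff)
qed

lemma differential_sum:
  assumes "diff_manifold M" "mdiff M N F p"
  shows "differential M N F p (\<lambda>c. \<Sum>\<alpha>\<in>A. a \<alpha> *\<^sub>R v \<alpha> c) = (\<lambda>d. \<Sum>\<alpha>\<in>A. a \<alpha> *\<^sub>R differential M N F p (v \<alpha>) d)"
proof
  fix d
  show "differential M N F p (\<lambda>c. \<Sum>\<alpha>\<in>A. a \<alpha> *\<^sub>R v \<alpha> c) d = (\<Sum>\<alpha>\<in>A. a \<alpha> *\<^sub>R differential M N F p (v \<alpha>) d)"
  proof (cases "d \<in> charts_at N (F p)")
    case True
    have c: "(SOME c. c \<in> charts_at M p) \<in> charts_at M p"
      using assms by (simp add: some_chart_at mdiff_def)
    let ?c = "SOME c. c \<in> charts_at M p"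
    interpret bounded_linear "frechet_derivative (\<lambda>y. snd d (F (chart_inv ?c y))) (at (snd ?c p))"
      by (rule has_derivative_bounded_linear) (rule mdiff_has_derivative[OF assms(2) c True])
    show ?thesis
      by (simp add: differential_apply True sum scaleR)
  qed (simp add: differential_def)
qed

lemma tangent_space_off_chart: "v \<in> tangent_space N x \<Longrightarrow> c \<notin> charts_at N x \<Longrightarrow> v c = 0"
  unfolding tangent_space_def by blast

lemma tangent_space_transition:
  "v \<in> tangent_space N x \<Longrightarrow> c \<in> charts_at N x \<Longrightarrow> d \<in> charts_at N x \<Longrightarrow>
    v d = frechet_derivative (\<lambda>y. snd d (chart_inv c y)) (at (snd c x)) (v c)"
  unfolding tangent_space_def o_def by blast

lemma has_velocityD:
  assumes "has_velocity N \<gamma> v t"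
  shows "limitin (mtop N) \<gamma> (\<gamma> t) (at t)" "v \<in> tangent_space N (\<gamma> t)" "\<gamma> t \<in> points N"
    "c \<in> charts_at N (\<gamma> t) \<Longrightarrow> ((\<lambda>s. snd c (\<gamma> s)) has_vector_derivative v c) (at t)"
  using assms by (auto simp: has_velocity_def o_def limitin_topspace)

lemma has_vector_derivative_through_chart:
  assumes "diff_manifold N" "limitin (mtop N) \<gamma> (\<gamma> t) (at t)" "c \<in> charts_at N (\<gamma> t)"
    and "((\<lambda>s. snd c (\<gamma> s)) has_vector_derivative w) (at t)"
    and "((\<lambda>z. H (chart_inv c z)) has_derivative H') (at (snd c (\<gamma> t)))"
  shows "((\<lambda>s. H (\<gamma> s)) has_vector_derivative H' w) (at t)"
proof -
  note c = chart_at[OF assms(1,3)]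
  interpret H': bounded_linear H' using assms(5) by (rule has_derivative_bounded_linear)
  have "((\<lambda>s. H (\<gamma> s)) has_derivative (\<lambda>h. H' (h *\<^sub>R w))) (at t)"
    by (rule has_derivative_through_chart[OF assms(1,3) limitinD[OF assms(2) c(3,2)]])
      (use assms(4,5) in \<open>simp_all add: has_vector_derivative_def\<close>)
  then show ?thesis by (simp add: has_vector_derivative_def H'.scaleR)
qed

text \<open>One chart is enough: the transition map carries the derivative to any other chart
  exactly as the components of a tangent vector transform.\<close>

lemma has_velocity_if_chart:
  assumes "diff_manifold N" "limitin (mtop N) \<gamma> (\<gamma> t) (at t)" "v \<in> tangent_space N (\<gamma> t)"
    and c: "c \<in> charts_at N (\<gamma> t)" "((\<lambda>s. snd c (\<gamma> s)) has_vector_derivative v c) (at t)"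
  shows "has_velocity N \<gamma> v t"
  unfolding has_velocity_def
proof (intro conjI ballI)
  fix d assume d: "d \<in> charts_at N (\<gamma> t)"
  have "v d = frechet_derivative (\<lambda>y. snd d (chart_inv c y)) (at (snd c (\<gamma> t))) (v c)"
    by (rule tangent_space_transition[OF assms(3) c(1) d])
  then show "((snd d \<circ> \<gamma>) has_vector_derivative v d) (at t)"
    using has_vector_derivative_through_chart[OF assms(1,2) c transition_has_derivative[OF assms(1) c(1) d]]
    by (simp add: o_def)
qed fact+

lemma has_velocity_compose:
  assumes "diff_manifold M" "diff_manifold N" "mdiff M N F (\<gamma> t)" "has_velocity M \<gamma> v t"
  shows "has_velocity N (\<lambda>s. F (\<gamma> s)) (differential M N F (\<gamma> t) v) t"
  unfolding has_velocity_def
proof (intro conjI ballI)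
  note v = has_velocityD[OF assms(4)]
  show "limitin (mtop N) (\<lambda>s. F (\<gamma> s)) (F (\<gamma> t)) (at t)" by (rule limitin_mdiff[OF assms(3) v(1)])
  show "differential M N F (\<gamma> t) v \<in> tangent_space N (F (\<gamma> t))"
    by (rule differential_in_tangent_space[OF assms(1-3)])
  fix d assume d: "d \<in> charts_at N (F (\<gamma> t))"
  have c: "(SOME c. c \<in> charts_at M (\<gamma> t)) \<in> charts_at M (\<gamma> t)"
    by (rule some_chart_at[OF assms(1) v(3)])
  show "((snd d \<circ> (\<lambda>s. F (\<gamma> s))) has_vector_derivative differential M N F (\<gamma> t) v d) (at t)"
    using has_vector_derivative_through_chart[OF assms(1) v(1) c v(4)[OF c]
        mdiff_has_derivative[OF assms(3) c d]]
    by (simp add: differential_apply d o_def)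
qed

text \<open>Derivatives determine the components in charts at the point, and the convention that all
  other components vanish makes the two vectors equal as functions.\<close>

lemma has_velocity_unique:
  assumes "has_velocity N \<gamma> v t" "has_velocity N \<gamma> w t"
  shows "v = w"
proof
  fix c show "v c = w c"
  proof (cases "c \<in> charts_at N (\<gamma> t)")
    case True
    then show ?thesis using has_velocityD(4)[OF assms(1)] has_velocityD(4)[OF assms(2)]
      by (meson vector_derivative_unique_at)
  next
    case False
    then show ?thesis
      using tangent_space_off_chart has_velocityD(2)[OF assms(1)] has_velocityD(2)[OF assms(2)] by metis
  qed
qed

lemma has_velocity_cong:
  assumes "has_velocity N \<gamma> v t" "\<forall>\<^sub>F s in at t. \<gamma> s = \<eta> s" "\<gamma> t = \<eta> t"
  shows "has_velocity N \<eta> v t"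
  unfolding has_velocity_def
proof (intro conjI ballI)
  note v = has_velocityD[OF assms(1)]
  show "limitin (mtop N) \<eta> (\<eta> t) (at t)"
    using limitin_transform_eventually[OF assms(2) v(1)] assms(3) by simp
  show "v \<in> tangent_space N (\<eta> t)" using v(2) assms(3) by simp
  fix c assume "c \<in> charts_at N (\<eta> t)"
  then have "((\<lambda>s. snd c (\<gamma> s)) has_derivative (\<lambda>h. h *\<^sub>R v c)) (at t)"
    using v(4) assms(3) by (simp add: has_vector_derivative_def)
  then have "((\<lambda>s. snd c (\<eta> s)) has_derivative (\<lambda>h. h *\<^sub>R v c)) (at t)"
    by (rule has_derivative_transform_eventually) (use assms(2,3) in \<open>auto elim: eventually_mono\<close>)
  then show "((snd c \<circ> \<eta>) has_vector_derivative v c) (at t)"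
    by (simp add: has_vector_derivative_def o_def)
qed

text \<open>Provides the initial velocity of exp(-t v), which the sign convention for fundamental
  fields calls for.\<close>

lemma has_velocity_reflect:
  assumes "diff_manifold N" "has_velocity N \<gamma> v 0"
  shows "has_velocity N (\<lambda>t. \<gamma> (- t)) (\<lambda>c. - v c) 0"
  unfolding has_velocity_def
proof (intro conjI ballI)
  note v = has_velocityD[OF assms(2)]
  have "filterlim (\<lambda>t :: real. - t) (at 0) (at 0)"
    unfolding filterlim_at by (auto simp: eventually_at_filter intro!: tendsto_eq_intros)
  then show "limitin (mtop N) (\<lambda>t. \<gamma> (- t)) (\<gamma> (- 0)) (at 0)"
    using v(1) unfolding limitin_def by (auto simp: filterlim_iff)
  show "(\<lambda>c. - v c) \<in> tangent_space N (\<gamma> (- 0))"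
    unfolding tangent_space_def
  proof (intro CollectI conjI allI impI ballI)
    fix c assume "c \<notin> charts_at N (\<gamma> (- 0))"
    then show "- v c = 0" using tangent_space_off_chart v(2) by fastforce
  next
    fix c d assume c: "c \<in> charts_at N (\<gamma> (- 0))" and d: "d \<in> charts_at N (\<gamma> (- 0))"
    interpret D: bounded_linear "frechet_derivative (\<lambda>y. snd d (chart_inv c y)) (at (snd c (\<gamma> (- 0))))"
      by (rule has_derivative_bounded_linear) (rule transition_has_derivative[OF assms(1) c d])
    show "- v d = frechet_derivative (snd d \<circ> chart_inv c) (at (snd c (\<gamma> (- 0)))) (- v c)"
      unfolding o_def using D.neg[of "v c"] tangent_space_transition[OF v(2), of c d] c d by simp
  qed
  fix c assume "c \<in> charts_at N (\<gamma> (- 0))"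
  then have "((\<lambda>s. snd c (\<gamma> s)) has_vector_derivative v c) (at (- 0))" using v(4) by simp
  from vector_diff_chain_at[of uminus "-1" 0 "\<lambda>s. snd c (\<gamma> s)" "v c", OF _ this]
  show "((snd c \<circ> (\<lambda>t. \<gamma> (- t))) has_vector_derivative - v c) (at 0)"
    by (simp add: o_def has_vector_derivative_minus[OF has_vector_derivative_id])
qed

text \<open>One test curve per index computes the differential of \<open>F\<close> on
  \<open>W \<alpha>\<close> at the point \<open>g t\<close>; by linearity this fixes its value on
  the velocity of \<open>g\<close>. It is applied to right translations, to the inclusion of a fibre
  into G x M, to the projection to G, and to the orbit map of \<open>x 0\<close>.\<close>

lemma has_velocity_pushforward:
  assumes "diff_manifold M" "diff_manifold N" "mdiff M N F (g t)"
    and g: "has_velocity M g (\<lambda>c. \<Sum>\<alpha>\<in>A. a \<alpha> *\<^sub>R W \<alpha> c) t"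
    and rel: "\<And>\<alpha>. \<alpha> \<in> A \<Longrightarrow>
      \<exists>\<sigma>. \<sigma> 0 = g t \<and> has_velocity M \<sigma> (W \<alpha>) 0 \<and> has_velocity N (\<lambda>s. F (\<sigma> s)) (Y \<alpha>) 0"
  shows "has_velocity N (\<lambda>s. F (g s)) (\<lambda>c. \<Sum>\<alpha>\<in>A. a \<alpha> *\<^sub>R Y \<alpha> c) t"
proof -
  have "differential M N F (g t) (W \<alpha>) = Y \<alpha>" if \<alpha>: "\<alpha> \<in> A" for \<alpha>
  proof -
    obtain \<sigma> where \<sigma>: "\<sigma> 0 = g t" "has_velocity M \<sigma> (W \<alpha>) 0" "has_velocity N (\<lambda>s. F (\<sigma> s)) (Y \<alpha>) 0"
      using rel[OF \<alpha>] by blast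
    have "mdiff M N F (\<sigma> 0)" using assms(3) \<sigma>(1) by simp
    from has_velocity_compose[OF assms(1,2) this \<sigma>(2)] \<sigma>(1,3) show ?thesis
      using has_velocity_unique by metis
  qed
  then have "differential M N F (g t) (\<lambda>c. \<Sum>\<alpha>\<in>A. a \<alpha> *\<^sub>R W \<alpha> c) = (\<lambda>c. \<Sum>\<alpha>\<in>A. a \<alpha> *\<^sub>R Y \<alpha> c)"
    by (simp add: differential_sum[OF assms(1,3)])
  then show ?thesis using has_velocity_compose[OF assms(1-3) g] by simp
qed

section \<open>Products of manifolds\<close>

lemma differentiable_cong_nhds:
  assumes "\<forall>\<^sub>F y in nhds x. f y = g y" "f differentiable (at x)"
  shows "g differentiable (at x)"
proof -
  obtain f' where "(f has_derivative f') (at x)" using assms(2) unfolding differentiable_def by blast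
  then have "(g has_derivative f') (at x)"
    by (rule has_derivative_transform_eventually)
      (use assms(1) in \<open>auto simp: eventually_nhds_conv_at\<close>)
  then show ?thesis unfolding differentiable_def by blast
qed

abbreviation prod_chart :: "('a, 'e) chart \<Rightarrow> ('b, 'f) chart \<Rightarrow> ('a \<times> 'b, 'e \<times> 'f) chart" where
  "prod_chart c d \<equiv> (fst c \<times> fst d, map_prod (snd c) (snd d))"

lemma mtop_prod_manifold [simp]: "mtop (prod_manifold M N) = prod_topology (mtop M) (mtop N)"
  by (simp add: prod_manifold_def)

lemma prod_chart_in_atlas:
  "c \<in> atlas M \<Longrightarrow> d \<in> atlas N \<Longrightarrow> prod_chart c d \<in> atlas (prod_manifold M N)"
  unfolding prod_manifold_def by (simp only: manifold.select_convs) blast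

lemma atlas_prodE:
  assumes "e \<in> atlas (prod_manifold M N)"
  obtains c d where "c \<in> atlas M" "d \<in> atlas N" "e = prod_chart c d"
  using assms by (auto simp: prod_manifold_def)

lemma prod_chart_at:
  "c \<in> charts_at M p \<Longrightarrow> d \<in> charts_at N q \<Longrightarrow> prod_chart c d \<in> charts_at (prod_manifold M N) (p, q)"
  using prod_chart_in_atlas by (fastforce simp: charts_at_def)

lemma charts_at_prodE:
  assumes "e \<in> charts_at (prod_manifold M N) (p, q)"
  obtains c d where "c \<in> charts_at M p" "d \<in> charts_at N q" "e = prod_chart c d"
proof -
  have "e \<in> atlas (prod_manifold M N)" using assms by (simp add: charts_at_def)
  then obtain c d where "c \<in> atlas M" "d \<in> atlas N" "e = prod_chart c d" by (rule atlas_prodE)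
  moreover from this have "c \<in> charts_at M p" "d \<in> charts_at N q" using assms by (simp_all add: charts_at_def)
  ultimately show ?thesis using that by blast
qed

lemma prod_chart_inv:
  assumes "inj_on (snd c) (fst c)" "inj_on (snd d) (fst d)" "y \<in> snd c ` fst c" "z \<in> snd d ` fst d"
  shows "chart_inv (prod_chart c d) (y, z) = (chart_inv c y, chart_inv d z)"
proof (rule inv_into_f_eq)
  show "inj_on (snd (prod_chart c d)) (fst (prod_chart c d))"
    using map_prod_inj_on[OF assms(1,2)] by simp
qed (use assms(3,4) in \<open>auto simp: inv_into_into f_inv_into_f\<close>)

lemma prod_chart_image: "snd (prod_chart c d) ` fst (prod_chart c d) = (snd c ` fst c) \<times> (snd d ` fst d)"
  by force

text \<open>\<open>inv_into\<close> is unspecified off the image of a chart, so the two sides can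
  only be compared near the point. That is enough for differentiability there.\<close>

lemma eventually_prod_chart_inv:
  assumes "diff_manifold M" "diff_manifold N" "c \<in> charts_at M p" "d \<in> charts_at N q"
  shows "\<forall>\<^sub>F w in nhds (snd c p, snd d q).
    chart_inv (prod_chart c d) w = (chart_inv c (fst w), chart_inv d (snd w))"
proof -
  note c = chart_at[OF assms(1,3)] and d = chart_at[OF assms(2,4)]
  have "\<forall>\<^sub>F w in nhds (snd c p, snd d q). w \<in> (snd c ` fst c) \<times> (snd d ` fst d)"
    using c d by (intro eventually_nhds_in_open open_Times) auto
  then show ?thesis
    by eventually_elim (use prod_chart_inv[OF c(5) d(5)] in \<open>auto simp del: fst_conv snd_conv simp: fst_def snd_def\<close>)
qed

lemma diff_manifold_prod:
  assumes M: "diff_manifold M" and N: "diff_manifold N"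
  shows "diff_manifold (prod_manifold M N)"
  unfolding diff_manifold_def
proof (intro conjI ballI)
  show "(\<Union>e\<in>atlas (prod_manifold M N). fst e) = points (prod_manifold M N)"
  proof (intro equalityI subsetI)
    fix x assume "x \<in> (\<Union>e\<in>atlas (prod_manifold M N). fst e)"
    then obtain e where "e \<in> atlas (prod_manifold M N)" "x \<in> fst e" by blast
    moreover from this(1) obtain c d where "c \<in> atlas M" "d \<in> atlas N" "e = prod_chart c d"
      by (rule atlas_prodE)
    moreover from this have "fst c \<subseteq> points M" "fst d \<subseteq> points N"
      using M N by (simp_all add: diff_manifold_def openin_subset)
    ultimately show "x \<in> points (prod_manifold M N)" by auto
  next
    fix x assume "x \<in> points (prod_manifold M N)"
    then obtain p q where x: "x = (p, q)" "p \<in> points M" "q \<in> points N" by auto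
    then obtain c d where "c \<in> charts_at M p" "d \<in> charts_at N q" using M N ex_chart_at by meson
    then have "prod_chart c d \<in> charts_at (prod_manifold M N) x" unfolding x(1) by (rule prod_chart_at)
    then show "x \<in> (\<Union>e\<in>atlas (prod_manifold M N). fst e)" unfolding charts_at_def by blast
  qed
  fix e assume "e \<in> atlas (prod_manifold M N)"
  then obtain c d where c: "c \<in> atlas M" and d: "d \<in> atlas N" and e: "e = prod_chart c d" by (rule atlas_prodE)
  have c': "openin (mtop M) (fst c)" "open (snd c ` fst c)" "inj_on (snd c) (fst c)"
    "continuous_map (subtopology (mtop M) (fst c)) euclidean (snd c)"
    "continuous_map (top_of_set (snd c ` fst c)) (mtop M) (chart_inv c)"
    and d': "openin (mtop N) (fst d)" "open (snd d ` fst d)" "inj_on (snd d) (fst d)"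
    "continuous_map (subtopology (mtop N) (fst d)) euclidean (snd d)"
    "continuous_map (top_of_set (snd d ` fst d)) (mtop N) (chart_inv d)"
    using M N c d by (auto simp: diff_manifold_def)
  show "openin (mtop (prod_manifold M N)) (fst e)"
    using c' d' by (simp add: e openin_prod_Times_iff)
  show "open (snd e ` fst e)" unfolding e prod_chart_image using c' d' by (intro open_Times)
  show "inj_on (snd e) (fst e)" using map_prod_inj_on[OF c'(3) d'(3)] by (simp add: e)
  have "continuous_map (prod_topology (subtopology (mtop M) (fst c)) (subtopology (mtop N) (fst d)))
      (prod_topology euclidean euclidean) (\<lambda>(x, y). (snd c x, snd d y))"
    using c'(4) d'(4) by (simp only: continuous_map_prod_top simp_thms)
  then show "continuous_map (subtopology (mtop (prod_manifold M N)) (fst e)) euclidean (snd e)"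
    by (simp add: e subtopology_Times map_prod_def)
  have "continuous_map (prod_topology (top_of_set (snd c ` fst c)) (top_of_set (snd d ` fst d)))
      (prod_topology (mtop M) (mtop N)) (\<lambda>(x, y). (chart_inv c x, chart_inv d y))"
    using c'(5) d'(5) by (simp only: continuous_map_prod_top simp_thms)
  then show "continuous_map (top_of_set (snd e ` fst e)) (mtop (prod_manifold M N)) (chart_inv e)"
    unfolding e prod_chart_image mtop_prod_manifold prod_topology_subtopology_eu
    by (rule continuous_map_eq) (use prod_chart_inv[OF c'(3) d'(3)] in auto)
  fix e' x assume "e' \<in> atlas (prod_manifold M N)" and x: "x \<in> fst e \<inter> fst e'"
  from this(1) obtain c2 d2 where c2: "c2 \<in> atlas M" and d2: "d2 \<in> atlas N" and e': "e' = prod_chart c2 d2"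
    by (rule atlas_prodE)
  obtain p q where pq: "x = (p, q)" by (cases x)
  with x c d c2 d2 have at: "c \<in> charts_at M p" "d \<in> charts_at N q" "c2 \<in> charts_at M p" "d2 \<in> charts_at N q"
    by (auto simp: e e' charts_at_def)
  have "(\<lambda>w. (snd c2 (chart_inv c (fst w)), snd d2 (chart_inv d (snd w)))) differentiable (at (snd c p, snd d q))"
    unfolding differentiable_def
    using has_derivative_Pair[OF
        has_derivative_compose[OF has_derivative_fst[OF has_derivative_ident], of "\<lambda>y. snd c2 (chart_inv c y)"]
        has_derivative_compose[OF has_derivative_snd[OF has_derivative_ident], of "\<lambda>y. snd d2 (chart_inv d y)"]]
      transition_has_derivative[OF M at(1,3)] transition_has_derivative[OF N at(2,4)]
    by fastforce
  then show "(\<lambda>w. snd e' (chart_inv e w)) differentiable (at (snd e x))"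
    unfolding e e' pq snd_conv map_prod_simp
    by (rule differentiable_cong_nhds[rotated])
      (use eventually_prod_chart_inv[OF M N at(1,2)] in \<open>auto elim: eventually_mono\<close>)
qed

lemma mdiff_fst:
  assumes M: "diff_manifold M" and N: "diff_manifold N" and "p \<in> points M" "q \<in> points N"
  shows "mdiff (prod_manifold M N) M fst (p, q)"
  unfolding mdiff_def
proof (intro conjI allI impI ballI)
  fix V assume "openin (mtop M) V \<and> fst (p, q) \<in> V"
  then show "\<exists>U. openin (mtop (prod_manifold M N)) U \<and> (p, q) \<in> U \<and> (\<forall>w\<in>U. fst w \<in> V)"
    using assms(4) by (intro exI[of _ "V \<times> points N"]) (auto simp: openin_prod_Times_iff)
next
  fix e c2 assume "e \<in> charts_at (prod_manifold M N) (p, q)" and c2: "c2 \<in> charts_at M (fst (p, q))"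
  from this(1) obtain c d where c: "c \<in> charts_at M p" and d: "d \<in> charts_at N q" and e: "e = prod_chart c d"
    by (rule charts_at_prodE)
  have "(\<lambda>w. snd c2 (chart_inv c (fst w))) differentiable (at (snd c p, snd d q))"
    unfolding differentiable_def
    using has_derivative_compose[OF has_derivative_fst[OF has_derivative_ident], of "\<lambda>y. snd c2 (chart_inv c y)"]
      transition_has_derivative[OF M c, of c2] c2
    by fastforce
  then show "(\<lambda>w. snd c2 (fst (chart_inv e w))) differentiable (at (snd e (p, q)))"
    unfolding e snd_conv map_prod_simp
    by (rule differentiable_cong_nhds[rotated])
      (use eventually_prod_chart_inv[OF M N c d] in \<open>auto elim: eventually_mono\<close>)
qed (use assms in auto)

lemma mdiff_Pair_left:
  assumes M: "diff_manifold M" and "p \<in> points M" "q \<in> points N"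
  shows "mdiff M (prod_manifold M N) (\<lambda>x. (x, q)) p"
  unfolding mdiff_def
proof (intro conjI allI impI ballI)
  fix V assume V: "openin (mtop (prod_manifold M N)) V \<and> (p, q) \<in> V"
  then obtain U W where "openin (mtop M) U" "p \<in> U" "q \<in> W" "U \<times> W \<subseteq> V"
    unfolding mtop_prod_manifold openin_prod_topology_alt by blast
  then show "\<exists>U. openin (mtop M) U \<and> p \<in> U \<and> (\<forall>x\<in>U. (x, q) \<in> V)" by blast
next
  fix c e assume c: "c \<in> charts_at M p" and e: "e \<in> charts_at (prod_manifold M N) (p, q)"
  from e obtain c2 d2 where c2: "c2 \<in> charts_at M p" and e: "e = prod_chart c2 d2"
    by (rule charts_at_prodE)
  show "(\<lambda>y. snd e (chart_inv c y, q)) differentiable (at (snd c p))"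
    unfolding e snd_conv map_prod_simp differentiable_def
    using has_derivative_Pair[OF transition_has_derivative[OF M c c2] has_derivative_const] by blast
qed (use assms in auto)

lemma mdiff_Pair_right:
  assumes N: "diff_manifold N" and "p \<in> points M" "q \<in> points N"
  shows "mdiff N (prod_manifold M N) (\<lambda>x. (p, x)) q"
  unfolding mdiff_def
proof (intro conjI allI impI ballI)
  fix V assume V: "openin (mtop (prod_manifold M N)) V \<and> (p, q) \<in> V"
  then obtain U W where "openin (mtop N) W" "p \<in> U" "q \<in> W" "U \<times> W \<subseteq> V"
    unfolding mtop_prod_manifold openin_prod_topology_alt by blast
  then show "\<exists>U. openin (mtop N) U \<and> q \<in> U \<and> (\<forall>x\<in>U. (p, x) \<in> V)" by blast
next
  fix d e assume d: "d \<in> charts_at N q" and e: "e \<in> charts_at (prod_manifold M N) (p, q)"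
  from e obtain c2 d2 where d2: "d2 \<in> charts_at N q" and e: "e = prod_chart c2 d2"
    by (rule charts_at_prodE)
  show "(\<lambda>y. snd e (p, chart_inv d y)) differentiable (at (snd d q))"
    unfolding e snd_conv map_prod_simp differentiable_def
    using has_derivative_Pair[OF has_derivative_const transition_has_derivative[OF N d d2]] by blast
qed (use assms in auto)

lemma charts_at_vspace: "charts_at vspace x = {(UNIV, id)}"
  by (auto simp: charts_at_def vspace_def)

lemma mtop_vspace [simp]: "mtop vspace = euclidean"
  by (simp add: vspace_def)

lemma diff_manifold_vspace: "diff_manifold vspace"
  by (simp add: diff_manifold_def vspace_def inv_id[unfolded id_def] id_def)

lemma mdiff_slice_left:
  assumes "diff_manifold M" "diff_manifold N" "smooth_map_on D (prod_manifold M N) P (\<lambda>(x, y). F x y)"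
    and "(p, q) \<in> D"
  shows "mdiff M P (\<lambda>x. F x q) p"
proof -
  have F: "mdiff (prod_manifold M N) P (\<lambda>(x, y). F x y) (p, q)"
    by (rule mdiff_if_smooth_map_on[OF assms(3,4)])
  then have "p \<in> points M" "q \<in> points N" by (auto simp: mdiff_def)
  from mdiff_compose[OF assms(1) diff_manifold_prod[OF assms(1,2)] mdiff_Pair_left[OF assms(1) this] F]
  show ?thesis by simp
qed

lemma mdiff_slice_right:
  assumes "diff_manifold M" "diff_manifold N" "smooth_map_on D (prod_manifold M N) P (\<lambda>(x, y). F x y)"
    and "(p, q) \<in> D"
  shows "mdiff N P (\<lambda>y. F p y) q"
proof -
  have F: "mdiff (prod_manifold M N) P (\<lambda>(x, y). F x y) (p, q)"
    by (rule mdiff_if_smooth_map_on[OF assms(3,4)])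
  then have "p \<in> points M" "q \<in> points N" by (auto simp: mdiff_def)
  from mdiff_compose[OF assms(2) diff_manifold_prod[OF assms(1,2)] mdiff_Pair_right[OF assms(2) this] F]
  show ?thesis by simp
qed

section \<open>Integral curves on manifolds\<close>

text \<open>The common regularity of smooth fields and of right-invariant fields, whose estimate is
  inherited from G x M. It is what the uniqueness and local existence arguments consume.\<close>

definition loc_Lipschitz_field ::
    "('a, 'e::real_normed_vector) manifold \<Rightarrow> ('a, 'e) vfield \<Rightarrow> bool" where
  "loc_Lipschitz_field N Y \<longleftrightarrow>
     (\<forall>p\<in>points N. \<forall>c\<in>charts_at N p. \<exists>\<delta>>0. \<exists>L\<ge>0. ball (snd c p) \<delta> \<subseteq> snd c ` fst c \<and>
        (\<forall>y\<in>ball (snd c p) \<delta>. \<forall>z\<in>ball (snd c p) \<delta>.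
           norm (Y (chart_inv c y) c - Y (chart_inv c z) c) \<le> L * norm (y - z)))"

text \<open>Phrased for \<open>diff_manifold\<close> with a finite spanning set of the model space,
  so that it also covers the product G x M.\<close>

lemma vector_field_chart_Lipschitz:
  fixes N :: "('a, 'e::real_normed_vector) manifold"
  assumes fin: "\<exists>B :: 'e set. finite B \<and> span B = UNIV" and N: "diff_manifold N"
    and Y: "vector_field N Y" and c: "c \<in> charts_at N p"
  shows "\<exists>\<delta>>0. \<exists>L\<ge>0. ball (snd c p) \<delta> \<subseteq> snd c ` fst c \<and>
        (\<forall>y\<in>ball (snd c p) \<delta>. \<forall>z\<in>ball (snd c p) \<delta>.
           norm (Y (chart_inv c y) c - Y (chart_inv c z) c) \<le> L * norm (y - z))"
proof -
  note c' = chart_at[OF N c]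
  obtain B :: "'e set" where B: "finite B" "span B = UNIV" using fin by blast
  have "smooth_map_on (fst c) N vspace (\<lambda>x. Y x c)" using Y c' by (simp add: vector_field_def)
  then have "\<forall>c'\<in>atlas N. smooth_on (id \<circ> (\<lambda>x. Y x c) \<circ> chart_inv c') (snd c' ` {x \<in> fst c \<inter> fst c'. Y x c \<in> UNIV})"
    by (simp add: smooth_map_on_def vspace_def)
  then have smooth: "smooth_on (\<lambda>y. Y (chart_inv c y) c) (snd c ` fst c)"
    using c'(1) by (auto simp: o_def)
  show ?thesis
    by (rule locally_Lipschitz_if_C1[OF B c'(4) imageI[OF c'(2)] smooth_onD(1)[OF smooth] smooth_onD(2)[OF smooth]])
      blast+
qed

lemma loc_Lipschitz_field_if_vector_field:
  assumes "smooth_manifold N" "vector_field N Y"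
  shows "loc_Lipschitz_field N Y"
  unfolding loc_Lipschitz_field_def
  using vector_field_chart_Lipschitz[OF _ diff_manifold_if_smooth[OF assms(1)] assms(2)] assms(1)
  unfolding smooth_manifold_def by blast

lemma loc_Lipschitz_fields_uniform:
  assumes "finite A" "\<And>\<alpha>. \<alpha> \<in> A \<Longrightarrow> loc_Lipschitz_field N (Y \<alpha>)" "diff_manifold N" "c \<in> charts_at N p"
  shows "\<exists>\<delta>>0. \<exists>L\<ge>0. ball (snd c p) \<delta> \<subseteq> snd c ` fst c \<and>
        (\<forall>\<alpha>\<in>A. \<forall>y\<in>ball (snd c p) \<delta>. \<forall>z\<in>ball (snd c p) \<delta>.
           norm (Y \<alpha> (chart_inv c y) c - Y \<alpha> (chart_inv c z) c) \<le> L * norm (y - z))"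
  using assms(1,2)
proof (induction A rule: finite_induct)
  case empty
  have "open (snd c ` fst c)" "snd c p \<in> snd c ` fst c" using chart_at[OF assms(3,4)] by auto
  then obtain \<delta> where "\<delta> > 0" "ball (snd c p) \<delta> \<subseteq> snd c ` fst c" using open_contains_ball by blast
  then show ?case by (intro exI[of _ \<delta>] conjI exI[of _ 0]) auto
next
  case (insert \<beta> A)
  then obtain \<delta> L where 1: "\<delta> > 0" "L \<ge> 0" "ball (snd c p) \<delta> \<subseteq> snd c ` fst c"
    "\<forall>\<alpha>\<in>A. \<forall>y\<in>ball (snd c p) \<delta>. \<forall>z\<in>ball (snd c p) \<delta>.
           norm (Y \<alpha> (chart_inv c y) c - Y \<alpha> (chart_inv c z) c) \<le> L * norm (y - z)" by blast
  have "p \<in> points N" using chart_at[OF assms(3,4)] by simp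
  then obtain \<delta>' L' where 2: "\<delta>' > 0" "L' \<ge> 0"
    "\<forall>y\<in>ball (snd c p) \<delta>'. \<forall>z\<in>ball (snd c p) \<delta>'.
           norm (Y \<beta> (chart_inv c y) c - Y \<beta> (chart_inv c z) c) \<le> L' * norm (y - z)"
    using insert.prems[of \<beta>] assms(4) unfolding loc_Lipschitz_field_def by blast
  define \<epsilon> where "\<epsilon> = min \<delta> \<delta>'"
  define K where "K = max L L'"
  have "norm (Y \<alpha> (chart_inv c y) c - Y \<alpha> (chart_inv c z) c) \<le> K * norm (y - z)"
    if "\<alpha> \<in> insert \<beta> A" "y \<in> ball (snd c p) \<epsilon>" "z \<in> ball (snd c p) \<epsilon>" for \<alpha> y z
  proof -
    have yz: "y \<in> ball (snd c p) \<delta>" "z \<in> ball (snd c p) \<delta>" "y \<in> ball (snd c p) \<delta>'" "z \<in> ball (snd c p) \<delta>'"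
      using that by (auto simp: \<epsilon>_def)
    have "norm (Y \<alpha> (chart_inv c y) c - Y \<alpha> (chart_inv c z) c) \<le> L * norm (y - z) \<or>
      norm (Y \<alpha> (chart_inv c y) c - Y \<alpha> (chart_inv c z) c) \<le> L' * norm (y - z)"
      using that(1) 1(4) 2(3) yz by blast
    moreover have "L * norm (y - z) \<le> K * norm (y - z)" "L' * norm (y - z) \<le> K * norm (y - z)"
      by (auto simp: K_def intro: mult_right_mono)
    ultimately show ?thesis by linarith
  qed
  moreover have "\<epsilon> > 0" "K \<ge> 0" "ball (snd c p) \<epsilon> \<subseteq> snd c ` fst c"
    using 1 2 by (auto simp: \<epsilon>_def K_def)
  ultimately show ?case by blast
qed

lemma norm_field_sum_diff_le:
  fixes y z :: "'e::real_normed_vector"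
  assumes "\<And>\<alpha>. \<alpha> \<in> A \<Longrightarrow> norm (Y \<alpha> - Z \<alpha> :: 'e) \<le> L * norm (y - z)"
  shows "norm ((\<Sum>\<alpha>\<in>A. a \<alpha> *\<^sub>R Y \<alpha>) - (\<Sum>\<alpha>\<in>A. a \<alpha> *\<^sub>R Z \<alpha>)) \<le> ((\<Sum>\<alpha>\<in>A. \<bar>a \<alpha>\<bar>) * L) * norm (y - z)"
proof -
  have "norm (\<Sum>\<alpha>\<in>A. a \<alpha> *\<^sub>R (Y \<alpha> - Z \<alpha>)) \<le> (\<Sum>\<alpha>\<in>A. \<bar>a \<alpha>\<bar> * (L * norm (y - z)))"
    by (rule sum_norm_le) (use assms in \<open>auto intro: mult_left_mono\<close>)
  then show ?thesis by (simp add: scaleR_right_diff_distrib sum_subtractf sum_distrib_right mult.assoc)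
qed

text \<open>Let \<open>d\<close> be the difference of the two curves in a chart. On the segment from
  \<open>t\<^sub>0\<close> to \<open>t\<close> its norm is maximal at some \<open>m\<close>. Since
  \<open>d\<close> vanishes at \<open>t\<^sub>0\<close> and its derivative is at most
  \<open>K * norm (d m)\<close>, the mean value inequality bounds \<open>norm (d m)\<close> by half
  of itself on a short segment, so \<open>d\<close> is zero there.\<close>

lemma integral_curve_locally_unique:
  assumes N: "diff_manifold N" and A: "finite A"
    and Y: "\<And>\<alpha>. \<alpha> \<in> A \<Longrightarrow> loc_Lipschitz_field N (Y \<alpha>)"
    and a: "\<And>\<alpha>. \<alpha> \<in> A \<Longrightarrow> continuous_on UNIV (a \<alpha> :: real \<Rightarrow> real)"
    and J: "convex J" "t\<^sub>0 \<in> J"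
    and \<gamma>: "\<And>t. t \<in> J \<Longrightarrow> has_velocity N \<gamma> (\<lambda>c. \<Sum>\<alpha>\<in>A. a \<alpha> t *\<^sub>R Y \<alpha> (\<gamma> t) c) t"
    and \<eta>: "\<And>t. t \<in> J \<Longrightarrow> has_velocity N \<eta> (\<lambda>c. \<Sum>\<alpha>\<in>A. a \<alpha> t *\<^sub>R Y \<alpha> (\<eta> t) c) t"
    and eq: "\<gamma> t\<^sub>0 = \<eta> t\<^sub>0"
  shows "\<exists>e>0. \<forall>t\<in>J. dist t t\<^sub>0 < e \<longrightarrow> \<gamma> t = \<eta> t"
proof -
  define p where "p = \<gamma> t\<^sub>0"
  have p: "p \<in> points N" "p = \<eta> t\<^sub>0" using has_velocityD(3)[OF \<gamma>[OF J(2)]] eq by (auto simp: p_def)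
  obtain c where c: "c \<in> charts_at N p" using ex_chart_at[OF N p(1)] by blast
  note c' = chart_at[OF N c]
  obtain \<delta> L where \<delta>: "\<delta> > 0" and L: "L \<ge> 0"
    and lip: "\<And>\<alpha> y z. \<alpha> \<in> A \<Longrightarrow> y \<in> ball (snd c p) \<delta> \<Longrightarrow> z \<in> ball (snd c p) \<delta> \<Longrightarrow>
        norm (Y \<alpha> (chart_inv c y) c - Y \<alpha> (chart_inv c z) c) \<le> L * norm (y - z)"
    using loc_Lipschitz_fields_uniform[where Y = Y, OF A Y N c] by blast
  \<comment> \<open>Near \<open>t\<^sub>0\<close> this continuous sum stays below its value there
    plus 1, so \<open>K\<close> is a Lipschitz constant of the time-dependent field near
    \<open>(t\<^sub>0, p)\<close>.\<close>
  define S where "S = (\<lambda>t. \<Sum>\<alpha>\<in>A. \<bar>a \<alpha> t\<bar>)"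
  define K where "K = (S t\<^sub>0 + 1) * L"
  have "S t\<^sub>0 \<ge> 0" unfolding S_def by (intro sum_nonneg) simp
  then have "K \<ge> 0" using L by (simp add: K_def)
  have near: "\<forall>\<^sub>F t in at t\<^sub>0. \<zeta> t \<in> fst c \<and> snd c (\<zeta> t) \<in> ball (snd c p) \<delta>"
    if v: "has_velocity N \<zeta> v t\<^sub>0" and "\<zeta> t\<^sub>0 = p" for \<zeta> v
  proof -
    have lim: "limitin (mtop N) \<zeta> p (at t\<^sub>0)" using has_velocityD(1)[OF v] that(2) by simp
    have "\<forall>\<^sub>F t in at t\<^sub>0. snd c (\<zeta> t) \<in> ball (snd c p) \<delta>"
      by (rule topological_tendstoD[OF tendsto_chart[OF N lim c]]) (use \<delta> in auto)
    with limitinD[OF lim c'(3,2)] show ?thesis by eventually_elim simp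
  qed
  have "isCont S t\<^sub>0"
    unfolding S_def using a
    by (intro continuous_intros) (simp add: continuous_on_eq_continuous_at)
  then have "\<forall>\<^sub>F t in at t\<^sub>0. S t < S t\<^sub>0 + 1"
    unfolding isCont_def by (rule order_tendstoD) simp
  with near[OF \<gamma>[OF J(2)]] near[OF \<eta>[OF J(2)]] p(2)
  have "\<forall>\<^sub>F t in at t\<^sub>0. (\<gamma> t \<in> fst c \<and> snd c (\<gamma> t) \<in> ball (snd c p) \<delta>) \<and>
      (\<eta> t \<in> fst c \<and> snd c (\<eta> t) \<in> ball (snd c p) \<delta>) \<and> S t < S t\<^sub>0 + 1"
    by (simp add: p_def eventually_conj_iff)
  then obtain e where "e > 0" and e: "\<And>t. t \<noteq> t\<^sub>0 \<Longrightarrow> dist t t\<^sub>0 < e \<Longrightarrow>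
      (\<gamma> t \<in> fst c \<and> snd c (\<gamma> t) \<in> ball (snd c p) \<delta>) \<and>
      (\<eta> t \<in> fst c \<and> snd c (\<eta> t) \<in> ball (snd c p) \<delta>) \<and> S t < S t\<^sub>0 + 1"
    unfolding eventually_at by blast
  have e: "\<gamma> t \<in> fst c" "snd c (\<gamma> t) \<in> ball (snd c p) \<delta>" "\<eta> t \<in> fst c" "snd c (\<eta> t) \<in> ball (snd c p) \<delta>"
    "S t \<le> S t\<^sub>0 + 1" if "dist t t\<^sub>0 < e" for t
    using e[OF _ that] \<delta> c'(2) p p_def by (cases "t = t\<^sub>0"; force)+
  \<comment> \<open>The second bound forces
    \<open>K * \<bar>m - t\<^sub>0\<bar> \<le> 1 / 2\<close>; adding 1 to \<open>K\<close> covers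
    the case \<open>K = 0\<close>.\<close>
  define e' where "e' = min e (1 / (2 * (K + 1)))"
  have "e' > 0" using \<open>e > 0\<close> \<open>K \<ge> 0\<close> by (simp add: e'_def)
  have "\<gamma> t = \<eta> t" if "t \<in> J" "dist t t\<^sub>0 < e'" for t
  proof -
    define T where "T = closed_segment t\<^sub>0 t"
    have T: "T \<subseteq> J" unfolding T_def using J that(1) by (simp add: closed_segment_subset)
    have Te: "dist s t\<^sub>0 < e'" if "s \<in> T" for s
      using that \<open>dist t t\<^sub>0 < e'\<close> unfolding T_def
      by (metis dist_commute dist_in_closed_segment order_le_less_trans)
    then have Te2: "dist s t\<^sub>0 < e" if "s \<in> T" for s using that by (fastforce simp: e'_def)
    define d where "d = (\<lambda>s. snd c (\<gamma> s) - snd c (\<eta> s))"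
    define d' where "d' = (\<lambda>s. (\<Sum>\<alpha>\<in>A. a \<alpha> s *\<^sub>R Y \<alpha> (\<gamma> s) c) - (\<Sum>\<alpha>\<in>A. a \<alpha> s *\<^sub>R Y \<alpha> (\<eta> s) c))"
    have d: "(d has_vector_derivative d' s) (at s)" if "s \<in> T" for s
      unfolding d_def d'_def
      by (intro derivative_intros has_velocityD(4)[OF \<gamma>] has_velocityD(4)[OF \<eta>])
        (use that T e[OF Te2[OF that]] c'(1) in \<open>auto simp: charts_at_def\<close>)
    have "continuous_on T (\<lambda>s. norm (d s))"
      by (intro continuous_on_norm continuous_at_imp_continuous_on ballI)
        (rule has_vector_derivative_continuous[OF d])
    moreover have "compact T" "T \<noteq> {}" by (auto simp: T_def)
    ultimately obtain m where m: "m \<in> T" "\<And>s. s \<in> T \<Longrightarrow> norm (d s) \<le> norm (d m)"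
      using continuous_attains_sup by (metis (no_types, lifting))
    have d'_le: "norm (d' s) \<le> K * norm (d m)" if "s \<in> T" for s
    proof -
      note es = e[OF Te2[OF that]]
      have inv: "chart_inv c (snd c (\<gamma> s)) = \<gamma> s" "chart_inv c (snd c (\<eta> s)) = \<eta> s"
        using es c'(5) by simp_all
      have "norm (d' s) \<le> (S s * L) * norm (snd c (\<gamma> s) - snd c (\<eta> s))"
        unfolding d'_def S_def
        by (rule norm_field_sum_diff_le) (use lip[OF _ es(2,4)] inv in simp)
      also have "\<dots> \<le> K * norm (d m)"
        unfolding K_def using es(5) L m(2)[OF that] \<open>S t\<^sub>0 \<ge> 0\<close>
        by (intro mult_mono) (auto simp: d_def)
      finally show ?thesis .
    qed
    have "norm (d m - d t\<^sub>0) \<le> (K * norm (d m)) * \<bar>m - t\<^sub>0\<bar>"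
      by (rule vector_derivative_bound[of T])
        (use d d'_le m(1) in \<open>auto simp: T_def intro: has_vector_derivative_at_within\<close>)
    moreover have "d t\<^sub>0 = 0" using eq by (simp add: d_def)
    ultimately have "norm (d m) \<le> (K * \<bar>m - t\<^sub>0\<bar>) * norm (d m)" by (simp add: ac_simps)
    also have "K * \<bar>m - t\<^sub>0\<bar> \<le> K * (1 / (2 * (K + 1)))"
      using Te[OF m(1)] \<open>K \<ge> 0\<close> by (intro mult_left_mono) (auto simp: e'_def dist_real_def)
    also have "K * (1 / (2 * (K + 1))) \<le> 1 / 2" using \<open>K \<ge> 0\<close> by (simp add: field_simps)
    finally have "norm (d m) \<le> (1 / 2) * norm (d m)" by (simp add: mult_right_mono)
    then have "norm (d m) \<le> 0" by simp
    moreover have "t \<in> T" by (simp add: T_def)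
    ultimately have "snd c (\<gamma> t) = snd c (\<eta> t)" using m(2)[of t] by (simp add: d_def)
    then show "\<gamma> t = \<eta> t"
      using e(1,3)[OF Te2[OF \<open>t \<in> T\<close>]] c'(5) by (meson inj_onD)
  qed
  then show ?thesis using \<open>e' > 0\<close> by blast
qed

text \<open>Around each time the curves agree everywhere or nowhere: agreement spreads by local
  uniqueness, disagreement because the topology is Hausdorff and the curves are continuous.
  Connectedness of \<open>J\<close> does the rest. \<open>J\<close> may be a closed segment, but
  velocities are two-sided even at its ends.\<close>

lemma integral_curve_unique:
  assumes "smooth_manifold N" and A: "finite A"
    and Y: "\<And>\<alpha>. \<alpha> \<in> A \<Longrightarrow> loc_Lipschitz_field N (Y \<alpha>)"
    and a: "\<And>\<alpha>. \<alpha> \<in> A \<Longrightarrow> continuous_on UNIV (a \<alpha> :: real \<Rightarrow> real)"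
    and J: "convex J"
    and \<gamma>: "\<And>t. t \<in> J \<Longrightarrow> has_velocity N \<gamma> (\<lambda>c. \<Sum>\<alpha>\<in>A. a \<alpha> t *\<^sub>R Y \<alpha> (\<gamma> t) c) t"
    and \<eta>: "\<And>t. t \<in> J \<Longrightarrow> has_velocity N \<eta> (\<lambda>c. \<Sum>\<alpha>\<in>A. a \<alpha> t *\<^sub>R Y \<alpha> (\<eta> t) c) t"
    and s: "s \<in> J" "\<gamma> s = \<eta> s" and t: "t \<in> J"
  shows "\<gamma> t = \<eta> t"
proof -
  have N: "diff_manifold N" by (rule diff_manifold_if_smooth) fact
  have "\<exists>T. openin (top_of_set J) T \<and> u \<in> T \<and> (\<forall>x\<in>T. \<forall>y\<in>T. \<gamma> x = \<eta> x \<longrightarrow> \<gamma> y = \<eta> y)" if u: "u \<in> J" for u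
  proof -
    have "\<exists>e>0. (\<forall>x\<in>J. dist x u < e \<longrightarrow> \<gamma> x = \<eta> x) \<or> (\<forall>x\<in>J. dist x u < e \<longrightarrow> \<gamma> x \<noteq> \<eta> x)"
    proof (cases "\<gamma> u = \<eta> u")
      case True
      then show ?thesis
        using integral_curve_locally_unique[OF N A Y a J u \<gamma> \<eta>] by meson
    next
      case False
      note lim = has_velocityD(1,3)[OF \<gamma>[OF u]] has_velocityD(1,3)[OF \<eta>[OF u]]
      obtain U V where UV: "openin (mtop N) U" "openin (mtop N) V" "\<gamma> u \<in> U" "\<eta> u \<in> V" "disjnt U V"
        using assms(1) lim(2,4) False unfolding smooth_manifold_def Hausdorff_space_def by meson
      have "\<forall>\<^sub>F x in at u. \<gamma> x \<in> U \<and> \<eta> x \<in> V"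
        using limitinD[OF lim(1) UV(1,3)] limitinD[OF lim(3) UV(2,4)] by eventually_elim simp
      then obtain e where "e > 0" "\<And>x. x \<noteq> u \<Longrightarrow> dist x u < e \<Longrightarrow> \<gamma> x \<in> U \<and> \<eta> x \<in> V"
        unfolding eventually_at by blast
      then have "\<forall>x\<in>J. dist x u < e \<longrightarrow> \<gamma> x \<noteq> \<eta> x"
        using UV(5) False unfolding disjnt_iff by metis
      with \<open>e > 0\<close> show ?thesis by blast
    qed
    then obtain e where "e > 0"
      "(\<forall>x\<in>J. dist x u < e \<longrightarrow> \<gamma> x = \<eta> x) \<or> (\<forall>x\<in>J. dist x u < e \<longrightarrow> \<gamma> x \<noteq> \<eta> x)" by blast
    then show ?thesis
      using u by (intro exI[of _ "J \<inter> ball u e"]) (auto simp: dist_commute)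
  qed
  then show ?thesis
    using connected_induction_simple[OF convex_connected[OF J] s(1) t, of "\<lambda>x. \<gamma> x = \<eta> x"] s(2) by blast
qed

lemma tangent_space_sum:
  assumes "diff_manifold N" "\<And>\<alpha>. \<alpha> \<in> A \<Longrightarrow> v \<alpha> \<in> tangent_space N x"
  shows "(\<lambda>c. \<Sum>\<alpha>\<in>A. a \<alpha> *\<^sub>R v \<alpha> c) \<in> tangent_space N x"
  unfolding tangent_space_def
proof (intro CollectI conjI allI impI ballI)
  fix c assume "c \<notin> charts_at N x"
  then show "(\<Sum>\<alpha>\<in>A. a \<alpha> *\<^sub>R v \<alpha> c) = 0"
    using tangent_space_off_chart[OF assms(2)] by (intro sum.neutral) auto
next
  fix c d assume c: "c \<in> charts_at N x" and d: "d \<in> charts_at N x"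
  interpret D: bounded_linear "frechet_derivative (\<lambda>y. snd d (chart_inv c y)) (at (snd c x))"
    by (rule has_derivative_bounded_linear) (rule transition_has_derivative[OF assms(1) c d])
  show "(\<Sum>\<alpha>\<in>A. a \<alpha> *\<^sub>R v \<alpha> d) =
      frechet_derivative (snd d \<circ> chart_inv c) (at (snd c x)) (\<Sum>\<alpha>\<in>A. a \<alpha> *\<^sub>R v \<alpha> c)"
    unfolding o_def D.sum D.scaleR
    by (intro sum.cong refl arg_cong[where f = "scaleR _"] tangent_space_transition[OF assms(2) c d])
qed

text \<open>The equation is solved for the components in one chart and the solution is carried back
  by \<open>chart_inv\<close>; tangency of the fields transfers the velocity from this chart to all
  others.\<close>

lemma local_integral_curve:
  fixes N :: "('a, 'e::real_normed_vector) manifold" and t\<^sub>0 :: real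
  assumes fin: "\<exists>B :: 'e set. finite B \<and> span B = UNIV" and N: "diff_manifold N" and A: "finite A"
    and Y: "\<And>\<alpha>. \<alpha> \<in> A \<Longrightarrow> loc_Lipschitz_field N (Y \<alpha>)"
    and tangent: "\<And>\<alpha> p. \<alpha> \<in> A \<Longrightarrow> p \<in> points N \<Longrightarrow> Y \<alpha> p \<in> tangent_space N p"
    and a: "\<And>\<alpha>. \<alpha> \<in> A \<Longrightarrow> continuous_on UNIV (a \<alpha> :: real \<Rightarrow> real)"
    and p: "p \<in> points N"
  shows "\<exists>\<epsilon>>0. \<exists>g. g t\<^sub>0 = p \<and>
    (\<forall>t\<in>{t\<^sub>0 - \<epsilon><..<t\<^sub>0 + \<epsilon>}. has_velocity N g (\<lambda>c. \<Sum>\<alpha>\<in>A. a \<alpha> t *\<^sub>R Y \<alpha> (g t) c) t)"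
proof -
  obtain B :: "'e set" where B: "finite B" "span B = UNIV" using fin by blast
  obtain c where c: "c \<in> charts_at N p" using ex_chart_at[OF N p] by blast
  note c' = chart_at[OF N c]
  define y\<^sub>0 where "y\<^sub>0 = snd c p"
  define Z where "Z = (\<lambda>\<alpha> y. Y \<alpha> (chart_inv c y) c)"
  obtain \<delta> L where \<delta>: "\<delta> > 0" and L: "L \<ge> 0" and sub: "ball y\<^sub>0 \<delta> \<subseteq> snd c ` fst c"
    and lip: "\<And>\<alpha> y z. \<alpha> \<in> A \<Longrightarrow> y \<in> ball y\<^sub>0 \<delta> \<Longrightarrow> z \<in> ball y\<^sub>0 \<delta> \<Longrightarrow> norm (Z \<alpha> y - Z \<alpha> z) \<le> L * norm (y - z)"
    using loc_Lipschitz_fields_uniform[where Y = Y, OF A Y N c] unfolding y\<^sub>0_def Z_def by blast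
  define F where "F = (\<lambda>t y. \<Sum>\<alpha>\<in>A. a \<alpha> t *\<^sub>R Z \<alpha> y)"
  define S where "S = (\<lambda>t. \<Sum>\<alpha>\<in>A. \<bar>a \<alpha> t\<bar>)"
  \<comment> \<open>Any compact interval around \<open>t\<^sub>0\<close> would serve; it makes the
    coefficients bounded.\<close>
  let ?I = "{t\<^sub>0 - 1..t\<^sub>0 + 1}"
  have "continuous_on ?I S"
    unfolding S_def by (intro continuous_intros continuous_on_subset[OF a]) auto
  then obtain K where K: "\<And>t. t \<in> ?I \<Longrightarrow> S t \<le> K"
    using continuous_attains_sup[of ?I S] by fastforce
  have "S t\<^sub>0 \<ge> 0" unfolding S_def by (intro sum_nonneg) simp
  then have "K \<ge> 0" using K[of t\<^sub>0] by simp
  have contZ: "continuous_on (ball y\<^sub>0 \<delta>) (Z \<alpha>)" if "\<alpha> \<in> A" for \<alpha>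
    by (rule lipschitz_on_continuous_on[of L]) (use lip[OF that] L in \<open>auto simp: lipschitz_on_def dist_norm\<close>)
  have cont: "continuous_on (?I \<times> ball y\<^sub>0 \<delta>) (\<lambda>(t, y). F t y)"
    unfolding F_def case_prod_beta
    by (intro continuous_intros continuous_on_compose2[OF a] continuous_on_compose2[OF contZ]) auto
  \<comment> \<open>The Lipschitz estimate from the centre gives \<open>norm (Z \<alpha> y) \<le>
    norm (Z \<alpha> y\<^sub>0) + L * \<delta>\<close> on the ball.\<close>
  define C where "C = (\<Sum>\<alpha>\<in>A. K * (norm (Z \<alpha> y\<^sub>0) + L * \<delta>))"
  have bound: "norm (F t y) \<le> C" if t: "t \<in> ?I" and y: "y \<in> ball y\<^sub>0 \<delta>" for t y
    unfolding F_def C_def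
  proof (rule sum_norm_le)
    fix \<alpha> assume \<alpha>: "\<alpha> \<in> A"
    have "\<bar>a \<alpha> t\<bar> \<le> S t" unfolding S_def by (rule member_le_sum[where f = "\<lambda>\<alpha>. \<bar>a \<alpha> t\<bar>"]) (use \<alpha> A in auto)
    then have "\<bar>a \<alpha> t\<bar> \<le> K" using K[OF t] by simp
    moreover have "norm (Z \<alpha> y) \<le> norm (Z \<alpha> y\<^sub>0) + L * \<delta>"
    proof -
      have "norm (Z \<alpha> y) \<le> norm (Z \<alpha> y\<^sub>0) + norm (Z \<alpha> y - Z \<alpha> y\<^sub>0)" by (rule norm_triangle_sub)
      also have "norm (Z \<alpha> y - Z \<alpha> y\<^sub>0) \<le> L * norm (y - y\<^sub>0)" by (rule lip[OF \<alpha> y]) (use \<delta> in simp)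
      also have "\<dots> \<le> L * \<delta>" using y L by (intro mult_left_mono) (auto simp: dist_norm norm_minus_commute)
      finally show ?thesis by simp
    qed
    ultimately show "norm (a \<alpha> t *\<^sub>R Z \<alpha> y) \<le> K * (norm (Z \<alpha> y\<^sub>0) + L * \<delta>)"
      unfolding norm_scaleR using \<open>K \<ge> 0\<close> by (intro mult_mono) auto
  qed
  have Flip: "norm (F t y - F t z) \<le> (K * L) * norm (y - z)"
    if t: "t \<in> ?I" and "y \<in> ball y\<^sub>0 \<delta>" "z \<in> ball y\<^sub>0 \<delta>" for t y z
  proof -
    have "norm (F t y - F t z) \<le> (S t * L) * norm (y - z)"
      unfolding F_def S_def by (rule norm_field_sum_diff_le) (rule lip[OF _ that(2,3)])
    also have "\<dots> \<le> (K * L) * norm (y - z)" using K[OF t] L by (intro mult_right_mono) auto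
    finally show ?thesis .
  qed
  obtain \<epsilon> u where \<epsilon>: "\<epsilon> > 0" and u: "u t\<^sub>0 = y\<^sub>0"
    "\<And>t. t \<in> {t\<^sub>0 - \<epsilon><..<t\<^sub>0 + \<epsilon>} \<Longrightarrow> u t \<in> ball y\<^sub>0 \<delta>"
    "\<And>t. t \<in> {t\<^sub>0 - \<epsilon><..<t\<^sub>0 + \<epsilon>} \<Longrightarrow> (u has_vector_derivative F t (u t)) (at t)"
    using Picard_finite_dim[OF B zero_less_one \<delta> mult_nonneg_nonneg[OF \<open>K \<ge> 0\<close> L] cont bound Flip] by blast
  define g where "g = (\<lambda>t. chart_inv c (u t))"
  have "has_velocity N g (\<lambda>c. \<Sum>\<alpha>\<in>A. a \<alpha> t *\<^sub>R Y \<alpha> (g t) c) t" if t: "t \<in> {t\<^sub>0 - \<epsilon><..<t\<^sub>0 + \<epsilon>}" for t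
  proof -
    have sg: "snd c (g s) = u s" "g s \<in> fst c" if "s \<in> {t\<^sub>0 - \<epsilon><..<t\<^sub>0 + \<epsilon>}" for s
      using u(2)[OF that] sub by (auto simp: g_def f_inv_into_f inv_into_into)
    have cg: "c \<in> charts_at N (g t)" using sg[OF t] c'(1) by (simp add: charts_at_def)
    note cg' = chart_at[OF N cg]
    show ?thesis
    proof (rule has_velocity_if_chart[where c = c, OF N])
      show "limitin (mtop N) g (g t) (at t)"
        unfolding limitin_def
      proof (intro conjI allI impI)
        show "g t \<in> points N" by (rule cg'(7))
        fix U assume U: "openin (mtop N) U \<and> g t \<in> U"
        have "isCont u t" using u(3)[OF t] by (rule has_vector_derivative_continuous)
        then have "(u \<longlongrightarrow> snd c (g t)) (at t)" by (simp add: isCont_def sg[OF t])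
        from eventually_compose_filterlim[OF eventually_chart_inv[OF N cg, of U] this] U
        show "\<forall>\<^sub>F s in at t. g s \<in> U" by (auto simp: g_def elim: eventually_mono)
      qed
      show "(\<lambda>c. \<Sum>\<alpha>\<in>A. a \<alpha> t *\<^sub>R Y \<alpha> (g t) c) \<in> tangent_space N (g t)"
        by (rule tangent_space_sum[OF N tangent[OF _ cg'(7)]])
      show "c \<in> charts_at N (g t)" by (rule cg)
      have "((\<lambda>s. snd c (g s)) has_vector_derivative F t (u t)) (at t)"
        by (rule has_vector_derivative_transform_within_open[OF u(3)[OF t] open_greaterThanLessThan t])
          (simp add: sg)
      then show "((\<lambda>s. snd c (g s)) has_vector_derivative (\<Sum>\<alpha>\<in>A. a \<alpha> t *\<^sub>R Y \<alpha> (g t) c)) (at t)"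
        by (simp add: F_def Z_def g_def)
    qed
  qed
  moreover have "g t\<^sub>0 = p" using c'(6) by (simp add: g_def u(1) y\<^sub>0_def)
  ultimately show ?thesis using \<epsilon> by blast
qed

section \<open>Functions constant on leaves\<close>

lemma mdiff_ident:
  assumes "diff_manifold N" "p \<in> points N"
  shows "mdiff N N (\<lambda>x. x) p"
  unfolding mdiff_def
  using assms transition_has_derivative[OF assms(1)] unfolding differentiable_def by blast

lemma differential_ident_some_chart:
  assumes "diff_manifold N" "p \<in> points N"
  shows "differential N N (\<lambda>x. x) p v (SOME c. c \<in> charts_at N p) = v (SOME c. c \<in> charts_at N p)"
proof -
  let ?c = "SOME c. c \<in> charts_at N p"
  have c: "?c \<in> charts_at N p" by (rule some_chart_at[OF assms])
  note c' = chart_at[OF assms(1) c]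
  have "((\<lambda>y. snd ?c (chart_inv ?c y)) has_derivative (\<lambda>h. h)) (at (snd ?c p))"
  proof (rule has_derivative_transform_eventually[OF has_derivative_ident])
    show "\<forall>\<^sub>F y in at (snd ?c p). y = snd ?c (chart_inv ?c y)"
      using eventually_chart_inv[OF assms(1) c c'(3,2)] unfolding eventually_nhds_conv_at
      by (auto elim: eventually_mono)
  qed (use c' in auto)
  from frechet_derivative_at[OF this, symmetric] c show ?thesis by (simp add: differential_apply)
qed

text \<open>By the chain rule the derivative along the leaf is \<open>H (I w)\<close>, where
  \<open>I\<close> is the inclusion in charts. Each \<open>I w\<close> is a component of a vector of
  the distribution, hence a combination of the \<open>Xs \<alpha> x\<close>, and \<open>H\<close>
  vanishes on these.\<close>

lemma leaf_function_has_zero_derivative: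
  assumes N: "diff_manifold N" and L: "diff_manifold L" and x: "x \<in> points L"
    and incl: "mdiff L N (\<lambda>x. x) x"
    and dist: "differential L N (\<lambda>x. x) x ` tangent_space L x \<subseteq> distribution (vf_span r Xs) x"
    and h: "mdiff N vspace h x" "\<And>\<alpha>. \<alpha> < r \<Longrightarrow> apply_vf N (Xs \<alpha>) h x = 0"
    and c: "c \<in> charts_at L x"
  shows "((\<lambda>y. h (chart_inv c y)) has_derivative (\<lambda>_. 0)) (at (snd c x))"
proof -
  let ?d = "SOME d. d \<in> charts_at N x" and ?b = "SOME c. c \<in> charts_at L x"
  have d: "?d \<in> charts_at N x" using incl by (intro some_chart_at[OF N]) (simp add: mdiff_def)
  have b: "?b \<in> charts_at L x" by (rule some_chart_at[OF L x])
  define H where "H = frechet_derivative (\<lambda>y. h (chart_inv ?d y)) (at (snd ?d x))"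
  have H: "((\<lambda>y. h (chart_inv ?d y)) has_derivative H) (at (snd ?d x))"
    using mdiff_has_derivative[OF h(1) d, of "(UNIV, id)"] by (simp add: charts_at_vspace H_def)
  interpret H: bounded_linear H using H by (rule has_derivative_bounded_linear)
  define I where "I = frechet_derivative (\<lambda>y. snd ?d (chart_inv ?b y)) (at (snd ?b x))"
  have HX: "H (Xs \<alpha> x ?d) = 0" if "\<alpha> < r" for \<alpha>
    using h(2)[OF that] by (simp add: apply_vf_def differential_apply charts_at_vspace H_def)
  have "H (I w) = 0" for w
  proof -
    \<comment> \<open>A tangent vector with prescribed component \<open>w\<close> in the chart
      \<open>?b\<close>: the differential of the identity reads only that component and supplies the
      others compatibly.\<close>
    define v where "v = differential L L (\<lambda>x. x) x (\<lambda>_. w)"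
    have "v \<in> tangent_space L x"
      unfolding v_def by (rule differential_in_tangent_space[OF L L mdiff_ident[OF L x]])
    then have "differential L N (\<lambda>x. x) x v \<in> distribution (vf_span r Xs) x" using dist by blast
    then obtain a :: "nat \<Rightarrow> real" where a: "differential L N (\<lambda>x. x) x v = (\<lambda>c. \<Sum>\<alpha><r. a \<alpha> *\<^sub>R Xs \<alpha> x c)"
      by (auto simp: distribution_def vf_span_def)
    have "v ?b = w" by (simp add: v_def differential_ident_some_chart[OF L x])
    then have "differential L N (\<lambda>x. x) x v ?d = I w" using d by (simp add: differential_apply I_def)
    then have "I w = (\<Sum>\<alpha><r. a \<alpha> *\<^sub>R Xs \<alpha> x ?d)" by (simp add: a)
    then show ?thesis by (simp add: H.sum H.scaleR HX)
  qed
  moreover have "((\<lambda>y. h (chart_inv ?b y)) has_derivative (\<lambda>w. H (I w))) (at (snd ?b x))"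
    using mdiff_through_chart[OF L N incl b d H] by (simp add: I_def)
  ultimately have h0: "((\<lambda>y. h (chart_inv ?b y)) has_derivative (\<lambda>w. 0)) (at (snd ?b x))" by simp
  \<comment> \<open>The identity, expressed from \<open>c\<close> to \<open>?b\<close>, moves the
    result from the chosen chart to an arbitrary one.\<close>
  have "mdiff L L (\<lambda>x. x) x" by (rule mdiff_ident[OF L x])
  from mdiff_through_chart[OF L L this c b h0] show ?thesis .
qed

text \<open>A ball in the image of a chart is convex, so vanishing of the derivative on all of it
  gives constancy there; its preimage is the required open set.\<close>

lemma locally_constant_if_zero_derivative:
  assumes L: "diff_manifold L" and x: "x \<in> points L"
    and h: "\<And>x c. x \<in> points L \<Longrightarrow> c \<in> charts_at L x \<Longrightarrow>
      ((\<lambda>y. h (chart_inv c y)) has_derivative (\<lambda>_. 0)) (at (snd c x))"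
  shows "\<exists>U. openin (mtop L) U \<and> x \<in> U \<and> (\<forall>y\<in>U. h y = h x)"
proof -
  obtain c where c: "c \<in> charts_at L x" using ex_chart_at[OF L x] by blast
  note c' = chart_at[OF L c]
  obtain \<delta> where \<delta>: "\<delta> > 0" "ball (snd c x) \<delta> \<subseteq> snd c ` fst c"
    using c'(2,4) by (meson imageI open_contains_ball)
  have "((\<lambda>y. h (chart_inv c y)) has_derivative (\<lambda>_. 0)) (at y within ball (snd c x) \<delta>)"
    if y: "y \<in> ball (snd c x) \<delta>" for y
  proof -
    obtain q where q: "q \<in> fst c" "y = snd c q" using y \<delta>(2) by blast
    then have "q \<in> points L" "c \<in> charts_at L q"
      using c' openin_subset by (auto simp: charts_at_def)
    then show ?thesis using h[of q c] q(2) by (simp add: has_derivative_at_withinI)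
  qed
  then obtain k where k: "\<And>y. y \<in> ball (snd c x) \<delta> \<Longrightarrow> h (chart_inv c y) = k"
    using has_derivative_zero_constant[of "ball (snd c x) \<delta>" "\<lambda>y. h (chart_inv c y)"] by auto
  define U where "U = {q \<in> points L \<inter> fst c. snd c q \<in> ball (snd c x) \<delta>}"
  have "continuous_map (subtopology (mtop L) (fst c)) euclidean (snd c)"
    using L c'(1) by (simp add: diff_manifold_def)
  from openin_continuous_map_preimage[OF this, of "ball (snd c x) \<delta>"]
  have "openin (subtopology (mtop L) (fst c)) U" by (simp add: U_def)
  then have "openin (mtop L) U" using c'(3) openin_trans_full by blast
  moreover have "h q = k" if "q \<in> U" for q
    using k[of "snd c q"] that c'(5) by (auto simp: U_def)
  moreover have "x \<in> U" using c'(2,7) \<delta>(1) by (simp add: U_def)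
  ultimately show ?thesis by metis
qed

text \<open>For a locally constant function every condition on the value defines an open set, so a
  level set is both open and closed.\<close>

lemma constant_on_connected_manifold:
  assumes L: "diff_manifold L" "connected_space (mtop L)" and x: "x \<in> points L" "y \<in> points L"
    and h: "\<And>x c. x \<in> points L \<Longrightarrow> c \<in> charts_at L x \<Longrightarrow>
      ((\<lambda>y. h (chart_inv c y)) has_derivative (\<lambda>_. 0)) (at (snd c x))"
  shows "h x = h y"
proof -
  have op: "openin (mtop L) {z \<in> points L. P (h z)}" for P
  proof (subst openin_subopen, intro ballI)
    fix z assume z: "z \<in> {z \<in> points L. P (h z)}"
    then obtain U where "openin (mtop L) U" "z \<in> U" "\<forall>y\<in>U. h y = h z"
      using locally_constant_if_zero_derivative[OF L(1) _ h] by blast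
    then show "\<exists>T. openin (mtop L) T \<and> z \<in> T \<and> T \<subseteq> {z \<in> points L. P (h z)}"
      using z openin_subset by (intro exI[of _ U]) fastforce
  qed
  have diff: "points L - {z \<in> points L. h z = h x} = {z \<in> points L. h z \<noteq> h x}" by blast
  have "closedin (mtop L) {z \<in> points L. h z = h x}"
    unfolding closedin_def diff by (intro conjI op[of "\<lambda>w. w \<noteq> h x"]) blast
  then have "{z \<in> points L. h z = h x} = {} \<or> {z \<in> points L. h z = h x} = points L"
    using L(2) op[of "\<lambda>w. w = h x"] unfolding connected_space_clopen_in by blast
  then have "y \<in> {z \<in> points L. h z = h x}" using x by blast
  then show ?thesis by simp
qed

text \<open>The argument takes place in the leaf's own topology and charts, in which it is connected
  and has the distribution as tangent spaces. Constancy makes the description in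
  \<open>leaf_fun\<close> satisfiable, and the point \<open>x\<close> makes it unique.\<close>

lemma leaf_fun_eq:
  fixes N :: "('n, 'a::real_normed_vector) manifold"
  assumes "smooth_manifold N" "k \<in> leaves TYPE('l::real_normed_vector) N (vf_span r Xs)" "x \<in> k"
    and "\<And>x. x \<in> points N \<Longrightarrow> mdiff N vspace h x"
    and "\<And>x \<alpha>. x \<in> points N \<Longrightarrow> \<alpha> < r \<Longrightarrow> apply_vf N (Xs \<alpha>) h x = 0"
  shows "leaf_fun h k = h x"
proof -
  obtain L :: "('n, 'l) manifold" where k: "k = points L" and
    L: "connected_integral_submanifold N (vf_span r Xs) L"
    using assms(2) unfolding leaves_def by blast
  note L' = L[unfolded connected_integral_submanifold_def]
  have N: "diff_manifold N" and LM: "diff_manifold L"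
    using L' assms(1) diff_manifold_if_smooth by blast+
  have const: "h y = h x" if "y \<in> k" for y
  proof (rule constant_on_connected_manifold[OF LM])
    show "connected_space (mtop L)" "x \<in> points L" "y \<in> points L" using L' assms(3) that k by simp_all
    fix z c assume z: "z \<in> points L" and c: "c \<in> charts_at L z"
    have zN: "z \<in> points N" using L' z by blast
    show "((\<lambda>y. h (chart_inv c y)) has_derivative (\<lambda>_. 0)) (at (snd c z))"
    proof (rule leaf_function_has_zero_derivative[OF N LM z _ _ assms(4)[OF zN] assms(5)[OF zN] c])
      show "mdiff L N (\<lambda>x. x) z" using L' z by (intro mdiff_if_smooth_map_on) (auto simp: immersion_def)
      show "differential L N (\<lambda>x. x) z ` tangent_space L z \<subseteq> distribution (vf_span r Xs) z"
        using L' z by blast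
    qed
  qed
  show ?thesis
    unfolding leaf_fun_def
  proof (rule the_equality)
    show "\<forall>y\<in>k. h y = h x" using const by simp
    show "z = h x" if "\<forall>y\<in>k. h y = z" for z using bspec[OF that assms(3)] by simp
  qed
qed

section \<open>Right-invariant systems on Lie groups\<close>

text \<open>The minus sign follows the convention for fundamental fields: the value at the identity
  is minus \<open>v\<close>, so for \<open>v \<alpha>\<close> this is the G-component of minus
  \<open>XR \<alpha>\<close>.\<close>

definition right_invariant_field ::
    "'g monoid \<Rightarrow> ('g, 'c::real_normed_vector) manifold \<Rightarrow> ('g, 'c) tvec \<Rightarrow> ('g, 'c) vfield" where
  "right_invariant_field G GM v g = differential GM GM (\<lambda>h. h \<otimes>\<^bsub>G\<^esub> g) \<one>\<^bsub>G\<^esub> (\<lambda>c. - v c)"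

lemma Lie_groupD:
  assumes "Lie_group G GM"
  shows "smooth_manifold GM" "diff_manifold GM" "group G" "carrier G = points GM"
    "smooth_map (prod_manifold GM GM) GM (\<lambda>(g, h). g \<otimes>\<^bsub>G\<^esub> h)"
  using assms diff_manifold_if_smooth by (auto simp: Lie_group_def)

lemma mdiff_right_mult:
  assumes "Lie_group G GM" "g \<in> carrier G" "h \<in> carrier G"
  shows "mdiff GM GM (\<lambda>x. x \<otimes>\<^bsub>G\<^esub> h) g"
  using mdiff_slice_left[OF Lie_groupD(2)[OF assms(1)] Lie_groupD(2)[OF assms(1)] Lie_groupD(5)[OF assms(1)]] assms by (simp add: Lie_groupD(4))

lemma one_parameter_subgroupD:
  assumes G: "Lie_group G GM" and \<gamma>: "one_parameter_subgroup G GM v \<gamma>"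
  shows "\<gamma> s \<in> carrier G" "\<gamma> 0 = \<one>\<^bsub>G\<^esub>" "has_velocity GM (\<lambda>s. \<gamma> (- s)) (\<lambda>c. - v c) 0"
proof -
  interpret group G by (rule Lie_groupD(3)[OF G])
  have smooth: "smooth_map vspace GM \<gamma>" and hom: "\<gamma> (s + t) = \<gamma> s \<otimes>\<^bsub>G\<^esub> \<gamma> t"
    and vel: "has_velocity GM \<gamma> v 0" for s t
    using \<gamma> by (simp_all add: one_parameter_subgroup_def)
  have *: "\<gamma> s \<in> carrier G" for s
    using mdiff_if_smooth_map_on[OF smooth, of s] Lie_groupD(4)[OF G] by (simp add: mdiff_def)
  then show "\<gamma> s \<in> carrier G" .
  show "\<gamma> 0 = \<one>\<^bsub>G\<^esub>" using hom[of 0 0] *[of 0] by simp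
  show "has_velocity GM (\<lambda>s. \<gamma> (- s)) (\<lambda>c. - v c) 0"
    by (rule has_velocity_reflect[OF Lie_groupD(2)[OF G] vel])
qed

lemma right_invariant_field_velocity:
  assumes G: "Lie_group G GM" and \<gamma>: "one_parameter_subgroup G GM v \<gamma>" and g: "g \<in> carrier G"
  shows "has_velocity GM (\<lambda>s. \<gamma> (- s) \<otimes>\<^bsub>G\<^esub> g) (right_invariant_field G GM v g) 0"
proof -
  interpret group G by (rule Lie_groupD(3)[OF G])
  note \<gamma>' = one_parameter_subgroupD[OF G \<gamma>]
  note GM = Lie_groupD(2)[OF G]
  have "mdiff GM GM (\<lambda>h. h \<otimes>\<^bsub>G\<^esub> g) (\<gamma> (- 0))" using mdiff_right_mult[OF G _ g] \<gamma>'(2) by simp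
  from has_velocity_compose[OF GM GM this \<gamma>'(3)] show ?thesis
    by (simp add: right_invariant_field_def \<gamma>'(2))
qed

text \<open>Associativity: right translation by \<open>h\<close> sends the test curve exp(-s v) g to
  exp(-s v) (g h), the test curve of the same field at the translated point.\<close>

lemma right_invariant_field_related:
  assumes G: "Lie_group G GM" and \<gamma>: "one_parameter_subgroup G GM v \<gamma>"
    and g: "g \<in> carrier G" "h \<in> carrier G"
  shows "\<exists>\<sigma>. \<sigma> 0 = g \<and> has_velocity GM \<sigma> (right_invariant_field G GM v g) 0 \<and>
    has_velocity GM (\<lambda>s. \<sigma> s \<otimes>\<^bsub>G\<^esub> h) (right_invariant_field G GM v (g \<otimes>\<^bsub>G\<^esub> h)) 0"
proof -
  interpret group G by (rule Lie_groupD(3)[OF G])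
  note \<gamma>' = one_parameter_subgroupD[OF G \<gamma>]
  show ?thesis
    using right_invariant_field_velocity[OF G \<gamma> g(1)]
      right_invariant_field_velocity[OF G \<gamma> m_closed[OF g]] \<gamma>' g
    by (intro exI[of _ "\<lambda>s. \<gamma> (- s) \<otimes>\<^bsub>G\<^esub> g"]) (simp add: m_assoc)
qed

text \<open>The bundle action moves only the group component, so the orbit of \<open>(g, k)\<close>
  is exp(-s v) g paired with the constant \<open>k\<close>. The right-invariant field depends on
  \<open>v\<close> alone, so the one-parameter subgroup found here may differ from the one used for
  the action on N.\<close>

lemma bundle_fundamental_vf:
  assumes G: "Lie_group G GM" and Z: "fundamental_vf G GM (prod_manifold GM M) (bundle_action G) v Z"
    and gk: "g \<in> carrier G" "k \<in> points M"
  shows "\<exists>\<sigma>. \<sigma> 0 = g \<and> has_velocity GM \<sigma> (right_invariant_field G GM v g) 0 \<and>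
    has_velocity (prod_manifold GM M) (\<lambda>s. (\<sigma> s, k)) (Z (g, k)) 0"
proof -
  interpret group G by (rule Lie_groupD(3)[OF G])
  obtain \<gamma> where \<gamma>: "one_parameter_subgroup G GM v \<gamma>" and
    vel: "\<forall>p\<in>points (prod_manifold GM M). has_velocity (prod_manifold GM M) (\<lambda>t. bundle_action G (\<gamma> (- t)) p) (Z p) 0"
    using Z by (auto simp: fundamental_vf_def)
  note \<gamma>' = one_parameter_subgroupD[OF G \<gamma>]
  have "has_velocity (prod_manifold GM M) (\<lambda>t. bundle_action G (\<gamma> (- t)) (g, k)) (Z (g, k)) 0"
    by (rule bspec[OF vel]) (use gk Lie_groupD(4)[OF G] in simp)
  then show ?thesis
    using right_invariant_field_velocity[OF G \<gamma> gk(1)] \<gamma>'(2) gk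
    by (intro exI[of _ "\<lambda>s. \<gamma> (- s) \<otimes>\<^bsub>G\<^esub> g"]) (simp add: bundle_action_def)
qed

lemma right_invariant_field_chart:
  assumes G: "Lie_group G GM" and Z: "fundamental_vf G GM (prod_manifold GM M) (bundle_action G) v Z"
    and M: "diff_manifold M" and c: "c \<in> charts_at GM g" and d: "d \<in> charts_at M k"
  shows "right_invariant_field G GM v g c = fst (Z (g, k) (prod_chart c d))"
proof -
  have "g \<in> carrier G" "k \<in> points M"
    using chart_at[OF Lie_groupD(2)[OF G] c] chart_at[OF M d] Lie_groupD(4)[OF G] by simp_all
  then obtain \<sigma> where \<sigma>: "\<sigma> 0 = g" "has_velocity GM \<sigma> (right_invariant_field G GM v g) 0"
    "has_velocity (prod_manifold GM M) (\<lambda>s. (\<sigma> s, k)) (Z (g, k)) 0"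
    using bundle_fundamental_vf[OF G Z] by blast
  have "((\<lambda>s. snd (prod_chart c d) (\<sigma> s, k)) has_vector_derivative Z (g, k) (prod_chart c d)) (at 0)"
    by (rule has_velocityD(4)[OF \<sigma>(3)]) (use prod_chart_at[OF c d] \<sigma>(1) in simp)
  from bounded_linear.has_vector_derivative[OF bounded_linear_fst this]
  have "((\<lambda>s. snd c (\<sigma> s)) has_vector_derivative fst (Z (g, k) (prod_chart c d))) (at 0)" by simp
  moreover have "((\<lambda>s. snd c (\<sigma> s)) has_vector_derivative right_invariant_field G GM v g c) (at 0)"
    by (rule has_velocityD(4)[OF \<sigma>(2)]) (use c \<sigma>(1) in simp)
  ultimately show ?thesis by (metis vector_derivative_unique_at)
qed

lemma finite_spanning_prod:
  fixes B :: "'a::real_vector set" and C :: "'b::real_vector set"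
  assumes "finite B" "span B = UNIV" "finite C" "span C = UNIV"
  shows "finite ((\<lambda>b. (b, 0)) ` B \<union> Pair 0 ` C)" "span ((\<lambda>b. (b, 0)) ` B \<union> Pair 0 ` C) = UNIV"
proof -
  let ?D = "(\<lambda>b. (b, 0)) ` B \<union> Pair 0 ` C :: ('a \<times> 'b) set"
  show "finite ?D" using assms by simp
  have "linear (\<lambda>x :: 'a. (x, 0 :: 'b))" "linear (Pair 0 :: 'b \<Rightarrow> 'a \<times> 'b)"
    by (simp_all add: linear_iff)
  then have "(\<lambda>x. (x, 0 :: 'b)) ` span B = span ((\<lambda>b. (b, 0)) ` B)" "Pair 0 ` span C = span (Pair (0 :: 'a) ` C)"
    by (simp_all add: linear_span_image)
  then have "(x, 0) \<in> span ?D" "(0, y) \<in> span ?D" for x y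
    using assms span_mono[of "(\<lambda>b. (b, 0)) ` B" ?D] span_mono[of "Pair 0 ` C" ?D] by auto
  then have "(x, 0) + (0, y) \<in> span ?D" for x y by (intro span_add)
  then show "span ?D = UNIV" by auto
qed

text \<open>In a product chart the field is the first component of the smooth field \<open>Z\<close>
  restricted to a slice over \<open>k\<close>. Restriction to the slice and projection do not
  increase a Lipschitz constant.\<close>

lemma right_invariant_field_loc_Lipschitz:
  assumes G: "Lie_group G GM" and Z: "fundamental_vf G GM (prod_manifold GM M) (bundle_action G) v Z"
    and M: "smooth_manifold (M :: ('k, 'c::real_normed_vector) manifold)" and k: "k \<in> points M"
  shows "loc_Lipschitz_field (GM :: ('g, 'b::real_normed_vector) manifold) (right_invariant_field G GM v)"
  unfolding loc_Lipschitz_field_def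
proof (intro ballI)
  fix p c assume p: "p \<in> points GM" and c: "c \<in> charts_at GM p"
  note GM' = Lie_groupD(2)[OF G] and M' = diff_manifold_if_smooth[OF M]
  note GxM = diff_manifold_prod[OF GM' M']
  obtain d where d: "d \<in> charts_at M k" using ex_chart_at[OF M' k] by blast
  note c' = chart_at[OF GM' c] and d' = chart_at[OF M' d]
  let ?e = "prod_chart c d"
  have fin: "\<exists>B :: ('b \<times> 'c) set. finite B \<and> span B = UNIV"
    using Lie_groupD(1)[OF G] M finite_spanning_prod unfolding smooth_manifold_def by metis
  have vf: "vector_field (prod_manifold GM M) Z" using Z by (simp add: fundamental_vf_def)
  obtain \<delta> L where \<delta>: "\<delta> > 0" and L: "L \<ge> 0"
    and sub: "ball (snd ?e (p, k)) \<delta> \<subseteq> snd ?e ` fst ?e"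
    and lip: "\<And>y z. y \<in> ball (snd ?e (p, k)) \<delta> \<Longrightarrow> z \<in> ball (snd ?e (p, k)) \<delta> \<Longrightarrow>
      norm (Z (chart_inv ?e y) ?e - Z (chart_inv ?e z) ?e) \<le> L * norm (y - z)"
    using vector_field_chart_Lipschitz[OF fin GxM vf prod_chart_at[OF c d]] by blast
  \<comment> \<open>Points with equal second coordinate have the distance of their first
    coordinates, so the radius carries over unchanged.\<close>
  have ball: "(y, snd d k) \<in> ball (snd ?e (p, k)) \<delta>" if "y \<in> ball (snd c p) \<delta>" for y
    using that by (simp add: dist_Pair_Pair)
  have img: "y \<in> snd c ` fst c" if "y \<in> ball (snd c p) \<delta>" for y
    using subsetD[OF sub ball[OF that]] by auto
  have W: "right_invariant_field G GM v (chart_inv c y) c = fst (Z (chart_inv ?e (y, snd d k)) ?e)"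
    if "y \<in> ball (snd c p) \<delta>" for y
  proof -
    have "chart_inv ?e (y, snd d k) = (chart_inv c y, k)"
      using prod_chart_inv[OF c'(5) d'(5) img[OF that], of "snd d k"] d'(2,6) by simp
    moreover have "c \<in> charts_at GM (chart_inv c y)"
      using c'(1) inv_into_into[OF img[OF that]] by (simp add: charts_at_def)
    ultimately show ?thesis using right_invariant_field_chart[OF G Z M' _ d] by simp
  qed
  have "norm (right_invariant_field G GM v (chart_inv c y) c - right_invariant_field G GM v (chart_inv c z) c)
      \<le> L * norm (y - z)" if y: "y \<in> ball (snd c p) \<delta>" and z: "z \<in> ball (snd c p) \<delta>" for y z
  proof -
    have "norm (fst (Z (chart_inv ?e (y, snd d k)) ?e - Z (chart_inv ?e (z, snd d k)) ?e))
        \<le> norm (Z (chart_inv ?e (y, snd d k)) ?e - Z (chart_inv ?e (z, snd d k)) ?e)"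
      by (metis norm_fst_le prod.collapse)
    also have "\<dots> \<le> L * norm ((y, snd d k) - (z, snd d k))" by (rule lip[OF ball[OF y] ball[OF z]])
    finally show ?thesis unfolding W[OF y] W[OF z] by simp
  qed
  then show "\<exists>\<delta>>0. \<exists>L\<ge>0. ball (snd c p) \<delta> \<subseteq> snd c ` fst c \<and> (\<forall>y\<in>ball (snd c p) \<delta>. \<forall>z\<in>ball (snd c p) \<delta>.
      norm (right_invariant_field G GM v (chart_inv c y) c - right_invariant_field G GM v (chart_inv c z) c)
      \<le> L * norm (y - z))"
    using \<delta> L img by blast
qed

lemma right_invariant_field_tangent:
  assumes "Lie_group G GM" "g \<in> points GM"
  shows "right_invariant_field G GM v g \<in> tangent_space GM g"
proof -
  interpret group G by (rule Lie_groupD(3)[OF assms(1)])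
  note GM = Lie_groupD(2)[OF assms(1)]
  have g: "g \<in> carrier G" using assms Lie_groupD(4) by blast
  from differential_in_tangent_space[OF GM GM mdiff_right_mult[OF assms(1) one_closed g]] g
  show ?thesis by (simp add: right_invariant_field_def)
qed

text \<open>Right translations map solutions to solutions, so local solutions can be continued along the
  whole interval on which the coefficients are defined.\<close>

lemma right_invariant_system_solution:
  fixes W :: "'i \<Rightarrow> ('g, 'b::real_normed_vector) vfield" and a :: "'i \<Rightarrow> real \<Rightarrow> real"
  assumes G: "Lie_group G GM" and A: "finite A"
    and lip: "\<And>\<alpha>. \<alpha> \<in> A \<Longrightarrow> loc_Lipschitz_field GM (W \<alpha>)"
    and W: "\<And>\<alpha>. \<alpha> \<in> A \<Longrightarrow> \<exists>v \<gamma>. one_parameter_subgroup G GM v \<gamma> \<and> W \<alpha> = right_invariant_field G GM v"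
    and a: "\<And>\<alpha>. \<alpha> \<in> A \<Longrightarrow> continuous_on UNIV (a \<alpha>)"
    and I: "open I" "convex I" "0 \<in> I"
  shows "\<exists>g. g 0 = \<one>\<^bsub>G\<^esub> \<and> (\<forall>t\<in>I. has_velocity GM g (\<lambda>c. \<Sum>\<alpha>\<in>A. a \<alpha> t *\<^sub>R W \<alpha> (g t) c) t)"
proof -
  interpret group G by (rule Lie_groupD(3)[OF G])
  note GM = Lie_groupD(2)[OF G] and carrier = Lie_groupD(4)[OF G]
  have fin: "\<exists>B :: 'b set. finite B \<and> span B = UNIV"
    using Lie_groupD(1)[OF G] by (simp add: smooth_manifold_def)
  have tangent: "W \<alpha> p \<in> tangent_space GM p" if "\<alpha> \<in> A" "p \<in> points GM" for \<alpha> p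
    using W[OF that(1)] right_invariant_field_tangent[OF G that(2)] by auto
  define sol where "sol = (\<lambda>J g. \<forall>t\<in>J. has_velocity GM g (\<lambda>c. \<Sum>\<alpha>\<in>A. a \<alpha> t *\<^sub>R W \<alpha> (g t) c) t)"
  have in_carrier: "g t \<in> carrier G" if "sol J g" "t \<in> J" for J g t
    using that has_velocityD(3) carrier unfolding sol_def by blast
  have translate: "sol J (\<lambda>t. g t \<otimes>\<^bsub>G\<^esub> h)" if J: "sol J g" and h: "h \<in> carrier G" for J g h
    unfolding sol_def
  proof
    fix t assume t: "t \<in> J"
    note gt = in_carrier[OF J t]
    show "has_velocity GM (\<lambda>t. g t \<otimes>\<^bsub>G\<^esub> h) (\<lambda>c. \<Sum>\<alpha>\<in>A. a \<alpha> t *\<^sub>R W \<alpha> (g t \<otimes>\<^bsub>G\<^esub> h) c) t"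
    proof (rule has_velocity_pushforward[where F = "\<lambda>x. x \<otimes>\<^bsub>G\<^esub> h" and g = g, OF GM GM])
      show "mdiff GM GM (\<lambda>x. x \<otimes>\<^bsub>G\<^esub> h) (g t)" by (rule mdiff_right_mult[OF G gt h])
      show "has_velocity GM g (\<lambda>c. \<Sum>\<alpha>\<in>A. a \<alpha> t *\<^sub>R W \<alpha> (g t) c) t" using J t by (simp add: sol_def)
      show "\<exists>\<sigma>. \<sigma> 0 = g t \<and> has_velocity GM \<sigma> (W \<alpha> (g t)) 0 \<and>
          has_velocity GM (\<lambda>s. \<sigma> s \<otimes>\<^bsub>G\<^esub> h) (W \<alpha> (g t \<otimes>\<^bsub>G\<^esub> h)) 0" if "\<alpha> \<in> A" for \<alpha>
        using W[OF that] right_invariant_field_related[OF G _ gt h] by metis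
    qed
  qed
  have unique: "g t = h t"
    if "convex J" "sol J g" "sol J h" "s \<in> J" "g s = h s" "t \<in> J" for J g h s t
    by (rule integral_curve_unique[where \<gamma> = g and \<eta> = h, OF Lie_groupD(1)[OF G] A lip a that(1) _ _ that(4-6)])
      (use that(2,3) in \<open>auto simp: sol_def\<close>)
  have cong: "has_velocity GM h (\<lambda>c. \<Sum>\<alpha>\<in>A. a \<alpha> t *\<^sub>R W \<alpha> (h t) c) t"
    if "sol J g" "open J" "t \<in> J" "\<And>s. s \<in> J \<Longrightarrow> h s = g s" for J g h t
  proof (rule has_velocity_cong[where \<gamma> = g])
    show "has_velocity GM g (\<lambda>c. \<Sum>\<alpha>\<in>A. a \<alpha> t *\<^sub>R W \<alpha> (h t) c) t" using that by (simp add: sol_def)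
    have "\<forall>\<^sub>F s in at t. s \<in> J" using that(2,3) by (rule eventually_at_in_open')
    then show "\<forall>\<^sub>F s in at t. g s = h s" by eventually_elim (simp add: that(4))
  qed (simp add: that)
  \<comment> \<open>Two times are related if one solution covers both. No initial value is
    prescribed, which makes this symmetric and, thanks to right translations, transitive;
    connectedness of \<open>I\<close> then relates 0 to every time.\<close>
  define R where "R = (\<lambda>s t. \<exists>J g. open J \<and> convex J \<and> J \<subseteq> I \<and> s \<in> J \<and> t \<in> J \<and> sol J g)"
  have R: "R 0 t" if t: "t \<in> I" for t
  proof (rule connected_equivalence_relation[OF convex_connected[OF I(2)] I(3) t])
    show "R y x" if "R x y" for x y using that unfolding R_def by blast
    show "R x z" if "R x y" "R y z" for x y z
    proof -
      obtain J1 g1 where 1: "open J1" "convex J1" "J1 \<subseteq> I" "x \<in> J1" "y \<in> J1" "sol J1 g1"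
        using \<open>R x y\<close> unfolding R_def by blast
      obtain J2 g2 where 2: "open J2" "convex J2" "J2 \<subseteq> I" "y \<in> J2" "z \<in> J2" "sol J2 g2"
        using \<open>R y z\<close> unfolding R_def by blast
      \<comment> \<open>The second solution is translated by the constant that makes it meet the
        first at \<open>y\<close>; uniqueness then makes them agree on the whole overlap, so they
        can be glued.\<close>
      define h where "h = (\<lambda>t. g2 t \<otimes>\<^bsub>G\<^esub> (inv\<^bsub>G\<^esub> g2 y \<otimes>\<^bsub>G\<^esub> g1 y))"
      have y: "g1 y \<in> carrier G" "g2 y \<in> carrier G"
        using in_carrier[OF 1(6,5)] in_carrier[OF 2(6,4)] by simp_all
      have h: "sol J2 h" unfolding h_def using y by (intro translate[OF 2(6)]) simp
      have "h y = g1 y" using y by (simp add: h_def flip: m_assoc)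
      have eq: "g1 t = h t" if "t \<in> J1" "t \<in> J2" for t
      proof (rule unique[of "J1 \<inter> J2"])
        show "convex (J1 \<inter> J2)" using 1(2) 2(2) by (rule convex_Int)
        show "sol (J1 \<inter> J2) g1" "sol (J1 \<inter> J2) h" using 1(6) h by (simp_all add: sol_def)
      qed (use 1 2 that \<open>h y = g1 y\<close> in auto)
      define g where "g = (\<lambda>t. if t \<in> J1 then g1 t else h t)"
      have "sol (J1 \<union> J2) g"
        unfolding sol_def
      proof
        fix t assume "t \<in> J1 \<union> J2"
        then show "has_velocity GM g (\<lambda>c. \<Sum>\<alpha>\<in>A. a \<alpha> t *\<^sub>R W \<alpha> (g t) c) t"
          using cong[OF 1(6,1), of t g] cong[OF h 2(1), of t g] eq by (auto simp: g_def)
      qed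
      moreover have "convex (J1 \<union> J2)"
        using connected_Un[of J1 J2] 1 2 convex_connected
        by (auto simp: is_interval_convex_1[symmetric] is_interval_connected_1)
      ultimately show ?thesis unfolding R_def using 1 2 by (intro exI[of _ "J1 \<union> J2"]) auto
    qed
    fix t assume "t \<in> I"
    \<comment> \<open>Any starting point would do, since \<open>R\<close> leaves the initial value
      free.\<close>
    have "\<one>\<^bsub>G\<^esub> \<in> points GM" using carrier by auto
    from local_integral_curve[where Y = W and a = a and t\<^sub>0 = t, OF fin GM A lip tangent a this]
    obtain \<epsilon> g where \<epsilon>: "\<epsilon> > 0" "sol {t - \<epsilon><..<t + \<epsilon>} g"
      unfolding sol_def by blast
    obtain \<delta> where \<delta>: "\<delta> > 0" "ball t \<delta> \<subseteq> I" using I(1) \<open>t \<in> I\<close> open_contains_ball by blast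
    define T where "T = ball t (min \<epsilon> \<delta>)"
    have T: "T \<subseteq> {t - \<epsilon><..<t + \<epsilon>}" "T \<subseteq> I" "open T" "convex T" "t \<in> T"
      using \<epsilon> \<delta> by (auto simp: T_def dist_real_def)
    then have "sol T g" using \<epsilon>(2) by (auto simp: sol_def)
    then have "\<forall>x\<in>T. R t x" using T unfolding R_def by blast
    moreover have "openin (top_of_set I) T" using T by (simp add: open_subset)
    ultimately show "\<exists>T. openin (top_of_set I) T \<and> t \<in> T \<and> (\<forall>x\<in>T. R t x)" using T by blast
  qed
  have "\<exists>J g. open J \<and> convex J \<and> 0 \<in> J \<and> t \<in> J \<and> sol J g \<and> g 0 = \<one>\<^bsub>G\<^esub>" if t: "t \<in> I" for t
  proof -
    obtain J g where J: "open J" "convex J" "0 \<in> J" "t \<in> J" "sol J g" using R[OF t] unfolding R_def by blast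
    note g0 = in_carrier[OF J(5,3)]
    \<comment> \<open>Translation by the inverse of the value at 0 normalises the initial condition
      to the identity.\<close>
    have "sol J (\<lambda>t. g t \<otimes>\<^bsub>G\<^esub> inv\<^bsub>G\<^esub> g 0)" using g0 by (intro translate[OF J(5)]) simp
    with J g0 show ?thesis by (intro exI[of _ J] exI[of _ "\<lambda>t. g t \<otimes>\<^bsub>G\<^esub> inv\<^bsub>G\<^esub> g 0"]) simp
  qed
  then have "\<forall>t. \<exists>J g. t \<in> I \<longrightarrow> open J \<and> convex J \<and> 0 \<in> J \<and> t \<in> J \<and> sol J g \<and> g 0 = \<one>\<^bsub>G\<^esub>"
    by blast
  from choice[OF this] obtain J where "\<forall>t. \<exists>g. t \<in> I \<longrightarrow> open (J t) \<and> convex (J t) \<and> 0 \<in> J t \<and> t \<in> J t \<and>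
      sol (J t) g \<and> g 0 = \<one>\<^bsub>G\<^esub>" ..
  from choice[OF this] obtain g where Jg: "\<forall>t. t \<in> I \<longrightarrow> open (J t) \<and> convex (J t) \<and> 0 \<in> J t \<and> t \<in> J t \<and>
      sol (J t) (g t) \<and> g t 0 = \<one>\<^bsub>G\<^esub>" ..
  have J: "open (J t)" "convex (J t)" "0 \<in> J t" "t \<in> J t" "sol (J t) (g t)" "g t 0 = \<one>\<^bsub>G\<^esub>" if "t \<in> I" for t
    using Jg that by simp_all
  \<comment> \<open>The global solution is the diagonal of the chosen family. By uniqueness it
    coincides with the single solution \<open>g t\<close> on all of \<open>J t \<inter> I\<close>,
    hence has the right velocity at \<open>t\<close>.\<close>
  have eq: "g s s = g t s" if "s \<in> I" "t \<in> I" "s \<in> J t" for s t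
  proof (rule unique[of "J s \<inter> J t" "g s" "g t" 0 s])
    show "convex (J s \<inter> J t)" using J(2) that by (intro convex_Int)
    show "sol (J s \<inter> J t) (g s)" "sol (J s \<inter> J t) (g t)" using J(5) that by (auto simp: sol_def)
  qed (use J that in auto)
  have "has_velocity GM (\<lambda>t. g t t) (\<lambda>c. \<Sum>\<alpha>\<in>A. a \<alpha> t *\<^sub>R W \<alpha> (g t t) c) t" if t: "t \<in> I" for t
  proof (rule cong)
    show "sol (J t \<inter> I) (g t)" using J(5)[OF t] by (simp add: sol_def)
    show "open (J t \<inter> I)" using J(1)[OF t] I(1) by (rule open_Int)
  qed (use J(4) t eq in auto)
  then show ?thesis using J(6)[OF I(3)] by (intro exI[of _ "\<lambda>t. g t t"]) simp
qed

section \<open>The solution over the leaf and its action on the initial point\<close>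

theorem theorem7p2:
  fixes N :: "('n, 'a::real_normed_vector) manifold"
    and V :: "('n, 'a) vfield set"
    and r :: nat
    and Xs :: "nat \<Rightarrow> ('n, 'a) vfield"
    and f :: "nat \<Rightarrow> real \<Rightarrow> 'n \<Rightarrow> real"
    and X :: "real \<Rightarrow> ('n, 'a) vfield"
    and G :: "'g monoid"
    and GM :: "('g, 'b::real_normed_vector) manifold"
    and D :: "('g \<times> 'n) set"
    and \<phi> :: "'g \<Rightarrow> 'n \<Rightarrow> 'n"
    and M :: "('n set, 'c::real_normed_vector) manifold"
    and v :: "nat \<Rightarrow> ('g, 'b) tvec"
    and XR :: "nat \<Rightarrow> ('g \<times> 'n set, 'b \<times> 'c) vfield"
  defines "GxM \<equiv> prod_manifold GM M"
    and "X\<^sub>\<pi> \<equiv> automorphic_system r (\<lambda>\<alpha> t k. - leaf_fun (f \<alpha> t) k) XR"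
  assumes N: "smooth_manifold N"
    and X: "foliated_Lie_system N V r Xs f X"
    and G: "Lie_group G GM"
    and \<phi>: "local_Lie_group_action G GM N D \<phi>"
    and eff: "effective_action G N D \<phi>"
    and int: "integrates G GM N \<phi> V"
    and M: "smooth_manifold M"
    and M_leaves: "points M = leaves TYPE('l::real_normed_vector) N V"
    and proj: "submersion N M (leaf_proj (points M))"
    and v: "\<And>\<alpha>. \<alpha> < r \<Longrightarrow> fundamental_vf G GM N \<phi> (v \<alpha>) (Xs \<alpha>)"
    and XR: "\<And>\<alpha>. \<alpha> < r \<Longrightarrow>
               fundamental_vf G GM GxM (bundle_action G) (v \<alpha>) (\<lambda>p c. - XR \<alpha> p c)"
    and x: "particular_solution N X I x" and I0: "0 \<in> I"
    and k: "k \<in> points M" "\<forall>t\<in>I. x t \<in> k"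
  shows "\<exists>g. particular_solution GxM X\<^sub>\<pi> I (\<lambda>t. (g t, k)) \<and> g 0 = \<one>\<^bsub>G\<^esub> \<and>
           (\<forall>g'. particular_solution GxM X\<^sub>\<pi> I (\<lambda>t. (g' t, k)) \<and> g' 0 = \<one>\<^bsub>G\<^esub> \<longrightarrow>
                 (\<forall>t\<in>I. g' t = g t)) \<and>
           (\<forall>t\<in>I. (\<forall>t'\<in>closed_segment 0 t. (g t', x 0) \<in> D) \<longrightarrow> x t = \<phi> (g t) (x 0))"
proof -
  interpret group G by (rule Lie_groupD(3)[OF G])
  note GM' = Lie_groupD(2)[OF G] and carrier = Lie_groupD(4)[OF G]
  note N' = diff_manifold_if_smooth[OF N] and M' = diff_manifold_if_smooth[OF M]
  have GxM': "diff_manifold GxM" unfolding GxM_def by (rule diff_manifold_prod[OF GM' M'])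
  have I: "open I" "convex I" and vel_x: "\<And>t. t \<in> I \<Longrightarrow> has_velocity N x (X t (x t)) t"
    using x by (simp_all add: particular_solution_def is_interval_convex_1)
  have x0: "x 0 \<in> k" "x 0 \<in> points N" using k(2) I0 has_velocityD(3)[OF vel_x[OF I0]] by simp_all
  have V: "V = vf_span r Xs" and Xs: "\<And>\<alpha>. \<alpha> < r \<Longrightarrow> vector_field N (Xs \<alpha>)"
    using X by (simp_all add: foliated_Lie_system_def lie_algebra_with_basis_def)
  have X_eq: "X = (\<lambda>t x c. \<Sum>\<alpha><r. f \<alpha> t x *\<^sub>R Xs \<alpha> x c)"
    using X unfolding foliated_Lie_system_def by blast
  have f: "smooth_map (prod_manifold vspace N) vspace (\<lambda>(t, x). f \<alpha> t x)" if "\<alpha> < r" for \<alpha>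
    using X that by (simp add: foliated_Lie_system_def)
  define a where "a = (\<lambda>\<alpha> t. leaf_fun (f \<alpha> t) k)"
  have a_eq: "a \<alpha> t = f \<alpha> t y" if \<alpha>: "\<alpha> < r" and y: "y \<in> k" for \<alpha> t y
    unfolding a_def
  proof (rule leaf_fun_eq[OF N _ y])
    show "k \<in> leaves TYPE('l) N (vf_span r Xs)" using k(1) M_leaves V by simp
    show "mdiff N vspace (f \<alpha> t) z" if "z \<in> points N" for z
      using mdiff_slice_right[OF diff_manifold_vspace N' f[OF \<alpha>], of t z] that by simp
    show "apply_vf N (Xs \<beta>) (f \<alpha> t) z = 0" if "z \<in> points N" "\<beta> < r" for z \<beta>
      using X that \<alpha> by (simp add: foliated_Lie_system_def)
  qed
  \<comment> \<open>Constancy on the leaf gives \<open>a \<alpha> t = f \<alpha> t (x 0)\<close>, a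
    restriction of the continuous function \<open>f \<alpha>\<close> to the line through
    \<open>x 0\<close>; this covers all times and not only those in \<open>I\<close>.\<close>
  have a_cont: "continuous_on UNIV (a \<alpha>)" if \<alpha>: "\<alpha> \<in> {..<r}" for \<alpha>
  proof -
    have "continuous_map (prod_topology euclidean (mtop N)) euclidean (\<lambda>(t, x). f \<alpha> t x)"
      using f[of \<alpha>] \<alpha>
      by (simp only: smooth_map_on_def subtopology_topspace mtop_prod_manifold mtop_vspace lessThan_iff)
    moreover have "continuous_map euclidean (prod_topology euclidean (mtop N)) (\<lambda>t :: real. (t, x 0))"
      using x0(2) by (simp add: continuous_map_pairwise o_def)
    ultimately have "continuous_map euclidean euclidean ((\<lambda>(t, x). f \<alpha> t x) \<circ> (\<lambda>t. (t, x 0)))"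
      by (rule continuous_map_compose[rotated])
    moreover have "(\<lambda>(t, x). f \<alpha> t x) \<circ> (\<lambda>t. (t, x 0)) = a \<alpha>"
      using a_eq[OF _ x0(1)] \<alpha> by (simp add: fun_eq_iff)
    ultimately show ?thesis by simp
  qed
  define W where "W = (\<lambda>\<alpha>. right_invariant_field G GM (v \<alpha>))"
  \<comment> \<open>The minus sign of the system is moved from the coefficients to the fields:
    \<open>Z \<alpha>\<close> is fundamental for \<open>v \<alpha>\<close>, and the system becomes
    the combination of the \<open>Z \<alpha>\<close> with coefficients \<open>a \<alpha> t\<close>,
    matching that of \<open>X\<close>.\<close>
  define Z where "Z = (\<lambda>\<alpha> p c. - XR \<alpha> p c)"
  have Z: "fundamental_vf G GM (prod_manifold GM M) (bundle_action G) (v \<alpha>) (Z \<alpha>)" if "\<alpha> < r" for \<alpha>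
    using XR[OF that] by (simp add: Z_def GxM_def)
  have X\<^sub>\<pi>: "X\<^sub>\<pi> t (g, k) = (\<lambda>c. \<Sum>\<alpha><r. a \<alpha> t *\<^sub>R Z \<alpha> (g, k) c)" for t g
    by (simp add: X\<^sub>\<pi>_def automorphic_system_def a_def Z_def)
  have W_lip: "loc_Lipschitz_field GM (W \<alpha>)" if "\<alpha> \<in> {..<r}" for \<alpha>
    unfolding W_def using right_invariant_field_loc_Lipschitz[OF G Z M k(1)] that by simp
  have W_subgroup: "\<exists>v \<gamma>. one_parameter_subgroup G GM v \<gamma> \<and> W \<alpha> = right_invariant_field G GM v"
    if "\<alpha> \<in> {..<r}" for \<alpha>
    unfolding W_def using v[of \<alpha>] that by (auto simp: fundamental_vf_def)
  have related: "\<exists>\<sigma>. \<sigma> 0 = h \<and> has_velocity GM \<sigma> (W \<alpha> h) 0 \<and> has_velocity GxM (\<lambda>s. (\<sigma> s, k)) (Z \<alpha> (h, k)) 0"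
    if "\<alpha> \<in> {..<r}" "h \<in> points GM" for \<alpha> h
    unfolding W_def GxM_def using bundle_fundamental_vf[OF G Z _ k(1)] that carrier by simp
  obtain g where g0: "g 0 = \<one>\<^bsub>G\<^esub>" and
    g: "\<And>t. t \<in> I \<Longrightarrow> has_velocity GM g (\<lambda>c. \<Sum>\<alpha><r. a \<alpha> t *\<^sub>R W \<alpha> (g t) c) t"
    using right_invariant_system_solution[where W = W and a = a and A = "{..<r}",
        OF G finite_lessThan W_lip W_subgroup a_cont I I0] by blast
  have lift: "particular_solution GxM X\<^sub>\<pi> I (\<lambda>t. (g t, k))"
    unfolding particular_solution_def X\<^sub>\<pi>
  proof (intro conjI ballI)
    fix t assume t: "t \<in> I"
    note gt = has_velocityD(3)[OF g[OF t]]
    show "has_velocity GxM (\<lambda>t. (g t, k)) (\<lambda>c. \<Sum>\<alpha><r. a \<alpha> t *\<^sub>R Z \<alpha> (g t, k) c) t"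
    proof (rule has_velocity_pushforward[where F = "\<lambda>h. (h, k)" and g = g, OF GM' GxM'])
      show "mdiff GM GxM (\<lambda>h. (h, k)) (g t)" unfolding GxM_def by (rule mdiff_Pair_left[OF GM' gt k(1)])
    qed (use g[OF t] related[OF _ gt] in auto)
  qed (use I in \<open>simp_all add: is_interval_convex_1\<close>)
  \<comment> \<open>A competing lift projects to a curve in G that solves the same right-invariant
    system with the same initial value, so uniqueness can be applied in G.\<close>
  moreover have "g' t = g t"
    if g': "particular_solution GxM X\<^sub>\<pi> I (\<lambda>t. (g' t, k))" "g' 0 = \<one>\<^bsub>G\<^esub>" and t: "t \<in> I" for g' t
  proof (rule integral_curve_unique[where \<gamma> = g' and \<eta> = g, OF Lie_groupD(1)[OF G] finite_lessThan
        W_lip a_cont I(2) _ g I0 _ t])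
    fix s assume s: "s \<in> I"
    have vel: "has_velocity GxM (\<lambda>t. (g' t, k)) (\<lambda>c. \<Sum>\<alpha><r. a \<alpha> s *\<^sub>R Z \<alpha> (g' s, k) c) s"
      using g'(1) s by (simp add: particular_solution_def X\<^sub>\<pi>)
    have gs: "g' s \<in> points GM" using has_velocityD(3)[OF vel] by (simp add: GxM_def)
    have "has_velocity GM (\<lambda>s. fst (g' s, k)) (\<lambda>c. \<Sum>\<alpha><r. a \<alpha> s *\<^sub>R W \<alpha> (g' s) c) s"
    proof (rule has_velocity_pushforward[where F = fst and g = "\<lambda>s. (g' s, k)", OF GxM' GM' _ vel])
      show "mdiff GxM GM fst (g' s, k)" unfolding GxM_def by (rule mdiff_fst[OF GM' M' gs k(1)])
      fix \<alpha> assume "\<alpha> \<in> {..<r}"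
      then obtain \<sigma> where "\<sigma> 0 = g' s" "has_velocity GM \<sigma> (W \<alpha> (g' s)) 0"
        "has_velocity GxM (\<lambda>s. (\<sigma> s, k)) (Z \<alpha> (g' s, k)) 0"
        using related[OF _ gs] by blast
      then show "\<exists>\<sigma>. \<sigma> 0 = (g' s, k) \<and> has_velocity GxM \<sigma> (Z \<alpha> (g' s, k)) 0 \<and>
          has_velocity GM (\<lambda>s. fst (\<sigma> s)) (W \<alpha> (g' s)) 0"
        by (intro exI[of _ "\<lambda>s. (\<sigma> s, k)"]) simp
    qed
    then show "has_velocity GM g' (\<lambda>c. \<Sum>\<alpha><r. a \<alpha> s *\<^sub>R W \<alpha> (g' s) c) s" by simp
  qed (use g0 g' in auto)
  \<comment> \<open>Both curves are compared on the closed segment from 0 to \<open>t\<close>, where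
    the domain assumption is available.\<close>
  moreover have "x t = \<phi> (g t) (x 0)"
    if t: "t \<in> I" and D: "\<forall>t'\<in>closed_segment 0 t. (g t', x 0) \<in> D" for t
  proof (rule integral_curve_unique[where \<gamma> = x and \<eta> = "\<lambda>s. \<phi> (g s) (x 0)" and Y = Xs, OF N finite_lessThan
        _ a_cont convex_closed_segment])
    show "loc_Lipschitz_field N (Xs \<alpha>)" if "\<alpha> \<in> {..<r}" for \<alpha>
      using loc_Lipschitz_field_if_vector_field[OF N Xs] that by simp
    show "x 0 = \<phi> (g 0) (x 0)" using \<phi> x0(2) g0 by (simp add: local_Lie_group_action_def)
    show "0 \<in> closed_segment 0 t" "t \<in> closed_segment 0 t" by simp_all
    fix s assume s: "s \<in> closed_segment 0 t"
    then have sI: "s \<in> I" using closed_segment_subset[OF I0 t I(2)] by blast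
    show "has_velocity N x (\<lambda>c. \<Sum>\<alpha><r. a \<alpha> s *\<^sub>R Xs \<alpha> (x s) c) s"
      using vel_x[OF sI] a_eq[OF _ bspec[OF k(2) sI]] by (simp add: X_eq)
    note gs = has_velocityD(3)[OF g[OF sI]]
    have gs': "g s \<in> carrier G" using gs carrier by simp
    have smooth: "smooth_map_on D (prod_manifold GM N) N (\<lambda>(g, x). \<phi> g x)"
      and act1: "\<And>x. x \<in> points N \<Longrightarrow> (\<one>\<^bsub>G\<^esub>, x) \<in> D \<and> \<phi> \<one>\<^bsub>G\<^esub> x = x"
      and act: "\<And>g h x. g \<in> carrier G \<Longrightarrow> h \<in> carrier G \<Longrightarrow> x \<in> points N \<Longrightarrow>
        (h, x) \<in> D \<Longrightarrow> (g, \<phi> h x) \<in> D \<Longrightarrow> (g \<otimes>\<^bsub>G\<^esub> h, x) \<in> D \<Longrightarrow>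
        \<phi> (g \<otimes>\<^bsub>G\<^esub> h) x = \<phi> g (\<phi> h x)"
      using \<phi> by (simp_all add: local_Lie_group_action_def)
    have openD: "openin (prod_topology (mtop GM) (mtop N)) D"
      using smooth by (simp add: smooth_map_on_def)
    have Ds: "(g s, x 0) \<in> D" using D s by blast
    have md: "mdiff GM N (\<lambda>h. \<phi> h (x 0)) (g s)" by (rule mdiff_slice_left[OF GM' N' smooth Ds])
    define y where "y = \<phi> (g s) (x 0)"
    have y: "y \<in> points N" using md by (simp add: mdiff_def y_def)
    show "has_velocity N (\<lambda>s. \<phi> (g s) (x 0)) (\<lambda>c. \<Sum>\<alpha><r. a \<alpha> s *\<^sub>R Xs \<alpha> (\<phi> (g s) (x 0)) c) s"
    proof (rule has_velocity_pushforward[where F = "\<lambda>h. \<phi> h (x 0)" and g = g, OF GM' N' md g[OF sI]])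
      fix \<alpha> assume \<alpha>: "\<alpha> \<in> {..<r}"
      obtain \<gamma> where \<gamma>: "one_parameter_subgroup G GM (v \<alpha>) \<gamma>" and
        vel: "\<forall>x\<in>points N. has_velocity N (\<lambda>t. \<phi> (\<gamma> (- t)) x) (Xs \<alpha> x) 0"
        using v[of \<alpha>] \<alpha> by (auto simp: fundamental_vf_def)
      note \<gamma>' = one_parameter_subgroupD[OF G \<gamma>]
      \<comment> \<open>The test curve exp(-t v) g(s). The local action law turns its action on
        \<open>x 0\<close> into that of exp(-t v) on \<open>y\<close>, whose velocity is
        \<open>Xs \<alpha> y\<close>. The law needs three domain conditions: one holds at the fixed
        point \<open>(g s, x 0)\<close>, and \<open>D1\<close> and \<open>D2\<close> provide the
        others for small \<open>t\<close> because \<open>D\<close> is open.\<close>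
      define \<sigma> where "\<sigma> = (\<lambda>t. \<gamma> (- t) \<otimes>\<^bsub>G\<^esub> g s)"
      have \<sigma>0: "\<sigma> 0 = g s" using gs' \<gamma>'(2) by (simp add: \<sigma>_def)
      have \<sigma>: "has_velocity GM \<sigma> (W \<alpha> (g s)) 0"
        unfolding \<sigma>_def W_def by (rule right_invariant_field_velocity[OF G \<gamma> gs'])
      have "limitin (prod_topology (mtop GM) (mtop N)) (\<lambda>t. (\<sigma> t, x 0)) (g s, x 0) (at 0)"
        using limitin_mdiff[OF mdiff_Pair_left[OF GM' gs x0(2)]] has_velocityD(1)[OF \<sigma>] \<sigma>0 by simp
      from limitinD[OF this openD Ds] have D1: "\<forall>\<^sub>F t in at 0. (\<sigma> t, x 0) \<in> D" .
      have "\<one>\<^bsub>G\<^esub> \<in> points GM" using carrier by auto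
      from limitin_mdiff[OF mdiff_Pair_left[OF GM' this y]] has_velocityD(1)[OF \<gamma>'(3)] \<gamma>'(2)
      have "limitin (prod_topology (mtop GM) (mtop N)) (\<lambda>t. (\<gamma> (- t), y)) (\<one>\<^bsub>G\<^esub>, y) (at 0)" by simp
      from limitinD[OF this openD] act1[OF y] have D2: "\<forall>\<^sub>F t in at 0. (\<gamma> (- t), y) \<in> D" by simp
      have "has_velocity N (\<lambda>t. \<phi> (\<sigma> t) (x 0)) (Xs \<alpha> y) 0"
      proof (rule has_velocity_cong[OF bspec[OF vel y]])
        show "\<forall>\<^sub>F t in at 0. \<phi> (\<gamma> (- t)) y = \<phi> (\<sigma> t) (x 0)"
          using D1 D2
          by eventually_elim (use act[OF \<gamma>'(1) gs' x0(2) Ds] in \<open>simp add: \<sigma>_def y_def\<close>)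
        show "\<phi> (\<gamma> (- 0)) y = \<phi> (\<sigma> 0) (x 0)" using \<sigma>0 \<gamma>'(2) act1[OF y] by (simp add: y_def)
      qed
      with \<sigma> \<sigma>0 show "\<exists>\<sigma>. \<sigma> 0 = g s \<and> has_velocity GM \<sigma> (W \<alpha> (g s)) 0 \<and>
          has_velocity N (\<lambda>t. \<phi> (\<sigma> t) (x 0)) (Xs \<alpha> (\<phi> (g s) (x 0))) 0"
        unfolding y_def by blast
    qed
  qed
  ultimately show ?thesis using g0 by blast
qed

end
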